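(* Let $E$ be an infinite dimensional real vector space, $\chi:E\to\mathbb{C}$ a characteristic function with $\chi(0)=1$, $\mu$ the corresponding measure on $(E^a,\mathcal{B}_E)$, and $1\le p<\infty$. Then the cocone $(\mathscr{L}^p(\mathfrak{R}),\psi_R)$ is a realization of the colimit in $\mathfrak{Ban}$ of the codiagram $(L^p(R^a,\mu_R),\pi_{RF}^* )$ indexed by $\mathcal{R}$, and the map $$\mathfrak{L}_p:(\mathscr{L}^p(\mathfrak{R}),\psi_R)\to(L^p(E^a,\mu),\varphi_R^* ),\qquad (f_R)_R\mapsto\lim_{R\in\mathcal{R}}\varphi_R^*(f_R),$$ is an isomorphism of cocones with inverse $$\mathfrak{L}_p^{-1}:(L^p(E^a,\mu),\varphi_R^* )\to(\mathscr{L}^p(\mathfrak{R}),\psi_R),\qquad f\mapsto\big([\varphi_R^*]^{-1}(\mathbb{E}_R(f))\big)_{R\in\mathcal{R}},$$ where $\mathbb{E}_R(f)=\mathbb{E}[f\,|\,\mathcal{B}^R]$ is the conditional expectation of $f\in L^p(E^a,\mu)$ with respect to the $\sigma$-algebra $\mathcal{B}^R=\{\varphi_R^{-1}(B):B\in\mathcal{B}_R\}$, $\mathcal{B}_R$ being the Borel $\sigma$-algebra of $R^a$.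
   Context: $E^a$ is the algebraic dual of $E$. For $\xi\in E$ let $\xi_*:E^a\to\mathbb{R}$, $\xi_*(\ell)=\ell(\xi)$, and $\mathcal{B}_E=\sigma(\{\xi_*^{-1}(B):\xi\in E,\ B\subset\mathbb{R}\text{ Borel}\})$. $\mathcal{R}$ is the set of finite dimensional subspaces of $E$, directed by inclusion (written $R\le F$). A characteristic function is a map $\chi:E\to\mathbb{C}$ such that $\sum_{j,k=1}^n\alpha_j\bar\alpha_k\chi(\xi_j-\xi_k)\ge0$ for all $n\in\mathbb{N}$, $\xi_j\in E$, $\alpha_j\in\mathbb{C}$, and $\chi|_R$ is continuous for the Euclidean topology on each $R\in\mathcal{R}$. By the Bochner–Minlos theorem there is a unique measure $\mu$ on $(E^a,\mathcal{B}_E)$ with $\chi(\xi)=\int_{E^a}e^{i\ell(\xi)}\,\mathrm{d}\mu(\ell)$ for all $\xi\in E$ (the corresponding measure). For $R\in\mathcal{R}$, $\mu_R$ is the Borel measure on $R^a$ corresponding in the same way to $\chi|_R$. For $R\le F$, $\pi_{RF}:F^a\to R^a$, $\pi_{RF}(\ell)=\ell|_R$; and $\varphi_R:E^a\to R^a$, $\varphi_R(\ell)=\ell|_R$. These maps are measure preserving. $L^p$ spaces are of real-valued functions, $f^*(u)=u\circ f$; $\mathbb{E}_R(f)$ lies in the range of the isometry $\varphi_R^*$. $\mathfrak{R}$ denotes the diagram $(R^a,\mu_R,\pi_{RF})$ indexed by $\mathcal{R}$. A family $(f_R)_R\in\prod_{R\in\mathcal{R}}L^p(R^a,\mu_R)$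 is co-Cauchy if for every $\varepsilon>0$ there is $R_0\in\mathcal{R}$ with $\|\pi_{RF}^*(f_R)-f_F\|_{L^p(\mu_F)}<\varepsilon$ whenever $R_0\le R\le F$. $\mathscr{L}^p(\mathfrak{R})$ is the vector space of co-Cauchy families modulo $(f_R)\sim(g_R)$ iff $\lim_{R\in\mathcal{R}}\|f_R-g_R\|_{L^p(\mu_R)}=0$ (net limit), with norm $\lim_{R\in\mathcal{R}}\|f_R\|_{L^p(\mu_R)}$. $\psi_R:L^p(R^a,\mu_R)\to\mathscr{L}^p(\mathfrak{R})$ sends $f_R$ to the class of $(g_F)_{F\in\mathcal{R}}$ with $g_F=\pi_{RF}^*(f_R)$ if $R\le F$ and $g_F=0$ otherwise. $\mathfrak{Ban}$ is the category of Banach spaces with linear isometries (not necessarily surjective) as morphisms. A cocone of a codiagram $(Z_R,\varphi_{RF}:Z_R\to Z_F)$ is a Banach space $Y$ with linear isometries $\psi_R:Z_R\to Y$ satisfying $\psi_R=\psi_F\circ\varphi_{RF}$ for $R\le F$; it is a realization of the colimit if for every cocone $(Y',\rho_R)$ there is a unique linear isometry $\varphi:Y\to Y'$ with $\varphi\circ\psi_R=\rho_R$ for all $R$. An isomorphism of cocones $(Y,\psi_R)\to(Y',\rho_R)$ is a surjective linear isometry $T:Y\to Y'$ with $T\circ\psi_R=\rho_R$ for all $R$. *)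

theory Defs
  imports "HOL-Probability.Probability"
begin

section \<open>Banach spaces with an explicit carrier, and the category of linear isometries\<close>

text \<open>
  The spaces that occur below are quotients whose carriers depend on a measure or on a
  family of measures, so they cannot be types of class \<open>banach\<close>.
\<close>

record 'a nvs =
  vcarrier :: "'a set"
  vadd :: "'a \<Rightarrow> 'a \<Rightarrow> 'a"
  vzero :: "'a"
  vscale :: "real \<Rightarrow> 'a \<Rightarrow> 'a"
  vnorm :: "'a \<Rightarrow> real"

definition vdiff :: "'a nvs \<Rightarrow> 'a \<Rightarrow> 'a \<Rightarrow> 'a" where
  "vdiff V x y = vadd V x (vscale V (-1) y)"

locale normed_space_on =
  fixes V :: "'a nvs"
  assumes add_closed: "\<lbrakk>x \<in> vcarrier V; y \<in> vcarrier V\<rbrakk> \<Longrightarrow> vadd V x y \<in> vcarrier V"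
    and zero_closed: "vzero V \<in> vcarrier V"
    and scale_closed: "x \<in> vcarrier V \<Longrightarrow> vscale V c x \<in> vcarrier V"
    and add_assoc: "\<lbrakk>x \<in> vcarrier V; y \<in> vcarrier V; z \<in> vcarrier V\<rbrakk>
      \<Longrightarrow> vadd V (vadd V x y) z = vadd V x (vadd V y z)"
    and add_commute: "\<lbrakk>x \<in> vcarrier V; y \<in> vcarrier V\<rbrakk> \<Longrightarrow> vadd V x y = vadd V y x"
    and add_zero: "x \<in> vcarrier V \<Longrightarrow> vadd V x (vzero V) = x"
    and add_inverse: "x \<in> vcarrier V \<Longrightarrow> vadd V x (vscale V (-1) x) = vzero V"
    and scale_one: "x \<in> vcarrier V \<Longrightarrow> vscale V 1 x = x"
    and scale_scale: "x \<in> vcarrier V \<Longrightarrow> vscale V a (vscale V b x) = vscale V (a * b) x"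
    and scale_add_right: "\<lbrakk>x \<in> vcarrier V; y \<in> vcarrier V\<rbrakk>
      \<Longrightarrow> vscale V a (vadd V x y) = vadd V (vscale V a x) (vscale V a y)"
    and scale_add_left: "x \<in> vcarrier V
      \<Longrightarrow> vscale V (a + b) x = vadd V (vscale V a x) (vscale V b x)"
    and norm_nonneg: "x \<in> vcarrier V \<Longrightarrow> 0 \<le> vnorm V x"
    and norm_eq_zero: "x \<in> vcarrier V \<Longrightarrow> vnorm V x = 0 \<longleftrightarrow> x = vzero V"
    and norm_scale: "x \<in> vcarrier V \<Longrightarrow> vnorm V (vscale V c x) = \<bar>c\<bar> * vnorm V x"
    and norm_triangle: "\<lbrakk>x \<in> vcarrier V; y \<in> vcarrier V\<rbrakk>
      \<Longrightarrow> vnorm V (vadd V x y) \<le> vnorm V x + vnorm V y"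

definition vlimit :: "'a nvs \<Rightarrow> ('i \<Rightarrow> 'a) \<Rightarrow> 'a \<Rightarrow> 'i filter \<Rightarrow> bool" where
  "vlimit V x l F \<longleftrightarrow> l \<in> vcarrier V \<and> ((\<lambda>i. vnorm V (vdiff V (x i) l)) \<longlongrightarrow> 0) F"

definition vLim :: "'a nvs \<Rightarrow> 'i filter \<Rightarrow> ('i \<Rightarrow> 'a) \<Rightarrow> 'a" where
  "vLim V F x = (THE l. vlimit V x l F)"

locale banach_space_on = normed_space_on +
  assumes complete:
    "\<lbrakk>\<And>n::nat. x n \<in> vcarrier V;
      \<And>e. 0 < e \<Longrightarrow> \<exists>N. \<forall>m\<ge>N. \<forall>n\<ge>N. vnorm V (vdiff V (x m) (x n)) < e\<rbrakk>
      \<Longrightarrow> \<exists>l. vlimit V x l sequentially"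

definition linear_isometry :: "'a nvs \<Rightarrow> 'b nvs \<Rightarrow> ('a \<Rightarrow> 'b) \<Rightarrow> bool" where
  "linear_isometry V W T \<longleftrightarrow>
     T \<in> vcarrier V \<rightarrow> vcarrier W \<and>
     (\<forall>x\<in>vcarrier V. \<forall>y\<in>vcarrier V. T (vadd V x y) = vadd W (T x) (T y)) \<and>
     (\<forall>c. \<forall>x\<in>vcarrier V. T (vscale V c x) = vscale W c (T x)) \<and>
     (\<forall>x\<in>vcarrier V. vnorm W (T x) = vnorm V x)"

text \<open>
  Morphisms are HOL functions on the ambient type; only their values on the carrier matter,
  so equality of morphisms always means equality on the carrier.
\<close>

definition codiagram ::
  "'i::order set \<Rightarrow> ('i \<Rightarrow> 'z nvs) \<Rightarrow> ('i \<Rightarrow> 'i \<Rightarrow> 'z \<Rightarrow> 'z) \<Rightarrow> bool" where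
  "codiagram I Z \<phi> \<longleftrightarrow>
     (\<forall>R\<in>I. banach_space_on (Z R)) \<and>
     (\<forall>R\<in>I. \<forall>F\<in>I. R \<le> F \<longrightarrow> linear_isometry (Z R) (Z F) (\<phi> R F)) \<and>
     (\<forall>R\<in>I. \<forall>z\<in>vcarrier (Z R). \<phi> R R z = z) \<and>
     (\<forall>R\<in>I. \<forall>F\<in>I. \<forall>G\<in>I. R \<le> F \<and> F \<le> G \<longrightarrow>
        (\<forall>z\<in>vcarrier (Z R). \<phi> F G (\<phi> R F z) = \<phi> R G z))"

definition cocone ::
  "'i::order set \<Rightarrow> ('i \<Rightarrow> 'z nvs) \<Rightarrow> ('i \<Rightarrow> 'i \<Rightarrow> 'z \<Rightarrow> 'z) \<Rightarrow>
   'y nvs \<Rightarrow> ('i \<Rightarrow> 'z \<Rightarrow> 'y) \<Rightarrow> bool" where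
  "cocone I Z \<phi> Y \<psi> \<longleftrightarrow>
     banach_space_on Y \<and>
     (\<forall>R\<in>I. linear_isometry (Z R) Y (\<psi> R)) \<and>
     (\<forall>R\<in>I. \<forall>F\<in>I. R \<le> F \<longrightarrow> (\<forall>z\<in>vcarrier (Z R). \<psi> R z = \<psi> F (\<phi> R F z)))"

text \<open>
  HOL cannot quantify over types inside a formula: the competing cocones live in the type
  \<open>'y\<close>, over which a theorem about \<open>realizes_colimit TYPE('y)\<close> is universally quantified.
\<close>

definition realizes_colimit ::
  "'w itself \<Rightarrow> 'i::order set \<Rightarrow> ('i \<Rightarrow> 'z nvs) \<Rightarrow> ('i \<Rightarrow> 'i \<Rightarrow> 'z \<Rightarrow> 'z) \<Rightarrow>
   'y nvs \<Rightarrow> ('i \<Rightarrow> 'z \<Rightarrow> 'y) \<Rightarrow> bool" where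
  "realizes_colimit (_ :: 'w itself) I Z \<phi> Y \<psi> \<longleftrightarrow>
     codiagram I Z \<phi> \<and> cocone I Z \<phi> Y \<psi> \<and>
     (\<forall>(Y' :: 'w nvs) \<rho>. cocone I Z \<phi> Y' \<rho> \<longrightarrow>
        (\<exists>T. linear_isometry Y Y' T \<and>
             (\<forall>R\<in>I. \<forall>z\<in>vcarrier (Z R). T (\<psi> R z) = \<rho> R z) \<and>
             (\<forall>T'. linear_isometry Y Y' T' \<and>
                   (\<forall>R\<in>I. \<forall>z\<in>vcarrier (Z R). T' (\<psi> R z) = \<rho> R z) \<longrightarrow>
                   (\<forall>y\<in>vcarrier Y. T' y = T y))))"

definition cocone_iso ::
  "'i::order set \<Rightarrow> ('i \<Rightarrow> 'z nvs) \<Rightarrow> ('i \<Rightarrow> 'i \<Rightarrow> 'z \<Rightarrow> 'z) \<Rightarrow>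
   'y nvs \<Rightarrow> ('i \<Rightarrow> 'z \<Rightarrow> 'y) \<Rightarrow> 'w nvs \<Rightarrow> ('i \<Rightarrow> 'z \<Rightarrow> 'w) \<Rightarrow> ('y \<Rightarrow> 'w) \<Rightarrow> bool" where
  "cocone_iso I Z \<phi> Y \<psi> Y' \<rho> T \<longleftrightarrow>
     cocone I Z \<phi> Y \<psi> \<and> cocone I Z \<phi> Y' \<rho> \<and>
     linear_isometry Y Y' T \<and> T ` vcarrier Y = vcarrier Y' \<and>
     (\<forall>R\<in>I. \<forall>z\<in>vcarrier (Z R). T (\<psi> R z) = \<rho> R z)"

text \<open>Convergence along a directed set, given as a subset of an ordered type.\<close>

definition net :: "'i::order set \<Rightarrow> 'i filter" where
  "net I = (INF R\<in>I. principal {F \<in> I. R \<le> F})"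


section \<open>\<open>L\<^sup>p\<close> spaces\<close>

definition Lp_fun :: "real \<Rightarrow> 'a measure \<Rightarrow> ('a \<Rightarrow> real) set" where
  "Lp_fun p M = {f \<in> borel_measurable M. integrable M (\<lambda>x. \<bar>f x\<bar> powr p)}"

definition Lp_class :: "real \<Rightarrow> 'a measure \<Rightarrow> ('a \<Rightarrow> real) \<Rightarrow> ('a \<Rightarrow> real) set" where
  "Lp_class p M f = {g \<in> Lp_fun p M. AE x in M. g x = f x}"

text \<open>
  Operations on classes are lifted from representatives by the idiom
  \<open>\<Union>f\<in>A. [\<dots> f \<dots>]\<close> of \<open>HOL.Equiv_Relations\<close>.
\<close>

definition Lp :: "real \<Rightarrow> 'a measure \<Rightarrow> ('a \<Rightarrow> real) set nvs" where
  "Lp p M = \<lparr>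
     vcarrier = Lp_class p M ` Lp_fun p M,
     vadd = (\<lambda>A B. \<Union>f\<in>A. \<Union>g\<in>B. Lp_class p M (\<lambda>x. f x + g x)),
     vzero = Lp_class p M (\<lambda>_. 0),
     vscale = (\<lambda>c A. \<Union>f\<in>A. Lp_class p M (\<lambda>x. c * f x)),
     vnorm = (\<lambda>A. the_elem ((\<lambda>f. (\<integral>x. \<bar>f x\<bar> powr p \<partial>M) powr (1 / p)) ` A))\<rparr>"

text \<open>The pullback \<open>f \<mapsto> f \<circ> h\<close> as a map into \<open>L\<^sup>p(M)\<close>.\<close>

definition Lp_pullback ::
  "real \<Rightarrow> 'a measure \<Rightarrow> ('a \<Rightarrow> 'b) \<Rightarrow> ('b \<Rightarrow> real) set \<Rightarrow> ('a \<Rightarrow> real) set" where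
  "Lp_pullback p M h A = (\<Union>f\<in>A. Lp_class p M (f \<circ> h))"

definition Lp_cond_exp ::
  "real \<Rightarrow> 'a measure \<Rightarrow> 'a measure \<Rightarrow> ('a \<Rightarrow> real) set \<Rightarrow> ('a \<Rightarrow> real) set" where
  "Lp_cond_exp p M F A = (\<Union>f\<in>A. Lp_class p M (real_cond_exp M F f))"


section \<open>Finite dimensional subspaces and algebraic duals\<close>

definition fin_dim_subspaces :: "'e::real_vector set set" where
  "fin_dim_subspaces = {R. \<exists>B. finite B \<and> span B = R}"

text \<open>
  The algebraic dual of a subspace; functionals are undefined outside of it.
  In particular \<open>alg_dual UNIV\<close> is the dual \<open>E\<^sup>a\<close> of the whole space.
\<close>

definition alg_dual :: "'e::real_vector set \<Rightarrow> ('e \<Rightarrow> real) set" where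
  "alg_dual V = {l \<in> extensional V.
     (\<forall>x\<in>V. \<forall>y\<in>V. l (x + y) = l x + l y) \<and> (\<forall>c. \<forall>x\<in>V. l (c *\<^sub>R x) = c * l x)}"

lemma alg_dual_UNIV: "alg_dual UNIV = {l. linear l}"
  by (auto simp: alg_dual_def extensional_def linear_iff)

text \<open>
  Both \<open>\<pi>\<^sub>R\<^sub>F : F\<^sup>a \<rightarrow> R\<^sup>a\<close> and \<open>\<phi>\<^sub>R : E\<^sup>a \<rightarrow> R\<^sup>a\<close> are the following map, taken on
  \<open>alg_dual F\<close> and on \<open>alg_dual UNIV\<close>, respectively.
\<close>

definition restr :: "'e set \<Rightarrow> ('e \<Rightarrow> real) \<Rightarrow> ('e \<Rightarrow> real)" where
  "restr R l = restrict l R"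

lemma restr_alg_dual:
  "\<lbrakk>R \<subseteq> F; subspace R; l \<in> alg_dual F\<rbrakk> \<Longrightarrow> restr R l \<in> alg_dual R"
  by (auto simp: alg_dual_def restr_def subspace_add subspace_scale subset_iff)

text \<open>
  The Euclidean topologies of a finite dimensional \<open>R\<close> and of \<open>R\<^sup>a\<close>, transported from
  \<open>\<real>\<^sup>B\<close> along the coordinates with respect to a basis \<open>B\<close> of \<open>R\<close> and its dual basis.
  The topologies do not depend on the choice of \<open>B\<close>.
\<close>

definition basis_of :: "'e::real_vector set \<Rightarrow> 'e set" where
  "basis_of R = (SOME B. independent B \<and> span B = R)"

definition euclid_top :: "'e::real_vector set \<Rightarrow> 'e topology" where
  "euclid_top R = pullback_topology R
     (\<lambda>x. restrict (representation (basis_of R) x) (basis_of R)) (powertop_real (basis_of R))"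

definition dual_euclid_top :: "'e::real_vector set \<Rightarrow> ('e \<Rightarrow> real) topology" where
  "dual_euclid_top R = pullback_topology (alg_dual R)
     (\<lambda>l. restrict l (basis_of R)) (powertop_real (basis_of R))"

lemma topspace_euclid_top: "topspace (euclid_top R) = R"
  by (auto simp: euclid_top_def topspace_pullback_topology)

lemma topspace_dual_euclid_top: "topspace (dual_euclid_top R) = alg_dual R"
  by (auto simp: dual_euclid_top_def topspace_pullback_topology)

definition borel_of :: "'a topology \<Rightarrow> 'a measure" where
  "borel_of X = sigma (topspace X) {U. openin X U}"

text \<open>The cylinder \<open>\<sigma>\<close>-algebra \<open>\<B>\<^sub>E\<close> on \<open>E\<^sup>a\<close>.\<close>

definition cyl_algebra :: "('e::real_vector \<Rightarrow> real) measure" where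
  "cyl_algebra = sigma (alg_dual UNIV)
     {{l \<in> alg_dual UNIV. l \<xi> \<in> B} | \<xi> B. B \<in> sets borel}"

text \<open>The sub-\<open>\<sigma>\<close>-algebra \<open>\<B>\<^sup>R\<close> on \<open>E\<^sup>a\<close>.\<close>

definition cyl_subalgebra :: "'e::real_vector set \<Rightarrow> ('e \<Rightarrow> real) measure" where
  "cyl_subalgebra R = vimage_algebra (alg_dual UNIV) (restr R) (borel_of (dual_euclid_top R))"


section \<open>Characteristic functions and corresponding measures\<close>

definition char_function :: "('e::real_vector \<Rightarrow> complex) \<Rightarrow> bool" where
  "char_function ch \<longleftrightarrow>
     (\<forall>(n::nat) \<xi> \<alpha>. (\<Sum>j<n. \<Sum>k<n. \<alpha> j * cnj (\<alpha> k) * ch (\<xi> j - \<xi> k)) \<in> nonneg_Reals) \<and>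
     (\<forall>R\<in>fin_dim_subspaces. continuous_map (euclid_top R) euclidean ch)"

text \<open>
  \<open>M\<close> is the measure on the dual of the subspace \<open>V\<close>, with the \<open>\<sigma>\<close>-algebra of \<open>A\<close>, that
  corresponds to \<open>ch\<close> restricted to \<open>V\<close>.
\<close>

definition corresponding_measure ::
  "('e::real_vector \<Rightarrow> complex) \<Rightarrow> 'e set \<Rightarrow> ('e \<Rightarrow> real) measure \<Rightarrow> ('e \<Rightarrow> real) measure \<Rightarrow> bool"
  where
  "corresponding_measure ch V A M \<longleftrightarrow>
     sets M = sets A \<and> finite_measure M \<and>
     (\<forall>\<xi>\<in>V. ch \<xi> = (\<integral>l. exp (\<i> * complex_of_real (l \<xi>)) \<partial>M))"


section \<open>The space of co-Cauchy families\<close>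

text \<open>
  In this section \<open>\<nu> R\<close> is the measure on \<open>R\<^sup>a\<close>, for \<open>R\<close> in \<open>fin_dim_subspaces\<close>.
\<close>

definition co_Cauchy ::
  "real \<Rightarrow> ('e::real_vector set \<Rightarrow> ('e \<Rightarrow> real) measure) \<Rightarrow> ('e set \<Rightarrow> (('e \<Rightarrow> real) \<Rightarrow> real) set) set"
  where
  "co_Cauchy p \<nu> = {f \<in> (\<Pi>\<^sub>E R\<in>fin_dim_subspaces. vcarrier (Lp p (\<nu> R))).
     \<forall>\<epsilon>>0. \<exists>R0\<in>fin_dim_subspaces. \<forall>R\<in>fin_dim_subspaces. \<forall>F\<in>fin_dim_subspaces.
       R0 \<subseteq> R \<and> R \<subseteq> F \<longrightarrow>
       vnorm (Lp p (\<nu> F)) (vdiff (Lp p (\<nu> F)) (Lp_pullback p (\<nu> F) (restr R) (f R)) (f F)) < \<epsilon>}"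

definition co_rel ::
  "real \<Rightarrow> ('e::real_vector set \<Rightarrow> ('e \<Rightarrow> real) measure) \<Rightarrow>
   ('e set \<Rightarrow> (('e \<Rightarrow> real) \<Rightarrow> real) set) rel"
  where
  "co_rel p \<nu> = {(f, g). f \<in> co_Cauchy p \<nu> \<and> g \<in> co_Cauchy p \<nu> \<and>
     ((\<lambda>R. vnorm (Lp p (\<nu> R)) (vdiff (Lp p (\<nu> R)) (f R) (g R))) \<longlongrightarrow> 0) (net fin_dim_subspaces)}"

definition coLp ::
  "real \<Rightarrow> ('e::real_vector set \<Rightarrow> ('e \<Rightarrow> real) measure) \<Rightarrow>
   ('e set \<Rightarrow> (('e \<Rightarrow> real) \<Rightarrow> real) set) set nvs"
  where
  "coLp p \<nu> = \<lparr>
     vcarrier = co_Cauchy p \<nu> // co_rel p \<nu>,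
     vadd = (\<lambda>A B. \<Union>f\<in>A. \<Union>g\<in>B.
       co_rel p \<nu> `` {\<lambda>R\<in>fin_dim_subspaces. vadd (Lp p (\<nu> R)) (f R) (g R)}),
     vzero = co_rel p \<nu> `` {\<lambda>R\<in>fin_dim_subspaces. vzero (Lp p (\<nu> R))},
     vscale = (\<lambda>c A. \<Union>f\<in>A. co_rel p \<nu> `` {\<lambda>R\<in>fin_dim_subspaces. vscale (Lp p (\<nu> R)) c (f R)}),
     vnorm = (\<lambda>A. the_elem
       ((\<lambda>f. Lim (net fin_dim_subspaces) (\<lambda>R. vnorm (Lp p (\<nu> R)) (f R))) ` A))\<rparr>"

text \<open>The structure maps \<open>\<psi>\<^sub>R\<close>.\<close>

definition coLp_inj ::
  "real \<Rightarrow> ('e::real_vector set \<Rightarrow> ('e \<Rightarrow> real) measure) \<Rightarrow> 'e set \<Rightarrow>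
   (('e \<Rightarrow> real) \<Rightarrow> real) set \<Rightarrow> ('e set \<Rightarrow> (('e \<Rightarrow> real) \<Rightarrow> real) set) set"
  where
  "coLp_inj p \<nu> R A = co_rel p \<nu> `` {\<lambda>F\<in>fin_dim_subspaces.
     if R \<subseteq> F then Lp_pullback p (\<nu> F) (restr R) A else vzero (Lp p (\<nu> F))}"

text \<open>The map \<open>\<LL>\<^sub>p\<close> and its proposed inverse; \<open>\<mu>\<close> is the measure on \<open>E\<^sup>a\<close>.\<close>

definition frakL ::
  "real \<Rightarrow> ('e::real_vector \<Rightarrow> real) measure \<Rightarrow>
   ('e set \<Rightarrow> (('e \<Rightarrow> real) \<Rightarrow> real) set) set \<Rightarrow> (('e \<Rightarrow> real) \<Rightarrow> real) set"
  where
  "frakL p \<mu> C = the_elem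
     ((\<lambda>f. vLim (Lp p \<mu>) (net fin_dim_subspaces) (\<lambda>R. Lp_pullback p \<mu> (restr R) (f R))) ` C)"

definition frakL_inv ::
  "real \<Rightarrow> ('e::real_vector \<Rightarrow> real) measure \<Rightarrow> ('e set \<Rightarrow> ('e \<Rightarrow> real) measure) \<Rightarrow>
   (('e \<Rightarrow> real) \<Rightarrow> real) set \<Rightarrow> ('e set \<Rightarrow> (('e \<Rightarrow> real) \<Rightarrow> real) set) set"
  where
  "frakL_inv p \<mu> \<nu> A = co_rel p \<nu> `` {\<lambda>R\<in>fin_dim_subspaces.
     inv_into (vcarrier (Lp p (\<nu> R))) (Lp_pullback p \<mu> (restr R))
       (Lp_cond_exp p \<mu> (cyl_subalgebra R) A)}"

end

theory Submission
  imports Defs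
begin

text \<open>
  The proof separates the category theory from the probability theory.

  On the categorical side, consider any directed codiagram of Banach spaces and isometries and any
  cocone \<open>(Y, \<psi>)\<close> of it.  Since the structure maps are isometries, a family \<open>(f\<^sub>R)\<close> is co-Cauchy
  exactly when the net \<open>\<psi>\<^sub>R f\<^sub>R\<close> is Cauchy in \<open>Y\<close>, that is, when it converges
  (\<open>cauchy_families_iff\<close>); equivalent families are those with the same limit (\<open>family_rel_iff\<close>), and
  the norm of a class is the norm of this limit.  So \<open>(f\<^sub>R) \<mapsto> lim \<psi>\<^sub>R f\<^sub>R\<close> is a well defined linear
  isometry from the space of classes into every cocone, compatible with the structure maps, and it
  is the only one, because a class is the limit of the images of its components.  If each point of
  one particular cocone is such a limit, then this isometry is onto; the space of classes inherits
  completeness from that cocone and is a realization of the colimit (\<open>colim_space_colimit\<close>).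

  It remains to show that \<open>L\<^sup>p(E\<^sup>a, \<mu>)\<close> is a cocone of this kind.  It is a cocone because the restriction
  maps preserve the measures (\<open>restr_measure_preserving\<close>): the image of \<open>\<mu>\<close> in \<open>R\<^sup>a\<close> has the Fourier
  transform of \<open>\<mu>\<^sub>R\<close>, and a finite measure on \<open>R\<^sup>a\<close> is determined by its Fourier transform
  (\<open>dual_measure_eqI_char\<close>).  That theorem is reduced to the uniqueness theorem on the line one
  coordinate at a time (\<open>joint_events_eqI_char\<close>).  Every \<open>f\<close> in \<open>L\<^sup>p(E\<^sup>a, \<mu>)\<close> is the limit of the net
  \<open>\<bbbE>\<^sub>R(f)\<close>, because the cylinder \<open>\<sigma>\<close>-algebra is generated by the directed family of the \<open>\<B>\<^sup>R\<close>
  (\<open>Lp_cond_exp_convergence\<close>), and \<open>\<bbbE>\<^sub>R(f)\<close> factors through \<open>R\<^sup>a\<close> by the Doob--Dynkin lemma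
  (\<open>measurable_vimage_algebra_factor\<close>), so it is \<open>\<phi>\<^sub>R\<^sup>*\<close> of an element of \<open>L\<^sup>p(R\<^sup>a, \<mu>\<^sub>R)\<close>.  These elements
  form the family that the inverse of \<open>\<LL>\<^sub>p\<close> assigns to \<open>f\<close>.
\<close>

section \<open>Normed spaces with a carrier\<close>

lemma UN_eq_common_value: "\<lbrakk>\<And>x. x \<in> A \<Longrightarrow> h x = S; a \<in> A\<rbrakk> \<Longrightarrow> (\<Union>x\<in>A. h x) = S"
  by auto

lemma vlimit_cong:
  assumes "\<forall>\<^sub>F i in F. x i = y i" and "vlimit V x l F"
  shows "vlimit V y l F"
proof -
  have "\<forall>\<^sub>F i in F. vnorm V (vdiff V (x i) l) = vnorm V (vdiff V (y i) l)"
    using assms(1) by eventually_elim simp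
  from tendsto_cong[OF this] show ?thesis
    using assms(2) by (simp add: vlimit_def)
qed

context normed_space_on
begin

lemma diff_closed: "\<lbrakk>x \<in> vcarrier V; y \<in> vcarrier V\<rbrakk> \<Longrightarrow> vdiff V x y \<in> vcarrier V"
  by (simp add: vdiff_def add_closed scale_closed)

lemma diff_self: "x \<in> vcarrier V \<Longrightarrow> vdiff V x x = vzero V"
  by (simp add: vdiff_def add_inverse)

lemma zero_add: "x \<in> vcarrier V \<Longrightarrow> vadd V (vzero V) x = x"
  using add_commute add_zero zero_closed by metis

lemma inverse_add: "x \<in> vcarrier V \<Longrightarrow> vadd V (vscale V (-1) x) x = vzero V"
  using add_commute add_inverse scale_closed by metis

lemma add_left_commute:
  "\<lbrakk>x \<in> vcarrier V; y \<in> vcarrier V; z \<in> vcarrier V\<rbrakk>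
    \<Longrightarrow> vadd V x (vadd V y z) = vadd V y (vadd V x z)"
  using add_commute add_assoc by metis

lemma diff_eq_zero_iff:
  assumes "x \<in> vcarrier V" "y \<in> vcarrier V"
  shows "vdiff V x y = vzero V \<longleftrightarrow> x = y"
proof
  assume *: "vdiff V x y = vzero V"
  have "x = vadd V x (vadd V (vscale V (-1) y) y)"
    using assms by (simp add: inverse_add add_zero)
  also have "\<dots> = vadd V (vdiff V x y) y"
    using assms by (simp add: vdiff_def add_assoc scale_closed)
  finally show "x = y"
    using assms * by (simp add: zero_add)
qed (use assms in \<open>simp add: diff_self\<close>)

lemma norm_diff_eq_zero_iff:
  "\<lbrakk>x \<in> vcarrier V; y \<in> vcarrier V\<rbrakk> \<Longrightarrow> vnorm V (vdiff V x y) = 0 \<longleftrightarrow> x = y"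
  by (simp add: norm_eq_zero diff_closed diff_eq_zero_iff)

lemma scale_diff:
  "\<lbrakk>x \<in> vcarrier V; y \<in> vcarrier V\<rbrakk>
    \<Longrightarrow> vdiff V (vscale V c x) (vscale V c y) = vscale V c (vdiff V x y)"
  by (simp add: vdiff_def scale_add_right scale_closed scale_scale)

lemma diff_add_diff:
  "\<lbrakk>x \<in> vcarrier V; y \<in> vcarrier V; z \<in> vcarrier V\<rbrakk>
    \<Longrightarrow> vadd V (vdiff V x y) (vdiff V y z) = vdiff V x z"
  unfolding vdiff_def
  by (metis add_assoc add_closed inverse_add zero_add scale_closed)

lemma add_diff_add:
  "\<lbrakk>x \<in> vcarrier V; y \<in> vcarrier V; x' \<in> vcarrier V; y' \<in> vcarrier V\<rbrakk>
    \<Longrightarrow> vdiff V (vadd V x y) (vadd V x' y') = vadd V (vdiff V x x') (vdiff V y y')"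
  by (simp add: vdiff_def scale_add_right add_assoc add_left_commute scale_closed add_closed)

lemma diff_zero: "x \<in> vcarrier V \<Longrightarrow> vdiff V x (vzero V) = x"
proof -
  assume x: "x \<in> vcarrier V"
  have "vscale V (-1) (vzero V) = vzero V"
    using add_inverse[OF zero_closed] zero_add[OF scale_closed[OF zero_closed]] by simp
  then show ?thesis using x by (simp add: vdiff_def add_zero)
qed

lemma norm_diff_commute:
  assumes "x \<in> vcarrier V" "y \<in> vcarrier V"
  shows "vnorm V (vdiff V x y) = vnorm V (vdiff V y x)"
proof -
  have "vscale V (-1) (vdiff V x y) = vdiff V y x"
    using assms by (simp add: vdiff_def scale_add_right scale_closed scale_scale scale_one add_commute)
  then show ?thesis
    using norm_scale[OF diff_closed[OF assms], of "-1"] by simp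
qed

lemma norm_diff_triangle:
  "\<lbrakk>x \<in> vcarrier V; y \<in> vcarrier V; z \<in> vcarrier V\<rbrakk>
    \<Longrightarrow> vnorm V (vdiff V x z) \<le> vnorm V (vdiff V x y) + vnorm V (vdiff V y z)"
  by (metis diff_add_diff norm_triangle diff_closed)

lemma norm_diff_triangle2:
  "\<lbrakk>x \<in> vcarrier V; y \<in> vcarrier V; z \<in> vcarrier V\<rbrakk>
    \<Longrightarrow> vnorm V (vdiff V x z) \<le> vnorm V (vdiff V y x) + vnorm V (vdiff V y z)"
  using norm_diff_triangle norm_diff_commute by metis

lemma abs_norm_diff_le:
  assumes "x \<in> vcarrier V" "y \<in> vcarrier V"
  shows "\<bar>vnorm V x - vnorm V y\<bar> \<le> vnorm V (vdiff V x y)"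
  using norm_diff_triangle[OF assms zero_closed]
    norm_diff_triangle[OF assms(2,1) zero_closed] norm_diff_commute[OF assms] assms
  by (simp add: diff_zero)

lemma vlimit_unique:
  assumes "F \<noteq> bot" and "\<forall>\<^sub>F i in F. x i \<in> vcarrier V"
    and "vlimit V x l F" and "vlimit V x l' F"
  shows "l = l'"
proof -
  have c: "l \<in> vcarrier V" "l' \<in> vcarrier V"
    using assms by (auto simp: vlimit_def)
  have "((\<lambda>i. vnorm V (vdiff V (x i) l) + vnorm V (vdiff V (x i) l')) \<longlongrightarrow> 0 + 0) F"
    using assms(3,4) unfolding vlimit_def by (intro tendsto_add) auto
  moreover have "\<forall>\<^sub>F i in F. vnorm V (vdiff V l l')
      \<le> vnorm V (vdiff V (x i) l) + vnorm V (vdiff V (x i) l')"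
    using assms(2) by eventually_elim (simp add: norm_diff_triangle2 c)
  ultimately have "vnorm V (vdiff V l l') \<le> 0"
    using tendsto_lowerbound[OF _ _ assms(1)] by fastforce
  then have "vnorm V (vdiff V l l') = 0"
    using norm_nonneg[OF diff_closed[OF c]] by simp
  then show ?thesis using c by (simp add: norm_diff_eq_zero_iff)
qed

lemma vLim_eqI:
  assumes "F \<noteq> bot" and "\<forall>\<^sub>F i in F. x i \<in> vcarrier V" and "vlimit V x l F"
  shows "vLim V F x = l"
  unfolding vLim_def using vlimit_unique[OF assms(1,2)] assms(3) by blast

lemma vlimit_eventually_const:
  assumes "l \<in> vcarrier V" "\<forall>\<^sub>F i in F. x i = l"
  shows "vlimit V x l F"
proof -
  have "\<forall>\<^sub>F i in F. vnorm V (vdiff V (x i) l) = 0"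
    using assms(2) by eventually_elim (simp add: norm_diff_eq_zero_iff assms)
  then show ?thesis using assms(1) by (simp add: vlimit_def tendsto_eventually)
qed

lemma vlimit_add:
  assumes "\<forall>\<^sub>F i in F. x i \<in> vcarrier V" "\<forall>\<^sub>F i in F. y i \<in> vcarrier V"
    and "vlimit V x l F" "vlimit V y m F"
  shows "vlimit V (\<lambda>i. vadd V (x i) (y i)) (vadd V l m) F"
proof -
  have c: "l \<in> vcarrier V" "m \<in> vcarrier V"
    using assms by (auto simp: vlimit_def)
  have *: "((\<lambda>i. vnorm V (vdiff V (x i) l) + vnorm V (vdiff V (y i) m)) \<longlongrightarrow> 0) F"
    using assms(3,4) unfolding vlimit_def by (intro tendsto_add_zero) auto
  have "((\<lambda>i. vnorm V (vdiff V (vadd V (x i) (y i)) (vadd V l m))) \<longlongrightarrow> 0) F"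
  proof (rule tendsto_sandwich[OF _ _ tendsto_const *])
    show "\<forall>\<^sub>F i in F. 0 \<le> vnorm V (vdiff V (vadd V (x i) (y i)) (vadd V l m))"
      using assms(1,2) by eventually_elim (simp add: norm_nonneg diff_closed add_closed c)
    show "\<forall>\<^sub>F i in F. vnorm V (vdiff V (vadd V (x i) (y i)) (vadd V l m))
        \<le> vnorm V (vdiff V (x i) l) + vnorm V (vdiff V (y i) m)"
      using assms(1,2)
      by eventually_elim (simp add: add_diff_add norm_triangle diff_closed c)
  qed
  then show ?thesis using c by (simp add: vlimit_def add_closed)
qed

lemma vlimit_scale:
  assumes "\<forall>\<^sub>F i in F. x i \<in> vcarrier V" and "vlimit V x l F"
  shows "vlimit V (\<lambda>i. vscale V c (x i)) (vscale V c l) F"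
proof -
  have c: "l \<in> vcarrier V"
    using assms by (auto simp: vlimit_def)
  have "((\<lambda>i. \<bar>c\<bar> * vnorm V (vdiff V (x i) l)) \<longlongrightarrow> 0) F"
    using assms(2) unfolding vlimit_def by (intro tendsto_mult_right_zero) auto
  moreover have "\<forall>\<^sub>F i in F. \<bar>c\<bar> * vnorm V (vdiff V (x i) l)
      = vnorm V (vdiff V (vscale V c (x i)) (vscale V c l))"
    using assms(1) by eventually_elim (simp add: scale_diff norm_scale diff_closed c)
  ultimately have "((\<lambda>i. vnorm V (vdiff V (vscale V c (x i)) (vscale V c l))) \<longlongrightarrow> 0) F"
    using tendsto_cong by fast
  then show ?thesis using c by (simp add: vlimit_def scale_closed)
qed

lemma vlimit_norm:
  assumes "\<forall>\<^sub>F i in F. x i \<in> vcarrier V" and "vlimit V x l F"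
  shows "((\<lambda>i. vnorm V (x i)) \<longlongrightarrow> vnorm V l) F"
proof -
  have c: "l \<in> vcarrier V" and l: "((\<lambda>i. vnorm V (vdiff V (x i) l)) \<longlongrightarrow> 0) F"
    using assms by (auto simp: vlimit_def)
  have "((\<lambda>i. vnorm V (x i) - vnorm V l) \<longlongrightarrow> 0) F"
    by (rule Lim_null_comparison[OF _ l])
      (use assms(1) in eventually_elim, simp add: abs_norm_diff_le c)
  then show ?thesis by (simp add: LIM_zero_iff)
qed

lemma vlimit_diff_zero_iff:
  assumes "\<forall>\<^sub>F i in F. x i \<in> vcarrier V" "\<forall>\<^sub>F i in F. y i \<in> vcarrier V"
    and "vlimit V x l F" "vlimit V y m F" and "F \<noteq> bot"
  shows "((\<lambda>i. vnorm V (vdiff V (x i) (y i))) \<longlongrightarrow> 0) F \<longleftrightarrow> l = m"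
proof -
  have c: "l \<in> vcarrier V" "m \<in> vcarrier V"
    using assms by (auto simp: vlimit_def)
  have "vlimit V (\<lambda>i. vdiff V (x i) (y i)) (vdiff V l m) F"
    unfolding vdiff_def
    by (intro vlimit_add vlimit_scale assms) (use assms(2) in eventually_elim, simp add: scale_closed)
  then have *: "((\<lambda>i. vnorm V (vdiff V (x i) (y i))) \<longlongrightarrow> vnorm V (vdiff V l m)) F"
    by (rule vlimit_norm[rotated]) (use assms(1,2) in eventually_elim, simp add: diff_closed)
  show ?thesis
    using tendsto_unique[OF assms(5) *] * norm_diff_eq_zero_iff[OF c] by fastforce
qed

end

lemma linear_isometry_diff:
  assumes "normed_space_on V" "linear_isometry V W T" "x \<in> vcarrier V" "y \<in> vcarrier V"
  shows "T (vdiff V x y) = vdiff W (T x) (T y)"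
  using assms by (auto simp: vdiff_def linear_isometry_def normed_space_on.scale_closed)

lemma linear_isometry_norm_diff:
  assumes "normed_space_on V" "linear_isometry V W T" "x \<in> vcarrier V" "y \<in> vcarrier V"
  shows "vnorm W (vdiff W (T x) (T y)) = vnorm V (vdiff V x y)"
  using assms linear_isometry_diff[OF assms]
  by (metis linear_isometry_def normed_space_on.diff_closed)

lemma linear_isometry_inj_on:
  assumes V: "normed_space_on V" and W: "normed_space_on W" and T: "linear_isometry V W T"
  shows "inj_on T (vcarrier V)"
proof (rule inj_onI)
  fix x y assume xy: "x \<in> vcarrier V" "y \<in> vcarrier V" and eq: "T x = T y"
  have "T y \<in> vcarrier W" using T xy by (auto simp: linear_isometry_def)
  then have "vnorm W (vdiff W (T x) (T y)) = 0"
    using eq W by (simp add: normed_space_on.norm_diff_eq_zero_iff)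
  then show "x = y"
    using linear_isometry_norm_diff[OF V T xy] normed_space_on.norm_diff_eq_zero_iff[OF V xy] by simp
qed

lemma linear_isometry_zero:
  assumes V: "normed_space_on V" and W: "normed_space_on W" and T: "linear_isometry V W T"
  shows "T (vzero V) = vzero W"
  using linear_isometry_diff[OF V T, of "vzero V" "vzero V"] T
    normed_space_on.zero_closed[OF V] normed_space_on.diff_self[OF V, of "vzero V"]
    normed_space_on.diff_self[OF W, of "T (vzero V)"]
  by (auto simp: linear_isometry_def)

lemma linear_isometry_closed: "\<lbrakk>linear_isometry V W T; x \<in> vcarrier V\<rbrakk> \<Longrightarrow> T x \<in> vcarrier W"
  by (auto simp: linear_isometry_def)

lemma vlimit_linear_isometry:
  assumes V: "normed_space_on V" and T: "linear_isometry V W T"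
    and x: "\<forall>\<^sub>F i in F. x i \<in> vcarrier V" and l: "vlimit V x l F"
  shows "vlimit W (\<lambda>i. T (x i)) (T l) F"
proof -
  have c: "l \<in> vcarrier V" and lim: "((\<lambda>i. vnorm V (vdiff V (x i) l)) \<longlongrightarrow> 0) F"
    using l by (auto simp: vlimit_def)
  have "\<forall>\<^sub>F i in F. vnorm V (vdiff V (x i) l) = vnorm W (vdiff W (T (x i)) (T l))"
    using x by eventually_elim (simp add: linear_isometry_norm_diff[OF V T _ c])
  from tendsto_cong[OF this] show ?thesis
    using lim linear_isometry_closed[OF T c] by (simp add: vlimit_def)
qed

text \<open>
  A set with operations, mapped bijectively onto a Banach space and compatibly with the
  operations, is itself a Banach space.  This spares a direct verification of the vector space
  axioms and of completeness for a space of equivalence classes.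
\<close>

lemma banach_space_on_transport:
  fixes V :: "'a nvs" and W :: "'b nvs"
  assumes W: "banach_space_on W" and T: "linear_isometry V W T"
    and bij: "bij_betw T (vcarrier V) (vcarrier W)"
    and add: "\<And>x y. \<lbrakk>x \<in> vcarrier V; y \<in> vcarrier V\<rbrakk> \<Longrightarrow> vadd V x y \<in> vcarrier V"
    and scale: "\<And>c x. x \<in> vcarrier V \<Longrightarrow> vscale V c x \<in> vcarrier V"
    and zero: "vzero V \<in> vcarrier V" "T (vzero V) = vzero W"
  shows "banach_space_on V"
proof -
  interpret W: banach_space_on W by (rule W)
  have T_in: "T x \<in> vcarrier W" if "x \<in> vcarrier V" for x
    using T that by (rule linear_isometry_closed)
  have T_add: "T (vadd V x y) = vadd W (T x) (T y)" if "x \<in> vcarrier V" "y \<in> vcarrier V" for x y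
    using T that by (simp add: linear_isometry_def)
  have T_scale: "T (vscale V c x) = vscale W c (T x)" if "x \<in> vcarrier V" for c x
    using T that by (simp add: linear_isometry_def)
  have T_norm: "vnorm V x = vnorm W (T x)" if "x \<in> vcarrier V" for x
    using T that by (simp add: linear_isometry_def)
  have T_eq: "x = y \<longleftrightarrow> T x = T y" if "x \<in> vcarrier V" "y \<in> vcarrier V" for x y
    using bij that by (meson bij_betw_imp_inj_on inj_on_eq_iff)
  have V: "normed_space_on V"
    by unfold_locales
      (simp_all add: T_eq T_add T_scale T_norm T_in add scale zero W.add_assoc W.add_zero
        W.add_inverse W.scale_one W.scale_scale W.scale_add_right W.scale_add_left
        W.norm_nonneg W.norm_eq_zero W.norm_scale W.norm_triangle W.add_commute[of "T _" "T _"])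
  interpret V: normed_space_on V by (rule V)
  show ?thesis
  proof
    fix x :: "nat \<Rightarrow> 'a"
    assume x: "x n \<in> vcarrier V" for n
    assume cau: "\<exists>N. \<forall>m\<ge>N. \<forall>n\<ge>N. vnorm V (vdiff V (x m) (x n)) < e" if "0 < e" for e
    have nd: "vnorm W (vdiff W (T u) (T v)) = vnorm V (vdiff V u v)"
      if "u \<in> vcarrier V" "v \<in> vcarrier V" for u v
      by (rule linear_isometry_norm_diff[OF V T that])
    have "\<exists>l. vlimit W (\<lambda>n. T (x n)) l sequentially"
      by (rule W.complete) (auto simp: nd x T_in cau)
    then obtain l where l: "vlimit W (\<lambda>n. T (x n)) l sequentially" ..
    then have "l \<in> T ` vcarrier V"
      using bij by (simp add: vlimit_def bij_betw_def)
    then obtain k where k: "k \<in> vcarrier V" "T k = l"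
      by blast
    have "vlimit V x k sequentially"
      using l by (simp add: vlimit_def k(1) nd[OF x k(1)] k(2)[symmetric])
    then show "\<exists>l. vlimit V x l sequentially" ..
  qed
qed


section \<open>Directed colimits of normed spaces\<close>

text \<open>
  Co-Cauchy families, their equivalence, and the space of their classes make sense for every
  codiagram of normed spaces; the spaces \<open>L\<^sup>p(R\<^sup>a, \<mu>\<^sub>R)\<close> are the instance of interest.
\<close>

definition cauchy_families ::
  "'i::order set \<Rightarrow> ('i \<Rightarrow> 'z nvs) \<Rightarrow> ('i \<Rightarrow> 'i \<Rightarrow> 'z \<Rightarrow> 'z) \<Rightarrow> ('i \<Rightarrow> 'z) set" where
  "cauchy_families I Z \<phi> = {f \<in> (\<Pi>\<^sub>E R\<in>I. vcarrier (Z R)).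
     \<forall>\<epsilon>>0. \<exists>R0\<in>I. \<forall>R\<in>I. \<forall>F\<in>I. R0 \<le> R \<and> R \<le> F \<longrightarrow>
       vnorm (Z F) (vdiff (Z F) (\<phi> R F (f R)) (f F)) < \<epsilon>}"

definition family_rel ::
  "'i::order set \<Rightarrow> ('i \<Rightarrow> 'z nvs) \<Rightarrow> ('i \<Rightarrow> 'i \<Rightarrow> 'z \<Rightarrow> 'z) \<Rightarrow> ('i \<Rightarrow> 'z) rel" where
  "family_rel I Z \<phi> = {(f, g). f \<in> cauchy_families I Z \<phi> \<and> g \<in> cauchy_families I Z \<phi> \<and>
     ((\<lambda>R. vnorm (Z R) (vdiff (Z R) (f R) (g R))) \<longlongrightarrow> 0) (net I)}"

definition colim_space ::
  "'i::order set \<Rightarrow> ('i \<Rightarrow> 'z nvs) \<Rightarrow> ('i \<Rightarrow> 'i \<Rightarrow> 'z \<Rightarrow> 'z) \<Rightarrow> ('i \<Rightarrow> 'z) set nvs" where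
  "colim_space I Z \<phi> = \<lparr>
     vcarrier = cauchy_families I Z \<phi> // family_rel I Z \<phi>,
     vadd = (\<lambda>A B. \<Union>f\<in>A. \<Union>g\<in>B. family_rel I Z \<phi> `` {\<lambda>R\<in>I. vadd (Z R) (f R) (g R)}),
     vzero = family_rel I Z \<phi> `` {\<lambda>R\<in>I. vzero (Z R)},
     vscale = (\<lambda>c A. \<Union>f\<in>A. family_rel I Z \<phi> `` {\<lambda>R\<in>I. vscale (Z R) c (f R)}),
     vnorm = (\<lambda>A. the_elem ((\<lambda>f. Lim (net I) (\<lambda>R. vnorm (Z R) (f R))) ` A))\<rparr>"

definition colim_inj ::
  "'i::order set \<Rightarrow> ('i \<Rightarrow> 'z nvs) \<Rightarrow> ('i \<Rightarrow> 'i \<Rightarrow> 'z \<Rightarrow> 'z) \<Rightarrow> 'i \<Rightarrow> 'z \<Rightarrow> ('i \<Rightarrow> 'z) set" where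
  "colim_inj I Z \<phi> R z =
     family_rel I Z \<phi> `` {\<lambda>F\<in>I. if R \<le> F then \<phi> R F z else vzero (Z F)}"

text \<open>
  The following two functions give the mediating morphism into a cocone.  The image of a class under
  \<open>family_limit\<close> is a singleton, since equivalent families have the same limit.
\<close>

definition family_limit ::
  "'i::order set \<Rightarrow> 'y nvs \<Rightarrow> ('i \<Rightarrow> 'z \<Rightarrow> 'y) \<Rightarrow> ('i \<Rightarrow> 'z) \<Rightarrow> 'y" where
  "family_limit I Y \<psi> f = vLim Y (net I) (\<lambda>R. \<psi> R (f R))"

definition colim_map ::
  "'i::order set \<Rightarrow> 'y nvs \<Rightarrow> ('i \<Rightarrow> 'z \<Rightarrow> 'y) \<Rightarrow> ('i \<Rightarrow> 'z) set \<Rightarrow> 'y" where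
  "colim_map I Y \<psi> C = the_elem (family_limit I Y \<psi> ` C)"

locale directed_codiagram =
  fixes I :: "'i::order set" and Z :: "'i \<Rightarrow> 'z nvs" and \<phi> :: "'i \<Rightarrow> 'i \<Rightarrow> 'z \<Rightarrow> 'z"
  assumes codiagram: "codiagram I Z \<phi>"
    and nonempty: "I \<noteq> {}"
    and directed: "\<lbrakk>R \<in> I; S \<in> I\<rbrakk> \<Longrightarrow> \<exists>F\<in>I. R \<le> F \<and> S \<le> F"
begin

lemma eventually_net: "eventually P (net I) \<longleftrightarrow> (\<exists>R\<in>I. \<forall>F\<in>I. R \<le> F \<longrightarrow> P F)"
proof -
  have "eventually P (net I) \<longleftrightarrow> (\<exists>R\<in>I. eventually P (principal {F \<in> I. R \<le> F}))"
    unfolding net_def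
  proof (rule eventually_INF_base[OF nonempty])
    fix R S assume "R \<in> I" "S \<in> I"
    then obtain F where F: "F \<in> I" "R \<le> F" "S \<le> F" using directed by blast
    then have "{G \<in> I. F \<le> G} \<subseteq> {G \<in> I. R \<le> G} \<inter> {G \<in> I. S \<le> G}" by auto
    then show "\<exists>F\<in>I. principal {G \<in> I. F \<le> G}
        \<le> inf (principal {F \<in> I. R \<le> F}) (principal {F \<in> I. S \<le> F})"
      using F(1) by auto
  qed
  then show ?thesis by (auto simp: eventually_principal)
qed

lemma net_neq_bot: "net I \<noteq> bot"
proof
  assume "net I = bot"
  then have "eventually (\<lambda>_. False) (net I)" by simp
  then show False unfolding eventually_net by auto
qed

lemma eventually_net_in: "(\<And>R. R \<in> I \<Longrightarrow> P R) \<Longrightarrow> eventually P (net I)"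
  using nonempty by (auto simp: eventually_net)

lemma normed: "R \<in> I \<Longrightarrow> normed_space_on (Z R)"
  using codiagram by (simp add: codiagram_def banach_space_on_def)

lemma isometry: "\<lbrakk>R \<in> I; F \<in> I; R \<le> F\<rbrakk> \<Longrightarrow> linear_isometry (Z R) (Z F) (\<phi> R F)"
  using codiagram by (simp add: codiagram_def)

text \<open>In a complete space a Cauchy net converges: a suitable sequence of its terms is Cauchy.\<close>

lemma cauchy_net_converges:
  assumes Y: "banach_space_on Y" and x: "\<And>R. R \<in> I \<Longrightarrow> x R \<in> vcarrier Y"
    and cau: "\<And>e. 0 < e \<Longrightarrow> \<exists>R0\<in>I. \<forall>R\<in>I. R0 \<le> R \<longrightarrow> vnorm Y (vdiff Y (x R0) (x R)) < e"
  shows "\<exists>l. vlimit Y x l (net I)"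
proof -
  interpret Y: banach_space_on Y by (rule Y)
  have "\<forall>n::nat. \<exists>R0\<in>I. \<forall>R\<in>I. R0 \<le> R \<longrightarrow> vnorm Y (vdiff Y (x R0) (x R)) < inverse (real (Suc n))"
    using cau by simp
  then obtain S where S: "S n \<in> I"
    and tail: "\<And>R. R \<in> I \<Longrightarrow> S n \<le> R \<Longrightarrow> vnorm Y (vdiff Y (x (S n)) (x R)) < inverse (real (Suc n))"
    for n by metis
  have "\<exists>l. vlimit Y (\<lambda>n. x (S n)) l sequentially"
  proof (rule Y.complete)
    fix e :: real assume "0 < e"
    \<comment> \<open>The indices \<open>S m\<close> and \<open>S n\<close> need not be comparable; a common upper bound links their terms.\<close>
    then obtain N where N: "inverse (real (Suc N)) < e / 2"
      using reals_Archimedean[of "e / 2"] by auto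
    have "vnorm Y (vdiff Y (x (S m)) (x (S n))) < e" if mn: "m \<ge> N" "n \<ge> N" for m n
    proof -
      obtain R where R: "R \<in> I" "S m \<le> R" "S n \<le> R" using directed S by blast
      have "vnorm Y (vdiff Y (x (S m)) (x (S n)))
          \<le> vnorm Y (vdiff Y (x (S m)) (x R)) + vnorm Y (vdiff Y (x (S n)) (x R))"
        using Y.norm_diff_triangle[of "x (S m)" "x R" "x (S n)"]
          Y.norm_diff_commute[of "x R" "x (S n)"] x S R by simp
      also have "\<dots> < inverse (real (Suc m)) + inverse (real (Suc n))"
        using R tail by (intro add_strict_mono) auto
      also have "\<dots> \<le> inverse (real (Suc N)) + inverse (real (Suc N))"
        using mn by (intro add_mono le_imp_inverse_le) auto
      finally show ?thesis using N by simp
    qed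
    then show "\<exists>N. \<forall>m\<ge>N. \<forall>n\<ge>N. vnorm Y (vdiff Y (x (S m)) (x (S n))) < e" by blast
  qed (simp add: x S)
  then obtain l where l: "l \<in> vcarrier Y"
    and lim: "(\<lambda>n. vnorm Y (vdiff Y (x (S n)) l)) \<longlonglongrightarrow> 0"
    by (auto simp: vlimit_def)
  have "((\<lambda>R. vnorm Y (vdiff Y (x R) l)) \<longlongrightarrow> 0) (net I)"
    unfolding tendsto_iff
  proof (intro allI impI)
    fix e :: real assume e: "0 < e"
    have "\<forall>\<^sub>F n in sequentially. vnorm Y (vdiff Y (x (S n)) l) < e / 2"
      using lim e by (intro order_tendstoD(2)[where a = "e / 2"]) auto
    moreover have "\<forall>\<^sub>F n in sequentially. inverse (real (Suc n)) < e / 2"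
      using LIMSEQ_inverse_real_of_nat e by (intro order_tendstoD(2)[where a = "e / 2"]) auto
    ultimately have "\<forall>\<^sub>F n in sequentially. vnorm Y (vdiff Y (x (S n)) l) < e / 2
        \<and> inverse (real (Suc n)) < e / 2"
      by (rule eventually_conj)
    then obtain n where n: "vnorm Y (vdiff Y (x (S n)) l) < e / 2" "inverse (real (Suc n)) < e / 2"
      using eventually_happens'[OF sequentially_bot] by blast
    have "dist (vnorm Y (vdiff Y (x R) l)) 0 < e" if R: "R \<in> I" "S n \<le> R" for R
    proof -
      have "vnorm Y (vdiff Y (x R) l) \<le> vnorm Y (vdiff Y (x (S n)) (x R)) + vnorm Y (vdiff Y (x (S n)) l)"
        using Y.norm_diff_triangle2 x S R l by simp
      also have "\<dots> < e" using tail[OF R] n by simp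
      finally show ?thesis
        using Y.norm_nonneg Y.diff_closed x R l by simp
    qed
    then show "\<forall>\<^sub>F R in net I. dist (vnorm Y (vdiff Y (x R) l)) 0 < e"
      using S unfolding eventually_net by blast
  qed
  then show ?thesis using l by (auto simp: vlimit_def)
qed

lemma cauchy_family_PiE: "f \<in> cauchy_families I Z \<phi> \<Longrightarrow> f \<in> (\<Pi>\<^sub>E R\<in>I. vcarrier (Z R))"
  by (simp add: cauchy_families_def)

lemma colim_carrierE:
  assumes "C \<in> vcarrier (colim_space I Z \<phi>)"
  obtains f where "f \<in> cauchy_families I Z \<phi>" "C = family_rel I Z \<phi> `` {f}"
  using assms by (auto simp: colim_space_def quotient_def)

lemma colim_carrierI:
  "f \<in> cauchy_families I Z \<phi> \<Longrightarrow> family_rel I Z \<phi> `` {f} \<in> vcarrier (colim_space I Z \<phi>)"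
  by (auto simp: colim_space_def quotient_def)

context
  fixes Y :: "'y nvs" and \<psi> :: "'i \<Rightarrow> 'z \<Rightarrow> 'y"
  assumes Y: "cocone I Z \<phi> Y \<psi>"
begin

interpretation Y: banach_space_on Y
  using Y by (simp add: cocone_def)

lemma cocone_isometry: "R \<in> I \<Longrightarrow> linear_isometry (Z R) Y (\<psi> R)"
  using Y by (simp add: cocone_def)

lemma cocone_in: "\<lbrakk>R \<in> I; z \<in> vcarrier (Z R)\<rbrakk> \<Longrightarrow> \<psi> R z \<in> vcarrier Y"
  by (rule linear_isometry_closed[OF cocone_isometry])

lemma cocone_family_in: "\<lbrakk>f \<in> (\<Pi>\<^sub>E R\<in>I. vcarrier (Z R)); R \<in> I\<rbrakk> \<Longrightarrow> \<psi> R (f R) \<in> vcarrier Y"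
  by (auto intro: cocone_in)

lemma cocone_eventually_in:
  "f \<in> (\<Pi>\<^sub>E R\<in>I. vcarrier (Z R)) \<Longrightarrow> \<forall>\<^sub>F R in net I. \<psi> R (f R) \<in> vcarrier Y"
  by (intro eventually_net_in cocone_family_in)

lemma cocone_norm_diff:
  assumes f: "f \<in> (\<Pi>\<^sub>E R\<in>I. vcarrier (Z R))" and "R \<in> I" "F \<in> I" "R \<le> F"
  shows "vnorm (Z F) (vdiff (Z F) (\<phi> R F (f R)) (f F)) = vnorm Y (vdiff Y (\<psi> R (f R)) (\<psi> F (f F)))"
proof -
  have "\<phi> R F (f R) \<in> vcarrier (Z F)"
    using linear_isometry_closed[OF isometry] assms by (auto simp: PiE_iff)
  then have "vnorm Y (vdiff Y (\<psi> F (\<phi> R F (f R))) (\<psi> F (f F)))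
      = vnorm (Z F) (vdiff (Z F) (\<phi> R F (f R)) (f F))"
    using linear_isometry_norm_diff[OF normed cocone_isometry] assms by (auto simp: PiE_iff)
  moreover have "\<psi> F (\<phi> R F (f R)) = \<psi> R (f R)"
    using Y assms unfolding cocone_def by (metis PiE_mem)
  ultimately show ?thesis by simp
qed

text \<open>
  As the structure maps are isometries, a family is Cauchy in the sense of the diagram iff its
  image in a cocone is a Cauchy net, iff this image converges.
\<close>

lemma cauchy_families_iff:
  assumes f: "f \<in> (\<Pi>\<^sub>E R\<in>I. vcarrier (Z R))"
  shows "f \<in> cauchy_families I Z \<phi> \<longleftrightarrow> (\<exists>l. vlimit Y (\<lambda>R. \<psi> R (f R)) l (net I))"
proof
  assume "f \<in> cauchy_families I Z \<phi>"
  then have "\<exists>R0\<in>I. \<forall>R\<in>I. \<forall>F\<in>I. R0 \<le> R \<and> R \<le> F \<longrightarrow>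
      vnorm Y (vdiff Y (\<psi> R (f R)) (\<psi> F (f F))) < e" if "0 < e" for e
    using that unfolding cauchy_families_def by (fastforce simp: cocone_norm_diff[OF f])
  then show "\<exists>l. vlimit Y (\<lambda>R. \<psi> R (f R)) l (net I)"
    using f by (intro cauchy_net_converges) (unfold_locales, auto intro: cocone_in, metis order_refl)
next
  assume "\<exists>l. vlimit Y (\<lambda>R. \<psi> R (f R)) l (net I)"
  then obtain l where l: "l \<in> vcarrier Y"
    and lim: "((\<lambda>R. vnorm Y (vdiff Y (\<psi> R (f R)) l)) \<longlongrightarrow> 0) (net I)"
    by (auto simp: vlimit_def)
  have "\<exists>R0\<in>I. \<forall>R\<in>I. \<forall>F\<in>I. R0 \<le> R \<and> R \<le> F \<longrightarrow>
      vnorm (Z F) (vdiff (Z F) (\<phi> R F (f R)) (f F)) < e" if e: "0 < e" for e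
  proof -
    have "\<forall>\<^sub>F R in net I. vnorm Y (vdiff Y (\<psi> R (f R)) l) < e / 2"
      using lim e by (intro order_tendstoD(2)[where a = "e / 2"]) auto
    then obtain R0 where R0: "R0 \<in> I"
      and small: "\<And>R. R \<in> I \<Longrightarrow> R0 \<le> R \<Longrightarrow> vnorm Y (vdiff Y (\<psi> R (f R)) l) < e / 2"
      unfolding eventually_net by blast
    have "vnorm (Z F) (vdiff (Z F) (\<phi> R F (f R)) (f F)) < e"
      if RF: "R \<in> I" "F \<in> I" "R0 \<le> R" "R \<le> F" for R F
    proof -
      have "vnorm Y (vdiff Y (\<psi> R (f R)) (\<psi> F (f F)))
          \<le> vnorm Y (vdiff Y (\<psi> R (f R)) l) + vnorm Y (vdiff Y (\<psi> F (f F)) l)"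
        using Y.norm_diff_triangle[of "\<psi> R (f R)" l "\<psi> F (f F)"]
          Y.norm_diff_commute[of l "\<psi> F (f F)"] cocone_family_in[OF f] RF l by simp
      also have "\<dots> < e"
        using small[of R] small[of F] RF by fastforce
      finally show ?thesis
        using RF by (simp add: cocone_norm_diff[OF f])
    qed
    then show ?thesis using R0 by blast
  qed
  then show "f \<in> cauchy_families I Z \<phi>"
    using f by (simp add: cauchy_families_def)
qed

abbreviation fam_lim :: "('i \<Rightarrow> 'z) \<Rightarrow> 'y" where
  "fam_lim \<equiv> family_limit I Y \<psi>"

lemma fam_lim_eqI:
  assumes f: "f \<in> (\<Pi>\<^sub>E R\<in>I. vcarrier (Z R))" and l: "vlimit Y (\<lambda>R. \<psi> R (f R)) l (net I)"
  shows "f \<in> cauchy_families I Z \<phi>" "fam_lim f = l"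
  using l cauchy_families_iff[OF f] Y.vLim_eqI[OF net_neq_bot cocone_eventually_in[OF f] l]
  by (auto simp: family_limit_def)

lemma fam_lim: "f \<in> cauchy_families I Z \<phi> \<Longrightarrow> vlimit Y (\<lambda>R. \<psi> R (f R)) (fam_lim f) (net I)"
  using cauchy_families_iff[OF cauchy_family_PiE] fam_lim_eqI[OF cauchy_family_PiE] by auto

lemma fam_lim_in: "f \<in> cauchy_families I Z \<phi> \<Longrightarrow> fam_lim f \<in> vcarrier Y"
  using fam_lim by (simp add: vlimit_def)

lemma family_add:
  assumes f: "f \<in> cauchy_families I Z \<phi>" and g: "g \<in> cauchy_families I Z \<phi>"
  defines "h \<equiv> \<lambda>R\<in>I. vadd (Z R) (f R) (g R)"
  shows "h \<in> cauchy_families I Z \<phi>" "fam_lim h = vadd Y (fam_lim f) (fam_lim g)"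
proof -
  note fg = cauchy_family_PiE[OF f] cauchy_family_PiE[OF g]
  have h: "h \<in> (\<Pi>\<^sub>E R\<in>I. vcarrier (Z R))"
    using fg by (auto simp: h_def PiE_iff normed_space_on.add_closed[OF normed])
  have "\<forall>\<^sub>F R in net I. vadd Y (\<psi> R (f R)) (\<psi> R (g R)) = \<psi> R (h R)"
  proof (rule eventually_net_in)
    fix R assume "R \<in> I"
    then show "vadd Y (\<psi> R (f R)) (\<psi> R (g R)) = \<psi> R (h R)"
      using cocone_isometry[of R] fg by (auto simp: h_def linear_isometry_def PiE_iff)
  qed
  then have "vlimit Y (\<lambda>R. \<psi> R (h R)) (vadd Y (fam_lim f) (fam_lim g)) (net I)"
    by (rule vlimit_cong[OF _ Y.vlimit_add[OF cocone_eventually_in[OF fg(1)]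
          cocone_eventually_in[OF fg(2)] fam_lim[OF f] fam_lim[OF g]]])
  then show "h \<in> cauchy_families I Z \<phi>" "fam_lim h = vadd Y (fam_lim f) (fam_lim g)"
    using fam_lim_eqI[OF h] by auto
qed

lemma family_scale:
  fixes c :: real
  assumes f: "f \<in> cauchy_families I Z \<phi>"
  defines "h \<equiv> \<lambda>R\<in>I. vscale (Z R) c (f R)"
  shows "h \<in> cauchy_families I Z \<phi>" "fam_lim h = vscale Y c (fam_lim f)"
proof -
  note f' = cauchy_family_PiE[OF f]
  have h: "h \<in> (\<Pi>\<^sub>E R\<in>I. vcarrier (Z R))"
    using f' by (auto simp: h_def PiE_iff normed_space_on.scale_closed[OF normed])
  have "\<forall>\<^sub>F R in net I. vscale Y c (\<psi> R (f R)) = \<psi> R (h R)"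
  proof (rule eventually_net_in)
    fix R assume "R \<in> I"
    then show "vscale Y c (\<psi> R (f R)) = \<psi> R (h R)"
      using cocone_isometry[of R] f' by (auto simp: h_def linear_isometry_def PiE_iff)
  qed
  then have "vlimit Y (\<lambda>R. \<psi> R (h R)) (vscale Y c (fam_lim f)) (net I)"
    by (rule vlimit_cong[OF _ Y.vlimit_scale[OF cocone_eventually_in[OF f'] fam_lim[OF f]]])
  then show "h \<in> cauchy_families I Z \<phi>" "fam_lim h = vscale Y c (fam_lim f)"
    using fam_lim_eqI[OF h] by auto
qed



lemma family_zero:
  defines "h \<equiv> \<lambda>R\<in>I. vzero (Z R)"
  shows "h \<in> cauchy_families I Z \<phi>" "fam_lim h = vzero Y"
proof -
  have h: "h \<in> (\<Pi>\<^sub>E R\<in>I. vcarrier (Z R))"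
    by (auto simp: h_def normed_space_on.zero_closed[OF normed])
  have "\<forall>\<^sub>F R in net I. \<psi> R (h R) = vzero Y"
    by (rule eventually_net_in) (simp add: h_def linear_isometry_zero[OF normed Y.normed_space_on_axioms cocone_isometry])
  then have "vlimit Y (\<lambda>R. \<psi> R (h R)) (vzero Y) (net I)"
    by (rule Y.vlimit_eventually_const[OF Y.zero_closed])
  then show "h \<in> cauchy_families I Z \<phi>" "fam_lim h = vzero Y"
    using fam_lim_eqI[OF h] by auto
qed

lemma family_inj:
  assumes R: "R \<in> I" and z: "z \<in> vcarrier (Z R)"
  defines "h \<equiv> \<lambda>F\<in>I. if R \<le> F then \<phi> R F z else vzero (Z F)"
  shows "h \<in> cauchy_families I Z \<phi>" "fam_lim h = \<psi> R z"
proof -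
  have h: "h \<in> (\<Pi>\<^sub>E R\<in>I. vcarrier (Z R))"
    using linear_isometry_closed[OF isometry[OF R] z]
    by (auto simp: h_def normed_space_on.zero_closed[OF normed])
  have "\<forall>\<^sub>F F in net I. \<psi> F (h F) = \<psi> R z"
    unfolding eventually_net using R z Y by (intro bexI[of _ R]) (auto simp: h_def cocone_def)
  then have "vlimit Y (\<lambda>R. \<psi> R (h R)) (\<psi> R z) (net I)"
    by (rule Y.vlimit_eventually_const[OF cocone_in[OF R z]])
  then show "h \<in> cauchy_families I Z \<phi>" "fam_lim h = \<psi> R z"
    using fam_lim_eqI[OF h] by auto
qed

lemma family_norm:
  assumes f: "f \<in> cauchy_families I Z \<phi>"
  shows "Lim (net I) (\<lambda>R. vnorm (Z R) (f R)) = vnorm Y (fam_lim f)"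
proof -
  note f' = cauchy_family_PiE[OF f]
  have "\<forall>\<^sub>F R in net I. vnorm Y (\<psi> R (f R)) = vnorm (Z R) (f R)"
    using cocone_isometry f'
    by (intro eventually_net_in) (auto simp: linear_isometry_def PiE_iff)
  from tendsto_cong[OF this]
  have "((\<lambda>R. vnorm (Z R) (f R)) \<longlongrightarrow> vnorm Y (fam_lim f)) (net I)"
    using Y.vlimit_norm[OF cocone_eventually_in[OF f'] fam_lim[OF f]] by simp
  then show ?thesis by (rule tendsto_Lim[OF net_neq_bot])
qed

text \<open>Equivalence is the kernel of the limit map, in whichever cocone the limit is taken.\<close>

lemma family_rel_iff:
  "(f, g) \<in> family_rel I Z \<phi> \<longleftrightarrow>
     f \<in> cauchy_families I Z \<phi> \<and> g \<in> cauchy_families I Z \<phi> \<and> fam_lim f = fam_lim g"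
proof -
  have "((\<lambda>R. vnorm (Z R) (vdiff (Z R) (f R) (g R))) \<longlongrightarrow> 0) (net I) \<longleftrightarrow> fam_lim f = fam_lim g"
    if fg: "f \<in> cauchy_families I Z \<phi>" "g \<in> cauchy_families I Z \<phi>"
  proof -
    note fg' = cauchy_family_PiE[OF fg(1)] cauchy_family_PiE[OF fg(2)]
    have "\<forall>\<^sub>F R in net I. vnorm (Z R) (vdiff (Z R) (f R) (g R))
        = vnorm Y (vdiff Y (\<psi> R (f R)) (\<psi> R (g R)))"
    proof (rule eventually_net_in)
      fix R assume "R \<in> I"
      then show "vnorm (Z R) (vdiff (Z R) (f R) (g R))
        = vnorm Y (vdiff Y (\<psi> R (f R)) (\<psi> R (g R)))"
        using fg' linear_isometry_norm_diff[OF normed cocone_isometry] by (auto simp: PiE_iff)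
    qed
    from tendsto_cong[OF this] show ?thesis
      using Y.vlimit_diff_zero_iff[OF cocone_eventually_in[OF fg'(1)]
          cocone_eventually_in[OF fg'(2)] fam_lim[OF fg(1)] fam_lim[OF fg(2)] net_neq_bot]
      by simp
  qed
  then show ?thesis by (auto simp: family_rel_def)
qed

lemma family_class_eq:
  "f \<in> cauchy_families I Z \<phi> \<Longrightarrow>
     family_rel I Z \<phi> `` {f} = {g \<in> cauchy_families I Z \<phi>. fam_lim g = fam_lim f}"
  by (auto simp: family_rel_iff)

lemma family_class_eqI:
  assumes "f \<in> cauchy_families I Z \<phi>" "g \<in> cauchy_families I Z \<phi>" "fam_lim f = fam_lim g"
  shows "family_rel I Z \<phi> `` {f} = family_rel I Z \<phi> `` {g}"
  by (simp only: family_class_eq assms)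

lemma colim_add:
  assumes f: "f \<in> cauchy_families I Z \<phi>" and g: "g \<in> cauchy_families I Z \<phi>"
  shows "vadd (colim_space I Z \<phi>) (family_rel I Z \<phi> `` {f}) (family_rel I Z \<phi> `` {g})
    = family_rel I Z \<phi> `` {\<lambda>R\<in>I. vadd (Z R) (f R) (g R)}"
proof -
  have "family_rel I Z \<phi> `` {\<lambda>R\<in>I. vadd (Z R) (f' R) (g' R)}
      = family_rel I Z \<phi> `` {\<lambda>R\<in>I. vadd (Z R) (f R) (g R)}"
    if "f' \<in> family_rel I Z \<phi> `` {f}" "g' \<in> family_rel I Z \<phi> `` {g}" for f' g'
  proof -
    have f': "f' \<in> cauchy_families I Z \<phi>" "fam_lim f' = fam_lim f"
      and g': "g' \<in> cauchy_families I Z \<phi>" "fam_lim g' = fam_lim g"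
      using that by (simp_all add: family_rel_iff)
    show ?thesis
      by (rule family_class_eqI[OF family_add(1)[OF f'(1) g'(1)] family_add(1)[OF f g]])
        (simp only: family_add(2)[OF f'(1) g'(1)] family_add(2)[OF f g] f'(2) g'(2))
  qed
  moreover have "f \<in> family_rel I Z \<phi> `` {f}" "g \<in> family_rel I Z \<phi> `` {g}"
    using f g by (auto simp: family_rel_iff)
  ultimately have "(\<Union>f'\<in>family_rel I Z \<phi> `` {f}. \<Union>g'\<in>family_rel I Z \<phi> `` {g}.
      family_rel I Z \<phi> `` {\<lambda>R\<in>I. vadd (Z R) (f' R) (g' R)})
    = family_rel I Z \<phi> `` {\<lambda>R\<in>I. vadd (Z R) (f R) (g R)}"
    by - (rule UN_eq_common_value, rule UN_eq_common_value, assumption+)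
  then show ?thesis
    by (simp only: colim_space_def nvs.select_convs)
qed

lemma colim_scale:
  assumes f: "f \<in> cauchy_families I Z \<phi>"
  shows "vscale (colim_space I Z \<phi>) c (family_rel I Z \<phi> `` {f})
    = family_rel I Z \<phi> `` {\<lambda>R\<in>I. vscale (Z R) c (f R)}"
proof -
  have "family_rel I Z \<phi> `` {\<lambda>R\<in>I. vscale (Z R) c (f' R)}
      = family_rel I Z \<phi> `` {\<lambda>R\<in>I. vscale (Z R) c (f R)}"
    if "f' \<in> family_rel I Z \<phi> `` {f}" for f'
  proof -
    have f': "f' \<in> cauchy_families I Z \<phi>" "fam_lim f' = fam_lim f"
      using that by (simp_all add: family_rel_iff)
    show ?thesis
      by (rule family_class_eqI[OF family_scale(1)[OF f'(1)] family_scale(1)[OF f]])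
        (simp only: family_scale(2)[OF f'(1)] family_scale(2)[OF f] f'(2))
  qed
  moreover have "f \<in> family_rel I Z \<phi> `` {f}"
    using f by (auto simp: family_rel_iff)
  ultimately have "(\<Union>f'\<in>family_rel I Z \<phi> `` {f}.
      family_rel I Z \<phi> `` {\<lambda>R\<in>I. vscale (Z R) c (f' R)})
    = family_rel I Z \<phi> `` {\<lambda>R\<in>I. vscale (Z R) c (f R)}"
    by - (rule UN_eq_common_value)
  then show ?thesis
    by (simp only: colim_space_def nvs.select_convs)
qed

lemma the_elem_family_class:
  assumes f: "f \<in> cauchy_families I Z \<phi>"
    and eq: "\<And>g. g \<in> cauchy_families I Z \<phi> \<Longrightarrow> fam_lim g = fam_lim f \<Longrightarrow> h g = h f"
  shows "the_elem (h ` (family_rel I Z \<phi> `` {f})) = h f"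
proof -
  have "h ` (family_rel I Z \<phi> `` {f}) = {h f}"
  proof (intro equalityI subsetI)
    fix y assume "y \<in> h ` (family_rel I Z \<phi> `` {f})"
    then obtain g where "y = h g" "g \<in> cauchy_families I Z \<phi>" "fam_lim g = fam_lim f"
      unfolding family_class_eq[OF f] by blast
    then show "y \<in> {h f}" using eq[of g] by simp
  next
    fix y assume "y \<in> {h f}"
    then show "y \<in> h ` (family_rel I Z \<phi> `` {f})"
      unfolding family_class_eq[OF f] using f by blast
  qed
  then show ?thesis by simp
qed

lemma colim_norm:
  assumes f: "f \<in> cauchy_families I Z \<phi>"
  shows "vnorm (colim_space I Z \<phi>) (family_rel I Z \<phi> `` {f}) = vnorm Y (fam_lim f)"
  unfolding colim_space_def nvs.select_convs
  by (subst the_elem_family_class[OF f]) (simp_all only: family_norm f)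

lemma colim_map_class:
  "f \<in> cauchy_families I Z \<phi> \<Longrightarrow> colim_map I Y \<psi> (family_rel I Z \<phi> `` {f}) = fam_lim f"
  unfolding colim_map_def by (rule the_elem_family_class)

lemma vlimit_colim_map:
  assumes "C \<in> vcarrier (colim_space I Z \<phi>)" "f \<in> C"
  shows "vlimit Y (\<lambda>R. \<psi> R (f R)) (colim_map I Y \<psi> C) (net I)"
proof -
  obtain g where g: "g \<in> cauchy_families I Z \<phi>" "C = family_rel I Z \<phi> `` {g}"
    using assms(1) by (rule colim_carrierE)
  then have "f \<in> cauchy_families I Z \<phi>" "fam_lim f = colim_map I Y \<psi> C"
    using assms(2) by (auto simp: family_rel_iff colim_map_class)
  then show ?thesis using fam_lim by metis
qed

text \<open>
  Isometric because the norm of a class is the limit of the norms of the components, which are the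
  norms of their images in the cocone.
\<close>

lemma colim_map_isometry: "linear_isometry (colim_space I Z \<phi>) Y (colim_map I Y \<psi>)"
  unfolding linear_isometry_def
proof (intro conjI ballI allI)
  show "colim_map I Y \<psi> \<in> vcarrier (colim_space I Z \<phi>) \<rightarrow> vcarrier Y"
    by (auto elim: colim_carrierE simp: colim_map_class fam_lim_in)
  fix C assume "C \<in> vcarrier (colim_space I Z \<phi>)"
  then obtain f where f: "f \<in> cauchy_families I Z \<phi>" "C = family_rel I Z \<phi> `` {f}"
    by (rule colim_carrierE)
  show "vnorm Y (colim_map I Y \<psi> C) = vnorm (colim_space I Z \<phi>) C"
    by (simp only: f colim_norm colim_map_class)
  show "colim_map I Y \<psi> (vscale (colim_space I Z \<phi>) c C) = vscale Y c (colim_map I Y \<psi> C)" for c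
    by (simp only: f colim_scale colim_map_class family_scale)
  fix D assume "D \<in> vcarrier (colim_space I Z \<phi>)"
  then obtain g where g: "g \<in> cauchy_families I Z \<phi>" "D = family_rel I Z \<phi> `` {g}"
    by (rule colim_carrierE)
  show "colim_map I Y \<psi> (vadd (colim_space I Z \<phi>) C D)
      = vadd Y (colim_map I Y \<psi> C) (colim_map I Y \<psi> D)"
    by (simp only: f g colim_add colim_map_class family_add)
qed

lemma colim_map_inj: "inj_on (colim_map I Y \<psi>) (vcarrier (colim_space I Z \<phi>))"
proof (rule inj_onI)
  fix C D assume CD: "C \<in> vcarrier (colim_space I Z \<phi>)" "D \<in> vcarrier (colim_space I Z \<phi>)"
    and eq: "colim_map I Y \<psi> C = colim_map I Y \<psi> D"
  obtain f where f: "f \<in> cauchy_families I Z \<phi>" "C = family_rel I Z \<phi> `` {f}"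
    using CD(1) by (rule colim_carrierE)
  obtain g where g: "g \<in> cauchy_families I Z \<phi>" "D = family_rel I Z \<phi> `` {g}"
    using CD(2) by (rule colim_carrierE)
  show "C = D"
    using eq f g family_class_eqI[OF f(1) g(1)] by (simp only: colim_map_class)
qed

lemma colim_inj_in:
  "\<lbrakk>R \<in> I; z \<in> vcarrier (Z R)\<rbrakk> \<Longrightarrow> colim_inj I Z \<phi> R z \<in> vcarrier (colim_space I Z \<phi>)"
  unfolding colim_inj_def by (intro colim_carrierI family_inj)

lemma colim_map_colim_inj:
  "\<lbrakk>R \<in> I; z \<in> vcarrier (Z R)\<rbrakk> \<Longrightarrow> colim_map I Y \<psi> (colim_inj I Z \<phi> R z) = \<psi> R z"
  unfolding colim_inj_def by (simp add: colim_map_class family_inj)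

end


text \<open>
  Suppose that every point of a cocone is the limit of a family of points of the diagram.  Then
  the limit map identifies the space of Cauchy families with this cocone, and so makes it a
  Banach space.  The limit map into an arbitrary cocone is the mediating morphism, and it is
  unique because a class is the limit of the images of the members of each of its families.
\<close>

theorem colim_space_colimit:
  fixes Y :: "'y nvs"
  assumes Y: "cocone I Z \<phi> Y \<psi>"
    and dense: "\<And>y. y \<in> vcarrier Y \<Longrightarrow>
      \<exists>f. (\<forall>R\<in>I. f R \<in> vcarrier (Z R)) \<and> vlimit Y (\<lambda>R. \<psi> R (f R)) y (net I)"
  shows "cocone_iso I Z \<phi> (colim_space I Z \<phi>) (colim_inj I Z \<phi>) Y \<psi> (colim_map I Y \<psi>)"
    and "realizes_colimit TYPE('w) I Z \<phi> (colim_space I Z \<phi>) (colim_inj I Z \<phi>)"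
proof -
  let ?C = "colim_space I Z \<phi>" and ?j = "colim_inj I Z \<phi>" and ?L = "colim_map I Y \<psi>"
  interpret Y: banach_space_on Y using Y by (simp add: cocone_def)
  note iso = colim_map_isometry[OF Y]
  have surj: "?L ` vcarrier ?C = vcarrier Y"
  proof
    show "?L ` vcarrier ?C \<subseteq> vcarrier Y"
      using iso by (auto simp: linear_isometry_def)
    show "vcarrier Y \<subseteq> ?L ` vcarrier ?C"
    proof
      fix y assume "y \<in> vcarrier Y"
      then obtain f where f: "\<forall>R\<in>I. f R \<in> vcarrier (Z R)" "vlimit Y (\<lambda>R. \<psi> R (f R)) y (net I)"
        using dense by blast
      define g where "g = restrict f I"
      have g: "g \<in> (\<Pi>\<^sub>E R\<in>I. vcarrier (Z R))" using f(1) by (simp add: g_def)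
      have "\<forall>\<^sub>F R in net I. \<psi> R (f R) = \<psi> R (g R)"
        by (rule eventually_net_in) (simp add: g_def)
      then have "vlimit Y (\<lambda>R. \<psi> R (g R)) y (net I)"
        using f(2) by (rule vlimit_cong)
      note g' = fam_lim_eqI[OF Y g this]
      then have "y = ?L (family_rel I Z \<phi> `` {g})"
        by (simp add: colim_map_class[OF Y])
      then show "y \<in> ?L ` vcarrier ?C"
        using colim_carrierI[OF g'(1)] by blast
    qed
  qed
  have bij: "bij_betw ?L (vcarrier ?C) (vcarrier Y)"
    using surj colim_map_inj[OF Y] by (simp add: bij_betw_def)
  have zero: "vzero ?C = family_rel I Z \<phi> `` {\<lambda>R\<in>I. vzero (Z R)}"
    by (simp add: colim_space_def)
  have banach: "banach_space_on ?C"
  proof (rule banach_space_on_transport[OF Y.banach_space_on_axioms iso bij])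
    show "vadd ?C x y \<in> vcarrier ?C" if x: "x \<in> vcarrier ?C" and y: "y \<in> vcarrier ?C" for x y
    proof -
      obtain f where f: "f \<in> cauchy_families I Z \<phi>" "x = family_rel I Z \<phi> `` {f}"
        using x by (rule colim_carrierE)
      obtain g where g: "g \<in> cauchy_families I Z \<phi>" "y = family_rel I Z \<phi> `` {g}"
        using y by (rule colim_carrierE)
      show ?thesis
        unfolding f g colim_add[OF Y f(1) g(1)] by (intro colim_carrierI family_add[OF Y] f g)
    qed
    show "vscale ?C c x \<in> vcarrier ?C" if x: "x \<in> vcarrier ?C" for c x
    proof -
      obtain f where f: "f \<in> cauchy_families I Z \<phi>" "x = family_rel I Z \<phi> `` {f}"
        using x by (rule colim_carrierE)
      show ?thesis
        unfolding f colim_scale[OF Y f(1)] by (intro colim_carrierI family_scale[OF Y] f)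
    qed
    show "vzero ?C \<in> vcarrier ?C" "?L (vzero ?C) = vzero Y"
      unfolding zero using family_zero[OF Y] by (auto simp: colim_map_class[OF Y] intro!: colim_carrierI)
  qed
  then interpret C: banach_space_on ?C .
  have L_eqD: "x = y" if "x \<in> vcarrier ?C" "y \<in> vcarrier ?C" "?L x = ?L y" for x y
    using colim_map_inj[OF Y] that by (meson inj_onD)
  have L_add: "?L (vadd ?C x y) = vadd Y (?L x) (?L y)"
    if "x \<in> vcarrier ?C" "y \<in> vcarrier ?C" for x y
    using iso that by (simp add: linear_isometry_def)
  have L_scale: "?L (vscale ?C c x) = vscale Y c (?L x)"
    and L_norm: "vnorm ?C x = vnorm Y (?L x)"
    if "x \<in> vcarrier ?C" for x c
    using iso that by (simp_all add: linear_isometry_def)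
  note j_in = colim_inj_in[OF Y] and Lj = colim_map_colim_inj[OF Y]
  have j_iso: "linear_isometry (Z R) ?C (?j R)" if R: "R \<in> I" for R
  proof -
    interpret ZR: normed_space_on "Z R" using normed R .
    have P_add: "\<psi> R (vadd (Z R) x y) = vadd Y (\<psi> R x) (\<psi> R y)"
      if "x \<in> vcarrier (Z R)" "y \<in> vcarrier (Z R)" for x y
      using cocone_isometry[OF Y R] that by (simp add: linear_isometry_def)
    have P: "\<psi> R (vscale (Z R) c x) = vscale Y c (\<psi> R x)" "vnorm Y (\<psi> R x) = vnorm (Z R) x"
      if "x \<in> vcarrier (Z R)" for x c
      using cocone_isometry[OF Y R] that by (simp_all add: linear_isometry_def)
    show ?thesis
      unfolding linear_isometry_def
    proof (intro conjI ballI allI)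
      show "?j R \<in> vcarrier (Z R) \<rightarrow> vcarrier ?C"
        using R by (auto intro: j_in)
      show "?j R (vadd (Z R) x y) = vadd ?C (?j R x) (?j R y)"
        if "x \<in> vcarrier (Z R)" "y \<in> vcarrier (Z R)" for x y
        by (rule L_eqD) (auto simp: R that P_add L_add Lj j_in ZR.add_closed C.add_closed)
      show "?j R (vscale (Z R) c x) = vscale ?C c (?j R x)"
        if "x \<in> vcarrier (Z R)" for x c
        by (rule L_eqD) (auto simp: R that P L_scale Lj j_in ZR.scale_closed C.scale_closed)
      show "vnorm ?C (?j R x) = vnorm (Z R) x" if "x \<in> vcarrier (Z R)" for x
        by (simp add: R that P L_norm Lj j_in)
    qed
  qed
  have C: "cocone I Z \<phi> ?C ?j"
    unfolding cocone_def
  proof (intro conjI ballI impI)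
    show "banach_space_on ?C" by (rule banach)
    show "linear_isometry (Z R) ?C (?j R)" if "R \<in> I" for R using j_iso that .
    show "?j R z = ?j F (\<phi> R F z)" if RF: "R \<in> I" "F \<in> I" "R \<le> F" and z: "z \<in> vcarrier (Z R)" for R F z
    proof (rule L_eqD)
      have *: "\<phi> R F z \<in> vcarrier (Z F)"
        using linear_isometry_closed[OF isometry[OF RF] z] .
      show "?j R z \<in> vcarrier ?C" "?j F (\<phi> R F z) \<in> vcarrier ?C"
        using RF z * by (auto intro: j_in)
      show "?L (?j R z) = ?L (?j F (\<phi> R F z))"
        using Y RF z unfolding cocone_def by (metis Lj *)
    qed
  qed
  show "cocone_iso I Z \<phi> ?C ?j Y \<psi> ?L"
    unfolding cocone_iso_def using C Y iso surj Lj by auto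
  show "realizes_colimit TYPE('w) I Z \<phi> ?C ?j"
    unfolding realizes_colimit_def
  proof (intro conjI allI impI codiagram C)
    fix W :: "'w nvs" and \<rho>
    assume W: "cocone I Z \<phi> W \<rho>"
    then interpret W: banach_space_on W by (simp add: cocone_def)
    have uniq: "T C = colim_map I W \<rho> C"
      if T: "linear_isometry ?C W T" "\<forall>R\<in>I. \<forall>z\<in>vcarrier (Z R). T (?j R z) = \<rho> R z"
        and Cl: "C \<in> vcarrier ?C" for T C
    proof -
      obtain f where f: "f \<in> cauchy_families I Z \<phi>" and Cf: "C = family_rel I Z \<phi> `` {f}"
        using Cl by (rule colim_carrierE)
      note f' = cauchy_family_PiE[OF f]
      have fC: "f \<in> C" using f Cf by (auto simp: family_rel_iff[OF Y])
      have ev: "\<forall>\<^sub>F R in net I. ?j R (f R) \<in> vcarrier ?C"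
        using f' by (auto intro!: eventually_net_in j_in)
      have "vlimit ?C (\<lambda>R. ?j R (f R)) C (net I)"
      proof -
        have ev': "\<forall>\<^sub>F R in net I. vnorm Y (vdiff Y (\<psi> R (f R)) (?L C)) = vnorm ?C (vdiff ?C (?j R (f R)) C)"
        proof (rule eventually_net_in)
          fix R assume R: "R \<in> I"
          then have "f R \<in> vcarrier (Z R)" using f' by auto
          then show "vnorm Y (vdiff Y (\<psi> R (f R)) (?L C)) = vnorm ?C (vdiff ?C (?j R (f R)) C)"
            using linear_isometry_norm_diff[OF C.normed_space_on_axioms iso j_in[of R "f R"] Cl] R
            by (simp add: Lj)
        qed
        from tendsto_cong[OF ev'] show ?thesis
          using vlimit_colim_map[OF Y Cl fC] Cl by (simp add: vlimit_def)
      qed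
      then have lim: "vlimit W (\<lambda>R. T (?j R (f R))) (T C) (net I)"
        by (rule vlimit_linear_isometry[OF C.normed_space_on_axioms T(1) ev])
      have "\<forall>\<^sub>F R in net I. T (?j R (f R)) = \<rho> R (f R)"
        using f' T(2) by (intro eventually_net_in) (auto simp: PiE_iff)
      then have "vlimit W (\<lambda>R. \<rho> R (f R)) (T C) (net I)"
        using lim by (rule vlimit_cong)
      then show ?thesis
        using W.vlimit_unique[OF net_neq_bot cocone_eventually_in[OF W f']]
          vlimit_colim_map[OF W Cl fC] by blast
    qed
    show "\<exists>T. linear_isometry ?C W T \<and> (\<forall>R\<in>I. \<forall>z\<in>vcarrier (Z R). T (?j R z) = \<rho> R z) \<and>
        (\<forall>T'. linear_isometry ?C W T' \<and> (\<forall>R\<in>I. \<forall>z\<in>vcarrier (Z R). T' (?j R z) = \<rho> R z) \<longrightarrow>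
          (\<forall>y\<in>vcarrier ?C. T' y = T y))"
      using colim_map_isometry[OF W] colim_map_colim_inj[OF W] uniq by blast
  qed
qed

end

text \<open>Isometries are injective, so a right inverse of an isomorphism of cocones is two-sided.\<close>

lemma cocone_iso_inverse:
  assumes T: "cocone_iso I Z \<phi> Y \<psi> Y' \<rho> T"
    and S: "\<And>y. y \<in> vcarrier Y' \<Longrightarrow> S y \<in> vcarrier Y \<and> T (S y) = y"
  shows "cocone_iso I Z \<phi> Y' \<rho> Y \<psi> S" and "\<And>x. x \<in> vcarrier Y \<Longrightarrow> S (T x) = x"
proof -
  have Y: "normed_space_on Y" and Y': "normed_space_on Y'" and iso: "linear_isometry Y Y' T"
    and c: "cocone I Z \<phi> Y \<psi>" "cocone I Z \<phi> Y' \<rho>"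
    and surj: "T ` vcarrier Y = vcarrier Y'" and comp: "\<And>R z. R \<in> I \<Longrightarrow> z \<in> vcarrier (Z R) \<Longrightarrow> T (\<psi> R z) = \<rho> R z"
    using T by (auto simp: cocone_iso_def cocone_def banach_space_on_def)
  interpret Y: normed_space_on Y by fact
  interpret Y': normed_space_on Y' by fact
  have inj: "inj_on T (vcarrier Y)" by (rule linear_isometry_inj_on[OF Y Y' iso])
  have T_in: "T x \<in> vcarrier Y'" if "x \<in> vcarrier Y" for x
    using linear_isometry_closed[OF iso that] .
  show ST: "S (T x) = x" if "x \<in> vcarrier Y" for x
    using inj S[OF T_in[OF that]] that by (meson inj_onD)
  have eq: "x = y" if "x \<in> vcarrier Y" "y \<in> vcarrier Y" "T x = T y" for x y
    using inj that by (meson inj_onD)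
  have "linear_isometry Y' Y S"
    unfolding linear_isometry_def
  proof (intro conjI ballI allI)
    show "S \<in> vcarrier Y' \<rightarrow> vcarrier Y" using S by auto
    show "S (vadd Y' x y) = vadd Y (S x) (S y)" if "x \<in> vcarrier Y'" "y \<in> vcarrier Y'" for x y
      by (rule eq) (use iso S that Y.add_closed Y'.add_closed in \<open>auto simp: linear_isometry_def\<close>)
    show "S (vscale Y' a x) = vscale Y a (S x)" if "x \<in> vcarrier Y'" for a x
      by (rule eq) (use iso S that Y.scale_closed Y'.scale_closed in \<open>auto simp: linear_isometry_def\<close>)
    show "vnorm Y (S x) = vnorm Y' x" if "x \<in> vcarrier Y'" for x
      using iso S[OF that] by (metis linear_isometry_def)
  qed
  moreover have "S ` vcarrier Y' = vcarrier Y"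
    using S T_in ST by (auto simp: image_iff) metis
  moreover have "S (\<rho> R z) = \<psi> R z" if "R \<in> I" "z \<in> vcarrier (Z R)" for R z
    using ST[OF linear_isometry_closed[OF _ that(2), of Y "\<psi> R"]] comp[OF that] c(1) that(1)
    by (simp add: cocone_def)
  ultimately show "cocone_iso I Z \<phi> Y' \<rho> Y \<psi> S"
    using c by (simp add: cocone_iso_def)
qed


section \<open>The \<open>L\<^sup>p\<close> seminorm on functions\<close>

definition Lp_norm :: "real \<Rightarrow> 'a measure \<Rightarrow> ('a \<Rightarrow> real) \<Rightarrow> real" where
  "Lp_norm p M f = (\<integral>x. \<bar>f x\<bar> powr p \<partial>M) powr (1 / p)"

lemma Lp_fun_measurable: "f \<in> Lp_fun p M \<Longrightarrow> f \<in> borel_measurable M"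
  by (simp add: Lp_fun_def)

lemma Lp_fun_integrable: "f \<in> Lp_fun p M \<Longrightarrow> integrable M (\<lambda>x. \<bar>f x\<bar> powr p)"
  by (simp add: Lp_fun_def)

text \<open>
  Convexity of the power on the open half line extends to 0 by \<open>(s u)\<^sup>p \<le> s u\<^sup>p\<close> for \<open>s < 1\<close>, and then to
  the whole line by the triangle inequality and monotonicity.
\<close>

lemma convex_abs_powr:
  assumes "1 \<le> p"
  shows "convex_on UNIV (\<lambda>x::real. \<bar>x\<bar> powr p)"
proof (rule convex_onI)
  fix t x y :: real assume t: "0 < t" "t < 1"
  have scale: "(s * u) powr p \<le> s * u powr p" if "0 < s" "s < 1" "0 \<le> u" for s u :: real
  proof -
    have "s powr p \<le> s powr 1" using that assms by (intro powr_mono') auto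
    then show ?thesis using that by (simp add: powr_mult mult_right_mono)
  qed
  have "((1 - t) * a + t * b) powr p \<le> (1 - t) * a powr p + t * b powr p"
    if "0 \<le> a" "0 \<le> b" for a b :: real
  proof (cases "a = 0 \<or> b = 0")
    case True
    then show ?thesis using scale[of t b] scale[of "1 - t" a] that t assms by auto
  next
    case False
    then show ?thesis
      using convex_onD[OF powr_convex[OF assms], of t a b] that t by simp
  qed
  from this[of "\<bar>x\<bar>" "\<bar>y\<bar>"]
  have "((1 - t) * \<bar>x\<bar> + t * \<bar>y\<bar>) powr p \<le> (1 - t) * \<bar>x\<bar> powr p + t * \<bar>y\<bar> powr p" by simp
  moreover have "\<bar>(1 - t) *\<^sub>R x + t *\<^sub>R y\<bar> \<le> (1 - t) * \<bar>x\<bar> + t * \<bar>y\<bar>"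
    using t abs_triangle_ineq[of "(1 - t) * x" "t * y"] by (simp add: abs_mult)
  ultimately show "\<bar>(1 - t) *\<^sub>R x + t *\<^sub>R y\<bar> powr p \<le> (1 - t) * \<bar>x\<bar> powr p + t * \<bar>y\<bar> powr p"
    using powr_mono2[of p] assms by (meson abs_ge_zero dual_order.trans order.trans zero_le_one)
qed simp

lemma abs_add_powr_le:
  fixes x y :: real
  assumes "1 \<le> p"
  shows "\<bar>x + y\<bar> powr p \<le> 2 powr p * (\<bar>x\<bar> powr p + \<bar>y\<bar> powr p)"
proof -
  have "\<bar>(x + y) / 2\<bar> powr p \<le> (\<bar>x\<bar> powr p + \<bar>y\<bar> powr p) / 2"
    using convex_onD[OF convex_abs_powr[OF assms], of "1/2" x y] by (simp add: add_divide_distrib)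
  also have "\<dots> \<le> \<bar>x\<bar> powr p + \<bar>y\<bar> powr p" by simp
  finally show ?thesis by (simp add: powr_divide field_simps)
qed

lemma Lp_fun_add:
  assumes p: "1 \<le> p" and f: "f \<in> Lp_fun p M" and g: "g \<in> Lp_fun p M"
  shows "(\<lambda>x. f x + g x) \<in> Lp_fun p M"
proof -
  note [measurable] = Lp_fun_measurable[OF f] Lp_fun_measurable[OF g]
  have "integrable M (\<lambda>x. \<bar>f x + g x\<bar> powr p)"
  proof (rule Bochner_Integration.integrable_bound)
    show "integrable M (\<lambda>x. 2 powr p * (\<bar>f x\<bar> powr p + \<bar>g x\<bar> powr p))"
      by (intro integrable_mult_right Bochner_Integration.integrable_add Lp_fun_integrable f g)
    show "AE x in M. norm (\<bar>f x + g x\<bar> powr p) \<le> norm (2 powr p * (\<bar>f x\<bar> powr p + \<bar>g x\<bar> powr p))"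
      using abs_add_powr_le[OF p] by (auto simp: abs_mult)
  qed measurable
  then show ?thesis by (simp add: Lp_fun_def)
qed

lemma Lp_fun_cmult: "f \<in> Lp_fun p M \<Longrightarrow> (\<lambda>x. c * f x) \<in> Lp_fun p M"
  by (auto simp: Lp_fun_def abs_mult powr_mult)

lemma Lp_fun_zero: "(\<lambda>_. 0) \<in> Lp_fun p M"
  by (simp add: Lp_fun_def)

lemma Lp_fun_diff:
  assumes "1 \<le> p" "f \<in> Lp_fun p M" "g \<in> Lp_fun p M"
  shows "(\<lambda>x. f x - g x) \<in> Lp_fun p M"
  using Lp_fun_add[OF assms(1,2) Lp_fun_cmult[OF assms(3), of "-1"]] by simp

lemma Lp_fun_cong_AE:
  assumes "f \<in> Lp_fun p M" "g \<in> borel_measurable M" "AE x in M. g x = f x"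
  shows "g \<in> Lp_fun p M"
proof -
  have [measurable]: "f \<in> borel_measurable M" using assms(1) by (rule Lp_fun_measurable)
  have "integrable M (\<lambda>x. \<bar>g x\<bar> powr p) \<longleftrightarrow> integrable M (\<lambda>x. \<bar>f x\<bar> powr p)"
    using assms(2,3) by (intro integrable_cong_AE) auto
  then show ?thesis using assms by (simp add: Lp_fun_def)
qed

lemma Lp_fun_bounded:
  assumes "1 \<le> p" "w \<in> Lp_fun p M" "f \<in> borel_measurable M" "AE x in M. \<bar>f x\<bar> \<le> \<bar>w x\<bar>"
  shows "f \<in> Lp_fun p M"
proof -
  note [measurable] = assms(3)
  have "integrable M (\<lambda>x. \<bar>f x\<bar> powr p)"
  proof (rule Bochner_Integration.integrable_bound[OF Lp_fun_integrable[OF assms(2)]])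
    show "AE x in M. norm (\<bar>f x\<bar> powr p) \<le> norm (\<bar>w x\<bar> powr p)"
      using assms(4) by eventually_elim (use assms(1) in \<open>simp add: powr_mono2\<close>)
  qed measurable
  then show ?thesis using assms by (simp add: Lp_fun_def)
qed

lemma (in finite_measure) Lp_fun_const: "(\<lambda>_. c) \<in> Lp_fun p M"
  by (simp add: Lp_fun_def)

lemma (in finite_measure) Lp_fun_imp_integrable:
  assumes "1 \<le> p" "f \<in> Lp_fun p M"
  shows "integrable M f"
proof (rule Bochner_Integration.integrable_bound)
  show "integrable M (\<lambda>x. 1 + \<bar>f x\<bar> powr p)"
    using Lp_fun_integrable[OF assms(2)] by simp
  have "\<bar>y\<bar> \<le> 1 + \<bar>y\<bar> powr p" for y :: real
  proof (cases "\<bar>y\<bar> \<le> 1")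
    case False
    then show ?thesis using powr_mono[of 1 p "\<bar>y\<bar>"] assms(1) by simp
  qed (simp add: add_increasing2)
  then show "AE x in M. norm (f x) \<le> norm (1 + \<bar>f x\<bar> powr p)" by simp
qed (rule Lp_fun_measurable[OF assms(2)])

lemma Lp_norm_nonneg: "0 \<le> Lp_norm p M f"
  by (simp add: Lp_norm_def)

lemma Lp_norm_powr: "1 \<le> p \<Longrightarrow> Lp_norm p M f powr p = (\<integral>x. \<bar>f x\<bar> powr p \<partial>M)"
  by (simp add: Lp_norm_def powr_powr)

lemma Lp_norm_cong_AE:
  assumes "f \<in> borel_measurable M" "g \<in> borel_measurable M" "AE x in M. f x = g x"
  shows "Lp_norm p M f = Lp_norm p M g"
proof -
  note [measurable] = assms(1,2)
  have "(\<integral>x. \<bar>f x\<bar> powr p \<partial>M) = (\<integral>x. \<bar>g x\<bar> powr p \<partial>M)"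
    using assms(3) by (intro integral_cong_AE) auto
  then show ?thesis by (simp add: Lp_norm_def)
qed

lemma Lp_norm_le_iff:
  assumes "1 \<le> p" "0 \<le> c"
  shows "Lp_norm p M f \<le> c \<longleftrightarrow> (\<integral>x. \<bar>f x\<bar> powr p \<partial>M) \<le> c powr p"
proof -
  have "Lp_norm p M f \<le> c \<longleftrightarrow> Lp_norm p M f powr p \<le> c powr p"
    using assms powr_mono2[of p "Lp_norm p M f" c] powr_less_mono2[of p c "Lp_norm p M f"]
    by (auto simp: Lp_norm_nonneg not_le[symmetric])
  then show ?thesis using assms by (simp add: Lp_norm_powr)
qed

lemma Lp_norm_zero_iff:
  assumes "1 \<le> p" "f \<in> Lp_fun p M"
  shows "Lp_norm p M f = 0 \<longleftrightarrow> (AE x in M. f x = 0)"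
proof -
  have "Lp_norm p M f = 0 \<longleftrightarrow> (\<integral>x. \<bar>f x\<bar> powr p \<partial>M) = 0"
    by (simp add: Lp_norm_def)
  also have "\<dots> \<longleftrightarrow> (AE x in M. \<bar>f x\<bar> powr p = 0)"
    by (intro integral_nonneg_eq_0_iff_AE Lp_fun_integrable assms) simp
  finally show ?thesis by simp
qed

lemma Lp_norm_cmult: "1 \<le> p \<Longrightarrow> Lp_norm p M (\<lambda>x. c * f x) = \<bar>c\<bar> * Lp_norm p M f"
  by (simp add: Lp_norm_def abs_mult powr_mult powr_powr)

lemma Lp_norm_minus: "Lp_norm p M (\<lambda>x. f x - g x) = Lp_norm p M (\<lambda>x. g x - f x)"
  by (simp add: Lp_norm_def abs_minus_commute)

text \<open>
  Minkowski's inequality: for \<open>a = \<parallel>f\<parallel>\<close> and \<open>b = \<parallel>g\<parallel>\<close> the function \<open>(f + g) / (a + b)\<close> is a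
  convex combination of \<open>f / a\<close> and \<open>g / b\<close>, whose \<open>p\<close>-th powers have integral 1.
\<close>

lemma Lp_norm_add:
  assumes p: "1 \<le> p" and f: "f \<in> Lp_fun p M" and g: "g \<in> Lp_fun p M"
  shows "Lp_norm p M (\<lambda>x. f x + g x) \<le> Lp_norm p M f + Lp_norm p M g"
proof -
  note [measurable] = Lp_fun_measurable[OF f] Lp_fun_measurable[OF g]
  define a b where "a = Lp_norm p M f" and "b = Lp_norm p M g"
  have ab: "0 \<le> a" "0 \<le> b" by (simp_all add: a_def b_def Lp_norm_nonneg)
  consider "a = 0" | "b = 0" | "0 < a" "0 < b" using ab by linarith
  then show ?thesis
  proof cases
    case 1
    then have "AE x in M. f x = 0" using Lp_norm_zero_iff[OF p f] by (simp add: a_def)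
    then have "Lp_norm p M (\<lambda>x. f x + g x) = b"
      unfolding b_def by (intro Lp_norm_cong_AE) auto
    then show ?thesis using ab by (simp add: a_def b_def)
  next
    case 2
    then have "AE x in M. g x = 0" using Lp_norm_zero_iff[OF p g] by (simp add: b_def)
    then have "Lp_norm p M (\<lambda>x. f x + g x) = a"
      unfolding a_def by (intro Lp_norm_cong_AE) auto
    then show ?thesis using ab by (simp add: a_def b_def)
  next
    case 3
    define t where "t = b / (a + b)"
    have t: "0 \<le> t" "t \<le> 1" "1 - t = a / (a + b)"
      using 3 by (auto simp: t_def field_simps)
    have "\<bar>f x + g x\<bar> powr p / (a + b) powr p
        \<le> (1 - t) * (\<bar>f x\<bar> powr p / a powr p) + t * (\<bar>g x\<bar> powr p / b powr p)" for x
    proof -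
      have "(f x + g x) / (a + b) = (1 - t) * (f x / a) + t * (g x / b)"
        unfolding t(3) using 3 by (simp add: t_def add_divide_distrib)
      then have "\<bar>(f x + g x) / (a + b)\<bar> powr p
          \<le> (1 - t) * \<bar>f x / a\<bar> powr p + t * \<bar>g x / b\<bar> powr p"
        using convex_onD[OF convex_abs_powr[OF p], of t "f x / a" "g x / b"] t by simp
      then show ?thesis using 3 by (simp add: powr_divide)
    qed
    then have "(\<integral>x. \<bar>f x + g x\<bar> powr p / (a + b) powr p \<partial>M)
        \<le> (\<integral>x. (1 - t) * (\<bar>f x\<bar> powr p / a powr p) + t * (\<bar>g x\<bar> powr p / b powr p) \<partial>M)"
      using Lp_fun_integrable[OF f] Lp_fun_integrable[OF g] Lp_fun_integrable[OF Lp_fun_add[OF p f g]]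
      by (intro integral_mono) auto
    also have "\<dots> = (1 - t) * (a powr p / a powr p) + t * (b powr p / b powr p)"
      using Lp_fun_integrable[OF f] Lp_fun_integrable[OF g]
      by (simp add: Lp_norm_powr[OF p] a_def b_def)
    also have "\<dots> = 1" using 3 by simp
    finally have "(\<integral>x. \<bar>f x + g x\<bar> powr p \<partial>M) \<le> (a + b) powr p"
      using 3 by (simp add: divide_le_eq)
    then show ?thesis
      using ab by (simp add: Lp_norm_le_iff[OF p] a_def b_def)
  qed
qed

lemma Lp_norm_triangle:
  assumes "1 \<le> p" "f \<in> Lp_fun p M" "g \<in> Lp_fun p M" "h \<in> Lp_fun p M"
  shows "Lp_norm p M (\<lambda>x. f x - h x) \<le> Lp_norm p M (\<lambda>x. f x - g x) + Lp_norm p M (\<lambda>x. g x - h x)"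
  using Lp_norm_add[OF assms(1) Lp_fun_diff[OF assms(1,2,3)] Lp_fun_diff[OF assms(1,3,4)]] by simp

text \<open>
  The Riesz--Fischer theorem.  Let \<open>d k = f (r (k + 1)) - f (r k)\<close> be the increments along a
  subsequence with \<open>\<parallel>d k\<parallel> \<le> (1/4)^k\<close>.  The \<open>p\<close>-th powers of \<open>2^k |d k|\<close> have a finite sum of integrals,
  so almost everywhere they tend to 0 and the subsequence converges geometrically.  Fatou's lemma
  turns this into convergence in norm of the whole sequence.
\<close>

lemma Lp_complete:
  assumes p: "1 \<le> p" and f: "\<And>n::nat. f n \<in> Lp_fun p M"
    and cau: "\<And>e. 0 < e \<Longrightarrow> \<exists>N. \<forall>m\<ge>N. \<forall>n\<ge>N. Lp_norm p M (\<lambda>x. f m x - f n x) < e"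
  obtains g where "g \<in> Lp_fun p M" "(\<lambda>n. Lp_norm p M (\<lambda>x. f n x - g x)) \<longlonglongrightarrow> 0"
proof -
  have [measurable]: "f n \<in> borel_measurable M" for n by (rule Lp_fun_measurable[OF f])
  have "\<forall>k. \<exists>N. \<forall>m\<ge>N. \<forall>n\<ge>N. Lp_norm p M (\<lambda>x. f m x - f n x) < (1 / 4) ^ k"
    using cau by simp
  then obtain N where N: "\<And>k m n. m \<ge> N k \<Longrightarrow> n \<ge> N k \<Longrightarrow> Lp_norm p M (\<lambda>x. f m x - f n x) < (1 / 4) ^ k"
    by metis
  \<comment> \<open>The partial sums dominate all earlier thresholds, which makes \<open>r\<close> a common tail for them.\<close>
  define r where "r k = (\<Sum>j\<le>k. N j)" for k
  have r_ge: "N K \<le> r k" if "K \<le> k" for K k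
    unfolding r_def using that by (intro member_le_sum) auto
  define d where "d k x = f (r (Suc k)) x - f (r k) x" for k x
  have [measurable]: "d k \<in> borel_measurable M" for k unfolding d_def by measurable
  have d: "d k \<in> Lp_fun p M" for k unfolding d_def by (intro Lp_fun_diff p f)
  have d_int: "(\<integral>\<^sup>+x. ennreal (\<bar>2 ^ k * d k x\<bar> powr p) \<partial>M) \<le> ennreal ((1 / 2) ^ k)" for k
  proof -
    have "Lp_norm p M (\<lambda>x. 2 ^ k * d k x) = 2 ^ k * Lp_norm p M (d k)"
      by (simp add: Lp_norm_cmult[OF p])
    also have "\<dots> \<le> 2 ^ k * (1 / 4) ^ k"
      using N[OF r_ge r_ge, of k "Suc k" k] by (intro mult_left_mono) (simp_all add: d_def[abs_def])
    also have "\<dots> = (1 / 2) ^ k" by (subst power_mult_distrib[symmetric]) simp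
    finally have "(\<integral>x. \<bar>2 ^ k * d k x\<bar> powr p \<partial>M) \<le> ((1 / 2) ^ k) powr p"
      by (simp add: Lp_norm_le_iff[OF p])
    also have "\<dots> \<le> ((1 / 2) ^ k) powr 1"
      using p by (intro powr_mono') (auto simp: power_le_one)
    finally have "(\<integral>x. \<bar>2 ^ k * d k x\<bar> powr p \<partial>M) \<le> (1 / 2) ^ k" by simp
    moreover have "(\<integral>\<^sup>+x. ennreal (\<bar>2 ^ k * d k x\<bar> powr p) \<partial>M)
        = ennreal (\<integral>x. \<bar>2 ^ k * d k x\<bar> powr p \<partial>M)"
      by (intro nn_integral_eq_integral Lp_fun_integrable Lp_fun_cmult d) simp
    ultimately show ?thesis by (simp add: ennreal_leI)
  qed
  have "(\<integral>\<^sup>+x. (\<Sum>k. ennreal (\<bar>2 ^ k * d k x\<bar> powr p)) \<partial>M)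
      = (\<Sum>k. \<integral>\<^sup>+x. ennreal (\<bar>2 ^ k * d k x\<bar> powr p) \<partial>M)"
    by (intro nn_integral_suminf) measurable
  also have "\<dots> \<le> (\<Sum>k. ennreal ((1 / 2) ^ k))"
    by (intro suminf_le d_int) auto
  also have "\<dots> = ennreal (\<Sum>k. (1 / 2) ^ k)"
    by (intro suminf_ennreal2) (auto intro: summable_geometric)
  also have "\<dots> < \<infinity>" by simp
  finally have "(\<integral>\<^sup>+x. (\<Sum>k. ennreal (\<bar>2 ^ k * d k x\<bar> powr p)) \<partial>M) \<noteq> \<infinity>"
    by simp
  then have "AE x in M. (\<Sum>k. ennreal (\<bar>2 ^ k * d k x\<bar> powr p)) \<noteq> \<infinity>"
    by (intro nn_integral_PInf_AE) measurable
  then have conv: "AE x in M. convergent (\<lambda>k. f (r k) x)"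
  proof eventually_elim
    case (elim x)
    have "summable (\<lambda>k. \<bar>2 ^ k * d k x\<bar> powr p)"
      using elim by (intro summable_suminf_not_top) auto
    then have "(\<lambda>k. \<bar>2 ^ k * d k x\<bar> powr p) \<longlonglongrightarrow> 0" by (rule summable_LIMSEQ_zero)
    then have "\<forall>\<^sub>F k in sequentially. \<bar>2 ^ k * d k x\<bar> powr p < 1"
      by (rule order_tendstoD) simp
    then have "\<forall>\<^sub>F k in sequentially. norm (d k x) \<le> (1 / 2) ^ k"
    proof eventually_elim
      case (elim k)
      have "\<bar>2 ^ k * d k x\<bar> < 1"
      proof (rule ccontr)
        assume "\<not> \<bar>2 ^ k * d k x\<bar> < 1"
        then have "1 \<le> \<bar>2 ^ k * d k x\<bar> powr p" using p by (intro ge_one_powr_ge_zero) auto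
        then show False using elim by simp
      qed
      then show ?case by (simp add: abs_mult power_divide field_simps)
    qed
    then have "summable (\<lambda>k. d k x)"
      by (rule summable_comparison_test_ev) (simp add: summable_geometric)
    then have "convergent (\<lambda>n. \<Sum>k<n. d k x)" by (simp add: summable_iff_convergent)
    then have "convergent (\<lambda>n. (\<Sum>k<n. d k x) + f (r 0) x)"
      by (intro convergent_add convergent_const)
    moreover have "(\<Sum>k<n. d k x) + f (r 0) x = f (r n) x" for n
      unfolding d_def using sum_lessThan_telescope[of "\<lambda>k. f (r k) x" n] by simp
    ultimately show ?case by simp
  qed
  define g where "g x = lim (\<lambda>k. f (r k) x)" for x
  have [measurable]: "g \<in> borel_measurable M" unfolding g_def by measurable
  have g_lim: "AE x in M. (\<lambda>k. f (r k) x) \<longlonglongrightarrow> g x"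
    using conv by eventually_elim (simp add: g_def convergent_LIMSEQ_iff)
  have fatou: "(\<integral>\<^sup>+x. ennreal (\<bar>f n x - g x\<bar> powr p) \<partial>M) \<le> ennreal (((1 / 4) ^ K) powr p)"
    if n: "n \<ge> N K" for n K
  proof -
    have "AE x in M. ennreal (\<bar>f n x - g x\<bar> powr p)
        = liminf (\<lambda>k. ennreal (\<bar>f n x - f (r k) x\<bar> powr p))"
      using g_lim
    proof eventually_elim
      case (elim x)
      have "(\<lambda>k. ennreal (\<bar>f n x - f (r k) x\<bar> powr p)) \<longlonglongrightarrow> ennreal (\<bar>f n x - g x\<bar> powr p)"
        using p elim by (intro tendsto_ennrealI tendsto_powr' tendsto_intros) auto
      then show ?case by (intro lim_imp_Liminf[symmetric]) auto
    qed
    then have "(\<integral>\<^sup>+x. ennreal (\<bar>f n x - g x\<bar> powr p) \<partial>M)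
        = (\<integral>\<^sup>+x. liminf (\<lambda>k. ennreal (\<bar>f n x - f (r k) x\<bar> powr p)) \<partial>M)"
      by (rule nn_integral_cong_AE)
    also have "\<dots> \<le> liminf (\<lambda>k. \<integral>\<^sup>+x. ennreal (\<bar>f n x - f (r k) x\<bar> powr p) \<partial>M)"
      by (intro nn_integral_liminf) measurable
    also have "\<dots> \<le> ennreal (((1 / 4) ^ K) powr p)"
    proof (rule Liminf_le)
      show "\<forall>\<^sub>F k in sequentially. (\<integral>\<^sup>+x. ennreal (\<bar>f n x - f (r k) x\<bar> powr p) \<partial>M)
          \<le> ennreal (((1 / 4) ^ K) powr p)"
        using eventually_ge_at_top[of K]
      proof eventually_elim
        case (elim k)
        have "Lp_norm p M (\<lambda>x. f n x - f (r k) x) \<le> (1 / 4) ^ K"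
          using N[OF n r_ge[OF elim]] by simp
        then have "(\<integral>x. \<bar>f n x - f (r k) x\<bar> powr p \<partial>M) \<le> ((1 / 4) ^ K) powr p"
          by (simp add: Lp_norm_le_iff[OF p])
        moreover have "(\<integral>\<^sup>+x. ennreal (\<bar>f n x - f (r k) x\<bar> powr p) \<partial>M)
            = ennreal (\<integral>x. \<bar>f n x - f (r k) x\<bar> powr p \<partial>M)"
          by (intro nn_integral_eq_integral Lp_fun_integrable Lp_fun_diff f p) simp
        ultimately show ?case by (simp add: ennreal_leI)
      qed
    qed simp
    finally show ?thesis .
  qed
  have fg: "(\<lambda>x. f n x - g x) \<in> Lp_fun p M" if "n \<ge> N K" for n K
  proof -
    have "integrable M (\<lambda>x. \<bar>f n x - g x\<bar> powr p)"
    proof (rule integrableI_bounded)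
      show "(\<integral>\<^sup>+x. ennreal (norm (\<bar>f n x - g x\<bar> powr p)) \<partial>M) < \<infinity>"
        using fatou[OF that] by (simp add: le_less_trans)
    qed measurable
    then show ?thesis by (simp add: Lp_fun_def)
  qed
  have "(\<lambda>x. f (N 0) x - (f (N 0) x - g x)) \<in> Lp_fun p M"
    by (intro Lp_fun_diff[OF p f fg[OF order_refl]])
  then have g: "g \<in> Lp_fun p M" by simp
  have small: "Lp_norm p M (\<lambda>x. f n x - g x) \<le> (1 / 4) ^ K" if "n \<ge> N K" for n K
  proof -
    have "ennreal (\<integral>x. \<bar>f n x - g x\<bar> powr p \<partial>M) \<le> ennreal (((1 / 4) ^ K) powr p)"
      using fatou[OF that] Lp_fun_integrable[OF fg[OF that]]
      by (simp add: nn_integral_eq_integral)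
    then show ?thesis by (simp add: Lp_norm_le_iff[OF p])
  qed
  have "(\<lambda>n. Lp_norm p M (\<lambda>x. f n x - g x)) \<longlonglongrightarrow> 0"
  proof (rule LIMSEQ_I)
    fix e :: real assume "0 < e"
    then obtain K where K: "(1 / 4 :: real) ^ K < e"
      using real_arch_pow_inv[of e "1 / 4"] by auto
    have "norm (Lp_norm p M (\<lambda>x. f n x - g x) - 0) < e" if "n \<ge> N K" for n
      using small[OF that] K Lp_norm_nonneg[of p M "\<lambda>x. f n x - g x"] by simp
    then show "\<exists>no. \<forall>n\<ge>no. norm (Lp_norm p M (\<lambda>x. f n x - g x) - 0) < e" by blast
  qed
  with g show thesis by (rule that)
qed

lemma Lp_norm_dominated_convergence:
  assumes p: "1 \<le> p" and w: "w \<in> Lp_fun p M" and [measurable]: "\<And>n. U n \<in> borel_measurable M"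
    "u \<in> borel_measurable M"
    and bound: "\<And>n. AE x in M. \<bar>U n x\<bar> \<le> \<bar>w x\<bar>" "AE x in M. \<bar>u x\<bar> \<le> \<bar>w x\<bar>"
    and lim: "AE x in M. (\<lambda>n. U n x) \<longlonglongrightarrow> u x"
  shows "(\<lambda>n. Lp_norm p M (\<lambda>x. U n x - u x)) \<longlonglongrightarrow> 0"
proof -
  have "(\<lambda>n. \<integral>x. \<bar>U n x - u x\<bar> powr p \<partial>M) \<longlonglongrightarrow> (\<integral>x. 0 \<partial>M)"
  proof (rule integral_dominated_convergence)
    show "integrable M (\<lambda>x. \<bar>2 * w x\<bar> powr p)"
      by (intro Lp_fun_integrable Lp_fun_cmult w)
    show "AE x in M. (\<lambda>n. \<bar>U n x - u x\<bar> powr p) \<longlonglongrightarrow> 0"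
      using lim
    proof eventually_elim
      case (elim x)
      have "(\<lambda>n. \<bar>U n x - u x\<bar>) \<longlonglongrightarrow> 0"
        using elim by (simp add: tendsto_rabs_zero_iff LIM_zero_iff)
      from tendsto_powr'[OF this tendsto_const, of p] show ?case using p by simp
    qed
    show "AE x in M. norm (\<bar>U n x - u x\<bar> powr p) \<le> \<bar>2 * w x\<bar> powr p" for n
      using bound(1)[of n] bound(2)
    proof eventually_elim
      case (elim x)
      then have "\<bar>U n x - u x\<bar> \<le> \<bar>2 * w x\<bar>" by linarith
      then show ?case using p by (simp add: powr_mono2)
    qed
  qed measurable
  then have "(\<lambda>n. \<integral>x. \<bar>U n x - u x\<bar> powr p \<partial>M) \<longlonglongrightarrow> 0" by simp
  from tendsto_powr'[OF this tendsto_const, of "1 / p"] show ?thesis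
    using p by (simp add: Lp_norm_def)
qed


section \<open>The Banach space of classes\<close>

lemma Lp_class_self: "f \<in> Lp_fun p M \<Longrightarrow> f \<in> Lp_class p M f"
  by (simp add: Lp_class_def)

lemma Lp_classD:
  "g \<in> Lp_class p M f \<Longrightarrow> g \<in> Lp_fun p M"
  "g \<in> Lp_class p M f \<Longrightarrow> AE x in M. g x = f x"
  by (simp_all add: Lp_class_def)

lemma Lp_class_eqI:
  assumes "AE x in M. f x = g x"
  shows "Lp_class p M f = Lp_class p M g"
proof -
  have "(AE x in M. h x = f x) \<longleftrightarrow> (AE x in M. h x = g x)" for h
  proof
    assume "AE x in M. h x = f x"
    then show "AE x in M. h x = g x" using assms by eventually_elim simp
  next
    assume "AE x in M. h x = g x"
    then show "AE x in M. h x = f x" using assms by eventually_elim simp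
  qed
  then show ?thesis by (simp add: Lp_class_def)
qed

lemma Lp_class_eq_iff:
  assumes "f \<in> Lp_fun p M"
  shows "Lp_class p M f = Lp_class p M g \<longleftrightarrow> (AE x in M. f x = g x)"
proof
  assume "Lp_class p M f = Lp_class p M g"
  then have "f \<in> Lp_class p M g" using Lp_class_self[OF assms] by simp
  then show "AE x in M. f x = g x" by (rule Lp_classD(2))
qed (rule Lp_class_eqI)

lemma Lp_carrierI: "f \<in> Lp_fun p M \<Longrightarrow> Lp_class p M f \<in> vcarrier (Lp p M)"
  by (simp add: Lp_def)

lemma Lp_carrierE:
  assumes "A \<in> vcarrier (Lp p M)"
  obtains f where "f \<in> Lp_fun p M" "A = Lp_class p M f"
  using assms by (auto simp: Lp_def)

lemma Lp_add_class:
  assumes "f \<in> Lp_fun p M" "g \<in> Lp_fun p M"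
  shows "vadd (Lp p M) (Lp_class p M f) (Lp_class p M g) = Lp_class p M (\<lambda>x. f x + g x)"
proof -
  have eq: "Lp_class p M (\<lambda>x. f' x + g' x) = Lp_class p M (\<lambda>x. f x + g x)"
    if "f' \<in> Lp_class p M f" "g' \<in> Lp_class p M g" for f' g'
  proof (rule Lp_class_eqI)
    show "AE x in M. f' x + g' x = f x + g x"
      using Lp_classD(2)[OF that(1)] Lp_classD(2)[OF that(2)] by eventually_elim simp
  qed
  have "(\<Union>f'\<in>Lp_class p M f. \<Union>g'\<in>Lp_class p M g. Lp_class p M (\<lambda>x. f' x + g' x))
      = Lp_class p M (\<lambda>x. f x + g x)"
    by (rule UN_eq_common_value[OF _ Lp_class_self[OF assms(1)]],
        rule UN_eq_common_value[OF _ Lp_class_self[OF assms(2)]], erule (1) eq)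
  then show ?thesis by (simp only: Lp_def nvs.select_convs)
qed

lemma Lp_scale_class:
  assumes "f \<in> Lp_fun p M"
  shows "vscale (Lp p M) c (Lp_class p M f) = Lp_class p M (\<lambda>x. c * f x)"
proof -
  have eq: "Lp_class p M (\<lambda>x. c * f' x) = Lp_class p M (\<lambda>x. c * f x)" if "f' \<in> Lp_class p M f" for f'
  proof (rule Lp_class_eqI)
    show "AE x in M. c * f' x = c * f x" using Lp_classD(2)[OF that] by eventually_elim simp
  qed
  have "(\<Union>f'\<in>Lp_class p M f. Lp_class p M (\<lambda>x. c * f' x)) = Lp_class p M (\<lambda>x. c * f x)"
    by (rule UN_eq_common_value[OF _ Lp_class_self[OF assms]], erule eq)
  then show ?thesis by (simp only: Lp_def nvs.select_convs)
qed

lemma Lp_zero: "vzero (Lp p M) = Lp_class p M (\<lambda>_. 0)"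
  by (simp add: Lp_def)

lemma Lp_norm_class:
  assumes f: "f \<in> Lp_fun p M"
  shows "vnorm (Lp p M) (Lp_class p M f) = Lp_norm p M f"
proof -
  have "Lp_norm p M g = Lp_norm p M f" if "g \<in> Lp_class p M f" for g
    using Lp_classD[OF that] f by (intro Lp_norm_cong_AE Lp_fun_measurable) auto
  then have "Lp_norm p M ` Lp_class p M f = {Lp_norm p M f}"
    using Lp_class_self[OF f] by blast
  moreover have "vnorm (Lp p M) (Lp_class p M f) = the_elem (Lp_norm p M ` Lp_class p M f)"
    by (simp add: Lp_def Lp_norm_def[abs_def])
  ultimately show ?thesis by simp
qed

lemma Lp_diff_class:
  assumes "f \<in> Lp_fun p M" "g \<in> Lp_fun p M"
  shows "vdiff (Lp p M) (Lp_class p M f) (Lp_class p M g) = Lp_class p M (\<lambda>x. f x - g x)"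
  using Lp_add_class[OF assms(1) Lp_fun_cmult[OF assms(2), of "-1"]]
  by (simp add: vdiff_def Lp_scale_class assms)

theorem banach_space_Lp:
  assumes p: "1 \<le> p"
  shows "banach_space_on (Lp p M)"
proof -
  note closed = Lp_fun_add[OF p] Lp_fun_cmult Lp_fun_zero
  note ops = Lp_add_class Lp_scale_class Lp_zero Lp_norm_class
  have "normed_space_on (Lp p M)"
  proof
    fix x y z and a b :: real
    show "vzero (Lp p M) \<in> vcarrier (Lp p M)"
      by (simp add: ops Lp_carrierI closed)
    assume "x \<in> vcarrier (Lp p M)"
    then obtain f where f: "f \<in> Lp_fun p M" "x = Lp_class p M f" by (rule Lp_carrierE)
    show "vscale (Lp p M) a x \<in> vcarrier (Lp p M)"
      "vadd (Lp p M) x (vzero (Lp p M)) = x" "vscale (Lp p M) 1 x = x"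
      "vadd (Lp p M) x (vscale (Lp p M) (-1) x) = vzero (Lp p M)"
      "vscale (Lp p M) a (vscale (Lp p M) b x) = vscale (Lp p M) (a * b) x"
      "vscale (Lp p M) (a + b) x = vadd (Lp p M) (vscale (Lp p M) a x) (vscale (Lp p M) b x)"
      "0 \<le> vnorm (Lp p M) x" "vnorm (Lp p M) (vscale (Lp p M) a x) = \<bar>a\<bar> * vnorm (Lp p M) x"
      using Lp_fun_cmult[OF f(1), of "-1"]
      by (simp_all add: f ops closed Lp_carrierI mult.assoc distrib_right Lp_norm_nonneg
          Lp_norm_cmult[OF p])
    show "vnorm (Lp p M) x = 0 \<longleftrightarrow> x = vzero (Lp p M)"
      by (simp add: f ops Lp_norm_zero_iff[OF p] Lp_class_eq_iff)
    assume "y \<in> vcarrier (Lp p M)"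
    then obtain g where g: "g \<in> Lp_fun p M" "y = Lp_class p M g" by (rule Lp_carrierE)
    show "vadd (Lp p M) x y \<in> vcarrier (Lp p M)" "vadd (Lp p M) x y = vadd (Lp p M) y x"
      "vscale (Lp p M) a (vadd (Lp p M) x y) = vadd (Lp p M) (vscale (Lp p M) a x) (vscale (Lp p M) a y)"
      "vnorm (Lp p M) (vadd (Lp p M) x y) \<le> vnorm (Lp p M) x + vnorm (Lp p M) y"
      by (simp_all add: f g ops closed Lp_carrierI add.commute distrib_left Lp_norm_add[OF p])
    assume "z \<in> vcarrier (Lp p M)"
    then obtain h where h: "h \<in> Lp_fun p M" "z = Lp_class p M h" by (rule Lp_carrierE)
    show "vadd (Lp p M) (vadd (Lp p M) x y) z = vadd (Lp p M) x (vadd (Lp p M) y z)"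
      by (simp add: f g h ops closed add.assoc)
  qed
  then interpret normed_space_on "Lp p M" .
  show ?thesis
  proof
    fix x :: "nat \<Rightarrow> ('a \<Rightarrow> real) set"
    assume x: "\<And>n. x n \<in> vcarrier (Lp p M)"
    assume cau: "\<And>e. 0 < e \<Longrightarrow> \<exists>N. \<forall>m\<ge>N. \<forall>n\<ge>N. vnorm (Lp p M) (vdiff (Lp p M) (x m) (x n)) < e"
    have "\<exists>f. f \<in> Lp_fun p M \<and> x n = Lp_class p M f" for n
      using Lp_carrierE[OF x[of n]] by blast
    then have "\<exists>f. \<forall>n. f n \<in> Lp_fun p M \<and> x n = Lp_class p M (f n)"
      by (intro choice allI)
    then obtain f where f: "\<And>n. f n \<in> Lp_fun p M" "\<And>n. x n = Lp_class p M (f n)" by blast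
    have nd: "vnorm (Lp p M) (vdiff (Lp p M) (x n) (Lp_class p M h)) = Lp_norm p M (\<lambda>t. f n t - h t)"
      if "h \<in> Lp_fun p M" for n h
      by (simp add: f Lp_diff_class Lp_norm_class Lp_fun_diff p that)
    have nd': "vnorm (Lp p M) (vdiff (Lp p M) (x m) (x n)) = Lp_norm p M (\<lambda>t. f m t - f n t)" for m n
      unfolding f(2)[of n] by (rule nd[OF f(1)])
    have cau': "\<exists>N. \<forall>m\<ge>N. \<forall>n\<ge>N. Lp_norm p M (\<lambda>t. f m t - f n t) < e" if "0 < e" for e
      using cau[OF that] by (simp only: nd')
    show "\<exists>l. vlimit (Lp p M) x l sequentially"
    proof (rule Lp_complete[OF p f(1)])
      fix g assume g: "g \<in> Lp_fun p M" "(\<lambda>n. Lp_norm p M (\<lambda>t. f n t - g t)) \<longlonglongrightarrow> 0"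
      have "vlimit (Lp p M) x (Lp_class p M g) sequentially"
        using g by (simp add: vlimit_def nd Lp_carrierI)
      then show "\<exists>l. vlimit (Lp p M) x l sequentially" ..
    qed (rule cau')
  qed
qed


section \<open>Pullbacks along measure preserving maps\<close>

lemma distr_eq_AE_comp:
  assumes "h \<in> measurable M N" "distr M N h = N" "AE y in N. P y"
  shows "AE x in M. P (h x)"
  using AE_distrD[OF assms(1)] assms(2,3) by metis

lemma Lp_fun_comp_iff:
  assumes [measurable]: "h \<in> measurable M N" "f \<in> borel_measurable N" and N: "distr M N h = N"
  shows "f \<circ> h \<in> Lp_fun p M \<longleftrightarrow> f \<in> Lp_fun p N"
proof -
  have "integrable N (\<lambda>y. \<bar>f y\<bar> powr p) \<longleftrightarrow> integrable M (\<lambda>x. \<bar>f (h x)\<bar> powr p)"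
    using integrable_distr_eq[of h M N "\<lambda>y. \<bar>f y\<bar> powr p"] N by simp
  moreover have "f \<circ> h \<in> borel_measurable M" by measurable
  ultimately show ?thesis by (simp add: Lp_fun_def)
qed

lemma Lp_norm_comp:
  assumes [measurable]: "h \<in> measurable M N" "f \<in> borel_measurable N" and N: "distr M N h = N"
  shows "Lp_norm p M (f \<circ> h) = Lp_norm p N f"
  using integral_distr[of h M N "\<lambda>y. \<bar>f y\<bar> powr p"] N by (simp add: Lp_norm_def)

lemma Lp_pullback_class:
  assumes h: "h \<in> measurable M N" "distr M N h = N" and f: "f \<in> Lp_fun p N"
  shows "Lp_pullback p M h (Lp_class p N f) = Lp_class p M (f \<circ> h)"
proof -
  have eq: "Lp_class p M (f' \<circ> h) = Lp_class p M (f \<circ> h)" if "f' \<in> Lp_class p N f" for f'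
    by (rule Lp_class_eqI) (simp add: distr_eq_AE_comp[OF h Lp_classD(2)[OF that]])
  show ?thesis
    unfolding Lp_pullback_def
    by (rule UN_eq_common_value[OF _ Lp_class_self[OF f]], erule eq)
qed

lemma Lp_fun_comp:
  assumes "h \<in> measurable M N" "distr M N h = N" and "f \<in> Lp_fun p N"
  shows "f \<circ> h \<in> Lp_fun p M"
  using Lp_fun_comp_iff[OF assms(1) Lp_fun_measurable[OF assms(3)] assms(2)] assms(3) by simp

lemma linear_isometry_Lp_pullback:
  assumes p: "1 \<le> p" and h: "h \<in> measurable M N" "distr M N h = N"
  shows "linear_isometry (Lp p N) (Lp p M) (Lp_pullback p M h)"
  unfolding linear_isometry_def
proof (intro conjI ballI allI)
  note pb = Lp_pullback_class[OF h] and comp = Lp_fun_comp[OF h]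
  show "Lp_pullback p M h \<in> vcarrier (Lp p N) \<rightarrow> vcarrier (Lp p M)"
    by (auto elim!: Lp_carrierE simp: pb intro!: Lp_carrierI comp)
  fix A assume "A \<in> vcarrier (Lp p N)"
  then obtain f where f: "f \<in> Lp_fun p N" "A = Lp_class p N f" by (rule Lp_carrierE)
  show "Lp_pullback p M h (vscale (Lp p N) c A) = vscale (Lp p M) c (Lp_pullback p M h A)" for c
    using f comp[OF f(1)] by (simp add: pb Lp_scale_class Lp_fun_cmult comp_def)
  show "vnorm (Lp p M) (Lp_pullback p M h A) = vnorm (Lp p N) A"
    using f comp[OF f(1)] by (simp add: pb Lp_norm_class Lp_norm_comp h Lp_fun_measurable)
  fix B assume "B \<in> vcarrier (Lp p N)"
  then obtain g where g: "g \<in> Lp_fun p N" "B = Lp_class p N g" by (rule Lp_carrierE)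
  show "Lp_pullback p M h (vadd (Lp p N) A B)
      = vadd (Lp p M) (Lp_pullback p M h A) (Lp_pullback p M h B)"
    using f g comp[OF f(1)] comp[OF g(1)] by (simp add: pb Lp_add_class Lp_fun_add p comp_def)
qed


section \<open>Conditional expectations\<close>

text \<open>By Jensen's inequality for the convex function \<open>|x|\<^sup>p\<close>, conditional expectation is a contraction.\<close>

lemma (in finite_measure_subalgebra) Lp_cond_exp_fun:
  assumes p: "1 \<le> p" and f: "f \<in> Lp_fun p M"
  shows "real_cond_exp M F f \<in> Lp_fun p M" "Lp_norm p M (real_cond_exp M F f) \<le> Lp_norm p M f"
proof -
  let ?q = "\<lambda>x::real. \<bar>x\<bar> powr p"
  have int: "integrable M f" by (rule Lp_fun_imp_integrable[OF p f])
  have q: "?q \<in> borel_measurable borel" by measurable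
  note J = Lp_fun_integrable[OF f] convex_abs_powr[OF p] q
  have "integrable M (\<lambda>x. ?q (real_cond_exp M F f x))"
    by (rule integrable_convex_cond_exp[OF int _ _ J]) auto
  then show ce: "real_cond_exp M F f \<in> Lp_fun p M" by (simp add: Lp_fun_def)
  have "(\<integral>x. ?q (real_cond_exp M F f x) \<partial>M) \<le> (\<integral>x. real_cond_exp M F (\<lambda>x. ?q (f x)) x \<partial>M)"
    by (intro integral_mono_AE Lp_fun_integrable ce real_cond_exp_int
        real_cond_exp_jensens_inequality(2)[OF int _ _ J] p f) (auto intro: J)
  also have "\<dots> = (\<integral>x. ?q (f x) \<partial>M)" by (rule real_cond_exp_int(2)[OF J(1)])
  also have "\<dots> = Lp_norm p M f powr p" by (simp add: Lp_norm_powr[OF p])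
  finally show "Lp_norm p M (real_cond_exp M F f) \<le> Lp_norm p M f"
    by (simp add: Lp_norm_le_iff[OF p] Lp_norm_nonneg)
qed

lemma (in finite_measure_subalgebra) Lp_cond_exp_class:
  assumes p: "1 \<le> p" and f: "f \<in> Lp_fun p M"
  shows "Lp_cond_exp p M F (Lp_class p M f) = Lp_class p M (real_cond_exp M F f)"
proof -
  have eq: "Lp_class p M (real_cond_exp M F f') = Lp_class p M (real_cond_exp M F f)"
    if "f' \<in> Lp_class p M f" for f'
    by (intro Lp_class_eqI real_cond_exp_cong Lp_classD(2)[OF that]
        Lp_fun_measurable[OF Lp_classD(1)[OF that]] Lp_fun_measurable[OF f])
  show ?thesis
    unfolding Lp_cond_exp_def
    by (rule UN_eq_common_value[OF _ Lp_class_self[OF f]], erule eq)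
qed

text \<open>
  The functions that are measurable for one of the \<open>\<sigma>\<close>-algebras \<open>F i\<close> of a directed family are dense in
  \<open>L\<^sup>p\<close> of the \<open>\<sigma>\<close>-algebra generated by all of them.  The closure of these functions is a vector
  space, closed under dominated limits.  The \<open>F i\<close> together form an algebra of sets, so Dynkin's
  argument puts all indicator functions into the closure, and monotone approximation all of \<open>L\<^sup>p\<close>.
\<close>

lemma (in finite_measure) Lp_dense_directed_subalgebras:
  fixes F :: "'i \<Rightarrow> 'a measure"
  assumes p: "1 \<le> p" and I: "I \<noteq> {}"
    and dir: "\<And>i j. i \<in> I \<Longrightarrow> j \<in> I \<Longrightarrow> \<exists>k\<in>I. sets (F i) \<subseteq> sets (F k) \<and> sets (F j) \<subseteq> sets (F k)"
    and sub: "\<And>i. i \<in> I \<Longrightarrow> subalgebra M (F i)"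
    and gen: "sets M = sigma_sets (space M) (\<Union>i\<in>I. sets (F i))"
    and f: "f \<in> Lp_fun p M" and e: "0 < e"
  shows "\<exists>i\<in>I. \<exists>g\<in>Lp_fun p M. g \<in> borel_measurable (F i) \<and> Lp_norm p M (\<lambda>x. f x - g x) < e"
proof -
  define D where "D = {f \<in> Lp_fun p M. \<forall>e>0. \<exists>i\<in>I. \<exists>g\<in>Lp_fun p M.
      g \<in> borel_measurable (F i) \<and> Lp_norm p M (\<lambda>x. f x - g x) < e}"
  have D_fun: "f \<in> Lp_fun p M" if "f \<in> D" for f using that by (simp add: D_def)
  have spF: "space (F i) = space M" if "i \<in> I" for i
    using sub[OF that] by (simp add: subalgebra_def)
  have up: "g \<in> borel_measurable (F k)"
    if "g \<in> borel_measurable (F i)" "i \<in> I" "k \<in> I" "sets (F i) \<subseteq> sets (F k)" for g :: "'a \<Rightarrow> real" and i k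
    using that spF by (auto simp: measurable_def)
  have D_simple: "f \<in> D" if "f \<in> Lp_fun p M" "i \<in> I" "f \<in> borel_measurable (F i)" for f i
    using that unfolding D_def
    by (auto intro!: bexI[of _ i] bexI[of _ f] simp: Lp_norm_def)
  have D_add: "(\<lambda>x. f x + g x) \<in> D" if f: "f \<in> D" and g: "g \<in> D" for f g
  proof -
    have "\<exists>k\<in>I. \<exists>h\<in>Lp_fun p M. h \<in> borel_measurable (F k) \<and> Lp_norm p M (\<lambda>x. f x + g x - h x) < e"
      if e: "0 < e" for e
    proof -
      obtain i f' where i: "i \<in> I" "f' \<in> Lp_fun p M" "f' \<in> borel_measurable (F i)"
        "Lp_norm p M (\<lambda>x. f x - f' x) < e / 2"
        using f e unfolding D_def by (auto dest!: spec[of _ "e / 2"])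
      obtain j g' where j: "j \<in> I" "g' \<in> Lp_fun p M" "g' \<in> borel_measurable (F j)"
        "Lp_norm p M (\<lambda>x. g x - g' x) < e / 2"
        using g e unfolding D_def by (auto dest!: spec[of _ "e / 2"])
      obtain k where k: "k \<in> I" "sets (F i) \<subseteq> sets (F k)" "sets (F j) \<subseteq> sets (F k)"
        using dir i(1) j(1) by blast
      have "Lp_norm p M (\<lambda>x. f x + g x - (f' x + g' x))
          = Lp_norm p M (\<lambda>x. (f x - f' x) + (g x - g' x))"
        by (simp add: algebra_simps)
      also have "\<dots> \<le> Lp_norm p M (\<lambda>x. f x - f' x) + Lp_norm p M (\<lambda>x. g x - g' x)"
        by (intro Lp_norm_add Lp_fun_diff D_fun f g i j p)
      also have "\<dots> < e" using i j by simp
      finally have "Lp_norm p M (\<lambda>x. f x + g x - (f' x + g' x)) < e" .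
      moreover have "(\<lambda>x. f' x + g' x) \<in> borel_measurable (F k)"
        using up[OF i(3,1) k(1,2)] up[OF j(3,1) k(1,3)] by measurable
      ultimately show ?thesis
        using k(1) Lp_fun_add[OF p i(2) j(2)] by blast
    qed
    then show ?thesis using Lp_fun_add[OF p D_fun[OF f] D_fun[OF g]] by (simp add: D_def)
  qed
  have D_cmult: "(\<lambda>x. c * f x) \<in> D" if f: "f \<in> D" for c f
  proof -
    have "\<exists>k\<in>I. \<exists>h\<in>Lp_fun p M. h \<in> borel_measurable (F k) \<and> Lp_norm p M (\<lambda>x. c * f x - h x) < e"
      if e: "0 < e" for e
    proof -
      have "0 < e / (\<bar>c\<bar> + 1)" using e by simp
      then obtain i f' where i: "i \<in> I" "f' \<in> Lp_fun p M" "f' \<in> borel_measurable (F i)"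
        "Lp_norm p M (\<lambda>x. f x - f' x) < e / (\<bar>c\<bar> + 1)"
        using f unfolding D_def by blast
      have "Lp_norm p M (\<lambda>x. c * f x - c * f' x) = \<bar>c\<bar> * Lp_norm p M (\<lambda>x. f x - f' x)"
        by (simp add: Lp_norm_cmult[OF p] flip: right_diff_distrib)
      also have "\<dots> \<le> (\<bar>c\<bar> + 1) * Lp_norm p M (\<lambda>x. f x - f' x)"
        by (intro mult_right_mono Lp_norm_nonneg) simp
      also have "\<dots> < e" using i(4) by (simp add: field_simps)
      finally show ?thesis
        using i by (intro bexI[of _ i] bexI[of _ "\<lambda>x. c * f' x"] conjI Lp_fun_cmult) auto
    qed
    then show ?thesis using Lp_fun_cmult[OF D_fun[OF f]] by (simp add: D_def)
  qed
  have D_lim: "u \<in> D" if U: "\<And>n::nat. U n \<in> D" and w: "w \<in> Lp_fun p M"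
    and um: "u \<in> borel_measurable M"
    and bound: "\<And>n x. x \<in> space M \<Longrightarrow> \<bar>U n x\<bar> \<le> \<bar>w x\<bar>" "\<And>x. x \<in> space M \<Longrightarrow> \<bar>u x\<bar> \<le> \<bar>w x\<bar>"
    and lim: "\<And>x. x \<in> space M \<Longrightarrow> (\<lambda>n. U n x) \<longlonglongrightarrow> u x" for U u w
  proof -
    have u: "u \<in> Lp_fun p M" using bound by (intro Lp_fun_bounded[OF p w um]) auto
    have conv: "(\<lambda>n. Lp_norm p M (\<lambda>x. U n x - u x)) \<longlonglongrightarrow> 0"
      using bound lim Lp_fun_measurable[OF D_fun[OF U]]
      by (intro Lp_norm_dominated_convergence[OF p w _ um]) auto
    have "\<exists>k\<in>I. \<exists>h\<in>Lp_fun p M. h \<in> borel_measurable (F k) \<and> Lp_norm p M (\<lambda>x. u x - h x) < e"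
      if e: "0 < e" for e
    proof -
      have "\<forall>\<^sub>F n in sequentially. Lp_norm p M (\<lambda>x. U n x - u x) < e / 2"
        using conv e by (intro order_tendstoD(2)[OF conv]) auto
      then obtain n where n: "Lp_norm p M (\<lambda>x. U n x - u x) < e / 2"
        using eventually_happens'[OF sequentially_bot] by blast
      obtain i f' where i: "i \<in> I" "f' \<in> Lp_fun p M" "f' \<in> borel_measurable (F i)"
        "Lp_norm p M (\<lambda>x. U n x - f' x) < e / 2"
        using U[of n] e unfolding D_def by (auto dest!: spec[of _ "e / 2"])
      have "Lp_norm p M (\<lambda>x. u x - f' x)
          \<le> Lp_norm p M (\<lambda>x. u x - U n x) + Lp_norm p M (\<lambda>x. U n x - f' x)"
        by (rule Lp_norm_triangle[OF p u D_fun[OF U] i(2)])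
      also have "\<dots> < e" using n i(4) by (simp add: Lp_norm_minus[of p M u])
      finally show ?thesis using i by blast
    qed
    then show ?thesis using u by (simp add: D_def)
  qed
  obtain i0 where i0: "i0 \<in> I" using I by blast
  have ind_fun: "indicator A \<in> Lp_fun p M" if "A \<in> sets M" for A
    by (rule Lp_fun_bounded[OF p Lp_fun_const[of 1]]) (use that in \<open>auto simp: indicator_def\<close>)
  have gen_sub: "(\<Union>i\<in>I. sets (F i)) \<subseteq> Pow (space M)"
    using sub sets.sets_into_space unfolding subalgebra_def by fastforce
  have Int: "Int_stable (\<Union>i\<in>I. sets (F i))"
  proof (rule Int_stableI)
    fix A B assume "A \<in> (\<Union>i\<in>I. sets (F i))" "B \<in> (\<Union>i\<in>I. sets (F i))"
    then obtain i j where ij: "i \<in> I" "A \<in> sets (F i)" "j \<in> I" "B \<in> sets (F j)" by blast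
    then obtain k where "k \<in> I" "sets (F i) \<subseteq> sets (F k)" "sets (F j) \<subseteq> sets (F k)"
      using dir by blast
    then show "A \<inter> B \<in> (\<Union>i\<in>I. sets (F i))" using ij by blast
  qed
  have D_ind: "indicator A \<in> D" if "A \<in> sets M" for A
  proof -
    have A: "A \<in> sigma_sets (space M) (\<Union>i\<in>I. sets (F i))" using that gen by simp
    show ?thesis
      using Int gen_sub A
    proof (induction rule: sigma_sets_induct_disjoint)
      case (basic A)
      then obtain i where i: "i \<in> I" "A \<in> sets (F i)" by blast
      then have "A \<in> sets M" using gen by auto
      then show ?case using i by (intro D_simple[OF ind_fun i(1)]) auto
    next
      case empty
      show ?case using i0 by (intro D_simple[OF ind_fun i0]) auto
    next
      case (compl A)
      have "(\<lambda>x. 1 + (-1) * indicator A x) \<in> D"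
        using i0 by (intro D_add D_cmult compl.IH D_simple[OF Lp_fun_const i0]) auto
      moreover have "A \<in> sets M" using compl.hyps gen by simp
      then have "indicator (space M - A) \<in> borel_measurable M" by measurable
      \<comment> \<open>The two functions agree on the space of \<open>M\<close> only; a constant sequence bridges the gap.\<close>
      ultimately show ?case
        by (rule D_lim[of "\<lambda>_ x. 1 + (-1) * indicator A x" "\<lambda>_. 1", OF _ Lp_fun_const])
          (auto simp: indicator_def)
    next
      case (union A)
      have ms: "A n \<in> sets M" for n using union.hyps(2) gen by auto
      have fin: "indicator (\<Union>i<n. A i) \<in> D" for n
      proof (induction n)
        case 0
        show ?case using i0 by (intro D_simple[OF ind_fun i0]) auto
      next
        case (Suc n)
        have "(\<Union>i<n. A i) \<inter> A n = {}"
          using union.hyps(1) by (auto simp: disjoint_family_on_def dest: less_imp_neq)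
        then have "indicator (\<Union>i<Suc n. A i) = (\<lambda>x. indicator (\<Union>i<n. A i) x + indicator (A n) x :: real)"
          by (auto simp: fun_eq_iff indicator_def lessThan_Suc)
        then show ?case using D_add[OF Suc.IH union.IH[of n]] by simp
      qed
      have m: "indicator (\<Union>i. A i) \<in> borel_measurable M" using ms by measurable
      have "\<bar>indicator B x :: real\<bar> \<le> \<bar>1\<bar>" for B and x :: 'a
        by (simp add: indicator_def)
      then show ?case
        by (intro D_lim[of "\<lambda>n. indicator (\<Union>i<n. A i)", OF fin Lp_fun_const[of 1] m]
            LIMSEQ_indicator_UN)
    qed
  qed
  have D_pos: "u \<in> Lp_fun p M \<longrightarrow> u \<in> D" if "u \<in> borel_measurable M" "\<And>x. 0 \<le> u x" for u
    using that
  proof (induction rule: borel_measurable_induct_real)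
    case (set A)
    then show ?case using D_ind by blast
  next
    case (mult u c)
    show ?case
    proof
      assume cu: "(\<lambda>x. c * u x) \<in> Lp_fun p M"
      show "(\<lambda>x. c * u x) \<in> D"
      proof (cases "c = 0")
        case True
        then show ?thesis using i0 by (intro D_simple[OF cu i0]) simp
      next
        case False
        then have "u \<in> Lp_fun p M" using Lp_fun_cmult[OF cu, of "1 / c"] by simp
        then show ?thesis using mult D_cmult by blast
      qed
    qed
  next
    case (add u v)
    show ?case
    proof
      assume uv: "(\<lambda>x. v x + u x) \<in> Lp_fun p M"
      have "u \<in> Lp_fun p M" "v \<in> Lp_fun p M"
        using add.hyps by (auto intro!: Lp_fun_bounded[OF p uv])
      then show "(\<lambda>x. v x + u x) \<in> D" using add.IH D_add by blast
    qed
  next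
    case (seq U)
    show ?case
    proof
      assume u: "u \<in> Lp_fun p M"
      have le: "\<bar>U n x\<bar> \<le> \<bar>u x\<bar>" if "x \<in> space M" for n x
        using incseq_le[OF _ seq.hyps(4)[OF that], of n] seq.hyps(2)[of n x] \<open>incseq U\<close>
        by (auto simp: incseq_def le_fun_def)
      have "U n \<in> Lp_fun p M" for n
        using le by (intro Lp_fun_bounded[OF p u seq.hyps(1)]) auto
      then show "u \<in> D"
        using seq.IH le seq.hyps(4) by (intro D_lim[of U u u, OF _ u Lp_fun_measurable[OF u]]) auto
    qed
  qed
  have [measurable]: "f \<in> borel_measurable M" using f by (rule Lp_fun_measurable)
  have "(\<lambda>x. max 0 (f x)) \<in> D" "(\<lambda>x. max 0 (- f x)) \<in> D"
    by (intro D_pos[rule_format] Lp_fun_bounded[OF p f]; force)+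
  then have "(\<lambda>x. max 0 (f x) + (-1) * max 0 (- f x)) \<in> D"
    by (intro D_add D_cmult)
  moreover have "(\<lambda>x. max 0 (f x) + (-1) * max 0 (- f x)) = f"
    by (auto simp: fun_eq_iff max_def)
  ultimately have "f \<in> D" by simp
  then show ?thesis using e by (simp add: D_def)
qed

text \<open>
  Martingale convergence in \<open>L\<^sup>p\<close> along a directed family: conditional expectations fix the functions
  that are dense by the preceding lemma, and they are contractions.
\<close>

theorem (in finite_measure) Lp_cond_exp_convergence:
  fixes F :: "'i \<Rightarrow> 'a measure"
  assumes p: "1 \<le> p" and I: "I \<noteq> {}"
    and dir: "\<And>i j. i \<in> I \<Longrightarrow> j \<in> I \<Longrightarrow> \<exists>k\<in>I. sets (F i) \<subseteq> sets (F k) \<and> sets (F j) \<subseteq> sets (F k)"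
    and sub: "\<And>i. i \<in> I \<Longrightarrow> subalgebra M (F i)"
    and gen: "sets M = sigma_sets (space M) (\<Union>i\<in>I. sets (F i))"
    and f: "f \<in> Lp_fun p M" and e: "0 < e"
  shows "\<exists>i\<in>I. \<forall>j\<in>I. sets (F i) \<subseteq> sets (F j) \<longrightarrow>
    Lp_norm p M (\<lambda>x. real_cond_exp M (F j) f x - f x) < e"
proof -
  obtain i g where i: "i \<in> I" and g: "g \<in> Lp_fun p M" "g \<in> borel_measurable (F i)"
    and small: "Lp_norm p M (\<lambda>x. f x - g x) < e / 2"
    using Lp_dense_directed_subalgebras[OF p I dir sub gen f, of "e / 2"] e by auto
  have "Lp_norm p M (\<lambda>x. real_cond_exp M (F j) f x - f x) < e"
    if j: "j \<in> I" and ij: "sets (F i) \<subseteq> sets (F j)" for j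
  proof -
    interpret E: finite_measure_subalgebra M "F j"
      by unfold_locales (rule sub[OF j])
    have gj: "g \<in> borel_measurable (F j)"
      using g(2) ij sub[OF i] sub[OF j] by (auto simp: measurable_def subalgebra_def)
    note int = Lp_fun_imp_integrable[OF p f] Lp_fun_imp_integrable[OF p g(1)]
    note Ef = E.Lp_cond_exp_fun(1)[OF p f]
    have "AE x in M. real_cond_exp M (F j) (\<lambda>x. f x - g x) x
        = real_cond_exp M (F j) f x - real_cond_exp M (F j) g x"
      by (rule E.real_cond_exp_diff[OF int])
    moreover have "AE x in M. real_cond_exp M (F j) g x = g x"
      by (rule E.real_cond_exp_F_meas[OF int(2) gj])
    ultimately have "AE x in M. real_cond_exp M (F j) f x - g x = real_cond_exp M (F j) (\<lambda>x. f x - g x) x"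
      by eventually_elim simp
    then have "Lp_norm p M (\<lambda>x. real_cond_exp M (F j) f x - g x)
        = Lp_norm p M (real_cond_exp M (F j) (\<lambda>x. f x - g x))"
      using Lp_fun_measurable[OF g(1)] by (intro Lp_norm_cong_AE) auto
    also have "\<dots> \<le> Lp_norm p M (\<lambda>x. f x - g x)"
      by (intro E.Lp_cond_exp_fun(2)[OF p] Lp_fun_diff p f g)
    finally have "Lp_norm p M (\<lambda>x. real_cond_exp M (F j) f x - g x) < e / 2"
      using small by simp
    then show ?thesis
      using Lp_norm_triangle[OF p Ef g(1) f] small by (simp add: Lp_norm_minus[of p M g f])
  qed
  then show ?thesis using i by blast
qed


section \<open>Finite measures are determined by their Fourier transforms\<close>

text \<open>
  Levy's uniqueness theorem is about probability measures; the total mass is the transform at 0, so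
  both measures can be normalized by the same factor.
\<close>

lemma finite_borel_measure_eqI_char:
  fixes M N :: "real measure"
  assumes M: "finite_measure M" "sets M = sets borel" and N: "finite_measure N" "sets N = sets borel"
    and eq: "\<And>t. (\<integral>x. iexp (t * x) \<partial>M) = (\<integral>x. iexp (t * x) \<partial>N)"
  shows "M = N"
proof -
  interpret M: finite_measure M by fact
  interpret N: finite_measure N by fact
  define m where "m = measure M (space M)"
  have "complex_of_real (measure M (space M)) = complex_of_real (measure N (space N))"
    using eq[of 0] by (simp add: scaleR_conv_of_real)
  then have mass: "measure N (space N) = m" by (simp add: m_def)
  show ?thesis
  proof (cases "m = 0")
    case True
    have "emeasure M A = 0" "emeasure N A = 0" for A
      using True mass emeasure_mono[of A "space M" M] emeasure_mono[of A "space N" N]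
        emeasure_notin_sets[of A M] emeasure_notin_sets[of A N] sets.sets_into_space[of A M]
        sets.sets_into_space[of A N]
      by (metis M.emeasure_eq_measure N.emeasure_eq_measure ennreal_0 le_zero_eq m_def sets.top)+
    then show ?thesis using M N by (intro measure_eqI) auto
  next
    case False
    then have m: "0 < m" using measure_nonneg[of M] by (simp add: m_def less_le)
    let ?n = "\<lambda>M. density M (\<lambda>_. ennreal (1 / m))"
    have dist: "real_distribution (?n L)"
      if L: "finite_measure L" "sets L = sets borel" "measure L (space L) = m" for L :: "real measure"
    proof -
      have "emeasure (?n L) (space (?n L)) = ennreal (1 / m) * emeasure L (space L)"
        by (simp add: emeasure_density_const)
      also have "\<dots> = 1"
        using m L(3) by (simp add: finite_measure.emeasure_eq_measure[OF L(1)] flip: ennreal_mult)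
      finally have "prob_space (?n L)" by (rule prob_spaceI)
      then show ?thesis using L(2) by (simp add: real_distribution_def real_distribution_axioms_def)
    qed
    have ch: "char (?n L) t = (1 / m) *\<^sub>R (\<integral>x. iexp (t * x) \<partial>L)"
      if "sets L = sets borel" for L :: "real measure" and t
    proof -
      have [measurable_cong]: "sets L = sets borel" by fact
      show ?thesis using m by (simp add: char_def integral_density)
    qed
    have "?n M = ?n N"
    proof (rule Levy_uniqueness)
      show "real_distribution (?n M)" "real_distribution (?n N)"
        using dist[OF M] dist[OF N] mass by (simp_all add: m_def)
      show "char (?n M) = char (?n N)" by (intro ext) (simp only: ch[OF M(2)] ch[OF N(2)] eq)
    qed
    then have dens: "emeasure (?n M) A = emeasure (?n N) A" for A by simp
    have "emeasure M A = emeasure N A" if A: "A \<in> sets M" for A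
    proof -
      have "A \<in> sets N" using A M N by simp
      then have "ennreal (1 / m) * emeasure M A = ennreal (1 / m) * emeasure N A"
        using dens[of A] A by (simp add: emeasure_density_const)
      moreover have "ennreal (1 / m) * ennreal (measure L A) = ennreal (1 / m * measure L A)" for L
        using m by (intro ennreal_mult[symmetric]) auto
      ultimately have "ennreal (1 / m * measure M A) = ennreal (1 / m * measure N A)"
        by (simp only: M.emeasure_eq_measure N.emeasure_eq_measure)
      then have "1 / m * measure M A = 1 / m * measure N A"
        using m by (subst (asm) ennreal_inj) auto
      then show ?thesis
        using m by (simp add: M.emeasure_eq_measure N.emeasure_eq_measure)
    qed
    then show ?thesis using M N by (intro measure_eqI) auto
  qed
qed

text \<open>The uniqueness theorem on the line, applied to the images under \<open>X\<close> of the measures with density \<open>w\<close>.\<close>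

lemma weighted_event_eqI_char:
  fixes X w :: "'a \<Rightarrow> real"
  assumes M: "finite_measure M" and N: "finite_measure N" and sets_eq: "sets M = sets N"
    and X: "X \<in> borel_measurable M" and w: "w \<in> borel_measurable M" "\<And>x. 0 \<le> w x" "\<And>x. w x \<le> c"
    and eq: "\<And>s. (\<integral>x. iexp (s * X x) * w x \<partial>M) = (\<integral>x. iexp (s * X x) * w x \<partial>N)"
    and A: "A \<in> sets borel"
  shows "(\<integral>x. indicator A (X x) * w x \<partial>M) = (\<integral>x. indicator A (X x) * w x \<partial>N)"
proof -
  let ?D = "\<lambda>L. distr (density L (\<lambda>x. ennreal (w x))) borel X"
  have fin: "finite_measure (?D L)"
    if L: "finite_measure L" and [measurable_cong]: "sets L = sets M" for L
  proof -
    interpret L: finite_measure L by fact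
    have [measurable]: "X \<in> borel_measurable L" "w \<in> borel_measurable L"
      using X w(1) by measurable
    have "(\<integral>\<^sup>+x. ennreal (w x) \<partial>L) \<le> (\<integral>\<^sup>+x. ennreal c \<partial>L)"
      by (intro nn_integral_mono ennreal_leI w)
    also have "\<dots> < \<infinity>" by (simp add: L.emeasure_eq_measure flip: ennreal_mult'')
    finally have "finite_measure (density L (\<lambda>x. ennreal (w x)))"
      by (intro finite_measureI) (simp add: emeasure_density cong: nn_integral_cong)
    then show ?thesis by (rule finite_measure.finite_measure_distr) simp
  qed
  have int: "(\<integral>x. f x \<partial>(?D L)) = (\<integral>x. w x *\<^sub>R f (X x) \<partial>L)"
    if [measurable_cong]: "sets L = sets M" and [measurable]: "f \<in> borel_measurable borel"
    for L and f :: "real \<Rightarrow> 'b :: {banach, second_countable_topology}"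
  proof -
    have [measurable]: "X \<in> borel_measurable L" "w \<in> borel_measurable L"
      using X w(1) by measurable
    show ?thesis using w(2) by (simp add: integral_distr integral_density)
  qed
  have "?D M = ?D N"
  proof (rule finite_borel_measure_eqI_char)
    show "(\<integral>x. iexp (t * x) \<partial>(?D M)) = (\<integral>x. iexp (t * x) \<partial>(?D N))" for t
      using eq[of t] sets_eq by (simp add: int scaleR_conv_of_real mult.commute)
  qed (use fin M N sets_eq in auto)
  then have "(\<integral>x. indicat_real A x \<partial>(?D M)) = (\<integral>x. indicat_real A x \<partial>(?D N))" by simp
  moreover have ind: "indicat_real A \<in> borel_measurable borel" using A by simp
  ultimately show ?thesis
    unfolding int[OF refl ind] int[OF sets_eq[symmetric] ind] by (simp only: real_scaleR_def mult.commute)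
qed

lemma sets_Collect_finite_all_mem:
  assumes "finite B" "\<And>b. b \<in> B \<Longrightarrow> X b \<in> borel_measurable M" "\<And>b. A b \<in> sets borel"
  shows "{x \<in> space M. \<forall>b\<in>B. X b x \<in> A b} \<in> sets M"
proof (rule sets.sets_Collect_finite_All[OF _ assms(1)])
  fix b assume "b \<in> B"
  from measurable_sets[OF assms(2)[OF this] assms(3)[of b]]
  show "{x \<in> space M. X b x \<in> A b} \<in> sets M" by (simp add: vimage_def Int_def conj_commute)
qed

text \<open>
  The Fourier transform of finitely many random variables determines their joint law, by induction on
  their number.  With \<open>S\<close> a linear combination of the other variables, the positive weights \<open>1\<close>,
  \<open>1 + cos S\<close> and \<open>1 + sin S\<close> reduce the removal of one variable \<open>X\<close> to the uniqueness theorem on the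
  line: they give \<open>\<integral> 1\<^sub>A(X) exp(\<i> S)\<close>, the Fourier transform of the other variables under the measure
  restricted to the event \<open>X \<in> A\<close>.
\<close>

lemma joint_events_eqI_char:
  fixes X :: "'b \<Rightarrow> 'a \<Rightarrow> real"
  assumes "finite B" and "finite_measure M" "finite_measure N" "sets M = sets N"
    and "\<And>b. b \<in> B \<Longrightarrow> X b \<in> borel_measurable M"
    and "\<And>t. (\<integral>x. iexp (\<Sum>b\<in>B. t b * X b x) \<partial>M) = (\<integral>x. iexp (\<Sum>b\<in>B. t b * X b x) \<partial>N)"
    and "\<And>b. A b \<in> sets borel"
  shows "measure M {x \<in> space M. \<forall>b\<in>B. X b x \<in> A b} = measure N {x \<in> space N. \<forall>b\<in>B. X b x \<in> A b}"
  using assms(1-6)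
proof (induction B arbitrary: M N rule: finite_induct)
  case empty
  then have "complex_of_real (measure M (space M)) = complex_of_real (measure N (space N))"
    by (simp add: scaleR_conv_of_real)
  then show ?case by simp
next
  case (insert a B)
  interpret M: finite_measure M by fact
  interpret N: finite_measure N by fact
  have [measurable_cong]: "sets N = sets M" using insert.prems(3) by simp
  note [measurable] = insert.prems(4) assms(7)
  define E where "E = {x \<in> space M. X a x \<in> A a}"
  have E [measurable]: "E \<in> sets M" unfolding E_def by measurable
  have key: "(\<integral>x. indicator E x *\<^sub>R iexp (\<Sum>b\<in>B. t b * X b x) \<partial>M)
      = (\<integral>x. indicator E x *\<^sub>R iexp (\<Sum>b\<in>B. t b * X b x) \<partial>N)" for t
  proof -
    define S where "S x = (\<Sum>b\<in>B. t b * X b x)" for x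
    have S [measurable]: "S \<in> borel_measurable M" unfolding S_def by measurable
    have char: "(\<integral>x. iexp (s * X a x + u * S x) \<partial>M) = (\<integral>x. iexp (s * X a x + u * S x) \<partial>N)" for s u
    proof -
      have "s * X a x + u * S x = (\<Sum>b\<in>insert a B. (if b = a then s else u * t b) * X b x)" for x
        using insert.hyps by (auto simp: S_def sum_distrib_left mult.assoc intro!: sum.cong)
      then show ?thesis using insert.prems(5)[of "\<lambda>b. if b = a then s else u * t b"] by simp
    qed
    have intM: "integrable M (\<lambda>x. iexp (s * X a x + u * S x))" for s u
      by (rule M.integrable_const_bound[of _ 1]) auto
    have intN: "integrable N (\<lambda>x. iexp (s * X a x + u * S x))" for s u
      by (rule N.integrable_const_bound[of _ 1]) auto
    \<comment> \<open>Euler's formula writes the weighted transforms of \<open>X a\<close> through the transforms of \<open>s X a \<plusminus> S\<close>.\<close>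
    have one: "(\<integral>x. indicat_real (A a) (X a x) * 1 \<partial>M) = (\<integral>x. indicat_real (A a) (X a x) * 1 \<partial>N)"
      using char[of _ 0] insert.prems assms(7)
      by (intro weighted_event_eqI_char[where X = "X a" and w = "\<lambda>_. 1" and c = 1]) auto
    have cos: "(\<integral>x. indicat_real (A a) (X a x) * (1 + cos (S x)) \<partial>M)
        = (\<integral>x. indicat_real (A a) (X a x) * (1 + cos (S x)) \<partial>N)"
    proof (rule weighted_event_eqI_char[where X = "X a" and w = "\<lambda>x. 1 + cos (S x)" and c = 2])
      fix s
      have e: "iexp (s * X a x) * complex_of_real (1 + cos (S x))
          = iexp (s * X a x + 0 * S x)
            + (iexp (s * X a x + 1 * S x) + iexp (s * X a x + (-1) * S x)) / 2" for x
        by (simp add: complex_eq_iff Re_exp Im_exp cos_add sin_add cos_diff sin_diff algebra_simps)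
      show "(\<integral>x. iexp (s * X a x) * complex_of_real (1 + cos (S x)) \<partial>M)
          = (\<integral>x. iexp (s * X a x) * complex_of_real (1 + cos (S x)) \<partial>N)"
        unfolding e
        using intM[of s 0] intM[of s 1] intM[of s "-1"] intN[of s 0] intN[of s 1] intN[of s "-1"]
          char[of s 0] char[of s 1] char[of s "-1"] by simp
    next
      show "0 \<le> 1 + cos (S x)" for x using cos_ge_minus_one[of "S x"] by linarith
    qed (use insert.prems assms(7) in auto)
    have sin: "(\<integral>x. indicat_real (A a) (X a x) * (1 + sin (S x)) \<partial>M)
        = (\<integral>x. indicat_real (A a) (X a x) * (1 + sin (S x)) \<partial>N)"
    proof (rule weighted_event_eqI_char[where X = "X a" and w = "\<lambda>x. 1 + sin (S x)" and c = 2])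
      fix s
      have e: "iexp (s * X a x) * complex_of_real (1 + sin (S x))
          = iexp (s * X a x + 0 * S x)
            + (iexp (s * X a x + 1 * S x) - iexp (s * X a x + (-1) * S x)) / (2 * \<i>)" for x
        by (simp add: complex_eq_iff Re_exp Im_exp Re_divide Im_divide cos_add sin_add cos_diff sin_diff
            power2_eq_square algebra_simps)
      show "(\<integral>x. iexp (s * X a x) * complex_of_real (1 + sin (S x)) \<partial>M)
          = (\<integral>x. iexp (s * X a x) * complex_of_real (1 + sin (S x)) \<partial>N)"
        unfolding e
        using intM[of s 0] intM[of s 1] intM[of s "-1"] intN[of s 0] intN[of s 1] intN[of s "-1"]
          char[of s 0] char[of s 1] char[of s "-1"] by simp
    next
      show "0 \<le> 1 + sin (S x)" for x using sin_ge_minus_one[of "S x"] by linarith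
    qed (use insert.prems assms(7) in auto)
    have split: "(\<integral>x. indicator E x *\<^sub>R iexp (S x) \<partial>L) =
        complex_of_real ((\<integral>x. indicat_real (A a) (X a x) * (1 + cos (S x)) \<partial>L)
          - (\<integral>x. indicat_real (A a) (X a x) * 1 \<partial>L))
        + \<i> * complex_of_real ((\<integral>x. indicat_real (A a) (X a x) * (1 + sin (S x)) \<partial>L)
          - (\<integral>x. indicat_real (A a) (X a x) * 1 \<partial>L))"
      if L: "finite_measure L" and [measurable_cong]: "sets L = sets M" for L
    proof -
      interpret L: finite_measure L by fact
      have spL: "space L = space M" using that(2) by (rule sets_eq_imp_space_eq)
      have [measurable]: "S \<in> borel_measurable L" "X a \<in> borel_measurable L"
        using S insert.prems(4) by measurable
      have i: "integrable L (\<lambda>x. indicat_real (A a) (X a x) * cos (S x))"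
        "integrable L (\<lambda>x. indicat_real (A a) (X a x) * sin (S x))"
        "integrable L (\<lambda>x. indicat_real (A a) (X a x))"
        by (rule L.integrable_const_bound[of _ 1]; auto simp: indicator_def)+
      have "(\<integral>x. indicator E x *\<^sub>R iexp (S x) \<partial>L)
          = (\<integral>x. complex_of_real (indicat_real (A a) (X a x) * cos (S x))
            + \<i> * complex_of_real (indicat_real (A a) (X a x) * sin (S x)) \<partial>L)"
        by (intro Bochner_Integration.integral_cong)
          (auto simp: indicator_def E_def spL complex_eq_iff Re_exp Im_exp)
      also have "\<dots> = complex_of_real (\<integral>x. indicat_real (A a) (X a x) * cos (S x) \<partial>L)
            + \<i> * complex_of_real (\<integral>x. indicat_real (A a) (X a x) * sin (S x) \<partial>L)"
      proof -
        have "(\<integral>x. complex_of_real (u x) + \<i> * complex_of_real (v x) \<partial>L)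
            = complex_of_real (\<integral>x. u x \<partial>L) + \<i> * complex_of_real (\<integral>x. v x \<partial>L)"
          if "integrable L u" "integrable L v" for u v
          using that by simp
        from this[OF i(1,2)] show ?thesis .
      qed
      finally show ?thesis using i by (simp add: distrib_left)
    qed
    show ?thesis
      using split[OF insert.prems(1) refl] split[OF insert.prems(2)] one cos sin insert.prems(3)
      unfolding S_def by simp
  qed
  let ?R = "\<lambda>L. density L (\<lambda>x. ennreal (indicator E x))"
  have fin: "finite_measure (?R L)"
    if L: "finite_measure L" and [measurable_cong]: "sets L = sets M" for L
  proof -
    interpret L: finite_measure L by fact
    have "emeasure (?R L) (space L) = (\<integral>\<^sup>+x. ennreal (indicator E x) * indicator (space L) x \<partial>L)"
      by (intro emeasure_density) auto
    also have "\<dots> \<le> (\<integral>\<^sup>+x. 1 \<partial>L)"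
      by (intro nn_integral_mono) (simp add: indicator_def)
    also have "\<dots> < \<infinity>" by (simp add: L.emeasure_eq_measure)
    finally show ?thesis by (intro finite_measureI) simp
  qed
  have meas: "measure (?R L) {x \<in> space L. \<forall>b\<in>B. X b x \<in> A b}
      = measure L {x \<in> space L. \<forall>b\<in>insert a B. X b x \<in> A b}"
    if L: "sets L = sets M" for L
  proof -
    have [measurable_cong]: "sets L = sets M" by fact
    have spL: "space L = space M" using L by (rule sets_eq_imp_space_eq)
    have B: "{x \<in> space L. \<forall>b\<in>B. X b x \<in> A b} \<in> sets L"
      using insert.hyps insert.prems(4) by measurable
    have "emeasure (?R L) {x \<in> space L. \<forall>b\<in>B. X b x \<in> A b}
        = (\<integral>\<^sup>+x. indicator {x \<in> space L. \<forall>b\<in>insert a B. X b x \<in> A b} x \<partial>L)"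
      using B by (subst emeasure_density) (auto simp: E_def spL indicator_def intro!: nn_integral_cong)
    also have "\<dots> = emeasure L {x \<in> space L. \<forall>b\<in>insert a B. X b x \<in> A b}"
      using insert.hyps insert.prems(4) by (intro nn_integral_indicator) measurable
    finally show ?thesis by (simp add: measure_def)
  qed
  have dens: "(\<integral>x. iexp (\<Sum>b\<in>B. t b * X b x) \<partial>(?R L))
      = (\<integral>x. indicator E x *\<^sub>R iexp (\<Sum>b\<in>B. t b * X b x) \<partial>L)"
    if L [measurable_cong]: "sets L = sets M" for L t
  proof -
    have [measurable]: "X b \<in> borel_measurable L" if "b \<in> B" for b
      using insert.prems(4)[of b] that by (simp add: measurable_cong_sets[OF L refl])
    show ?thesis by (intro integral_density) auto
  qed
  have "measure (?R M) {x \<in> space (?R M). \<forall>b\<in>B. X b x \<in> A b}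
      = measure (?R N) {x \<in> space (?R N). \<forall>b\<in>B. X b x \<in> A b}"
  proof (rule insert.IH)
    show "(\<integral>x. iexp (\<Sum>b\<in>B. t b * X b x) \<partial>(?R M)) = (\<integral>x. iexp (\<Sum>b\<in>B. t b * X b x) \<partial>(?R N))" for t
      by (simp only: dens[OF refl] dens[OF insert.prems(3)[symmetric]] key)
    show "finite_measure (?R M)" "finite_measure (?R N)"
      using fin insert.prems by simp_all
  qed (use insert.prems in auto)
  then show ?case using meas[of M] meas[of N] insert.prems(3) by simp
qed


section \<open>Functions measurable for an inverse image \<open>\<sigma>\<close>-algebra\<close>

text \<open>
  The Doob--Dynkin factorization.  With \<open>{g \<le> q} = h\<^sup>-\<^sup>1(B q)\<close> for rational \<open>q\<close>, the value \<open>g x\<close> is the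
  infimum of the \<open>q\<close> with \<open>h x \<in> B q\<close>, which makes sense at every point of the target.
\<close>

lemma measurable_vimage_algebra_factor:
  fixes g :: "'a \<Rightarrow> real"
  assumes h: "h \<in> X \<rightarrow> space N" and g: "g \<in> borel_measurable (vimage_algebra X h N)"
  obtains g' where "g' \<in> borel_measurable N" "\<And>x. x \<in> X \<Longrightarrow> g x = g' (h x)"
proof -
  have "\<exists>B\<in>sets N. {x \<in> X. g x \<le> of_rat q} = h -` B \<inter> X" for q
  proof -
    have "{x \<in> space (vimage_algebra X h N). g x \<le> of_rat q} \<in> sets (vimage_algebra X h N)"
      using g by measurable
    then show ?thesis by (auto simp: sets_vimage_algebra2[OF h])
  qed
  then obtain B where B: "\<And>q. B q \<in> sets N" "\<And>q. {x \<in> X. g x \<le> of_rat q} = h -` B q \<inter> X" by metis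
  define k where "k y = (INF q. if y \<in> B q then ereal (of_rat q) else \<infinity>)" for y
  have [measurable]: "k \<in> borel_measurable N"
    unfolding k_def using B(1) by measurable
  have "k (h x) = ereal (g x)" if x: "x \<in> X" for x
  proof -
    have iff: "h x \<in> B q \<longleftrightarrow> g x \<le> of_rat q" for q using B(2)[of q] x by blast
    show ?thesis unfolding k_def iff
    proof (rule antisym)
      show "ereal (g x) \<le> (INF q. if g x \<le> of_rat q then ereal (of_rat q) else \<infinity>)"
        by (rule INF_greatest) auto
      show "(INF q. if g x \<le> of_rat q then ereal (of_rat q) else \<infinity>) \<le> ereal (g x)"
      proof (rule ereal_le_epsilon2)
        fix e :: real assume "0 < e"
        then obtain q where q: "g x < of_rat q" "of_rat q < g x + e"
          using of_rat_dense[of "g x" "g x + e"] by auto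
        have "(INF q. if g x \<le> of_rat q then ereal (of_rat q) else \<infinity>)
            \<le> (if g x \<le> of_rat q then ereal (of_rat q) else \<infinity>)"
          by (rule INF_lower) simp
        also have "\<dots> \<le> ereal (g x) + ereal e" using q by simp
        finally show "(INF q. if g x \<le> of_rat q then ereal (of_rat q) else \<infinity>) \<le> ereal (g x) + ereal e" .
      qed
    qed
  qed
  then have "g x = real_of_ereal (k (h x))" if "x \<in> X" for x using that by simp
  moreover have "(\<lambda>y. real_of_ereal (k y)) \<in> borel_measurable N" by measurable
  ultimately show thesis using that by blast
qed


section \<open>The Borel structure of a finite dimensional dual\<close>

lemma fin_dim_subspaces_span: "finite B \<Longrightarrow> span B \<in> fin_dim_subspaces"
  by (auto simp: fin_dim_subspaces_def)

lemma fin_dim_subspaces_subspace: "R \<in> fin_dim_subspaces \<Longrightarrow> subspace R"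
  by (auto simp: fin_dim_subspaces_def)

lemma fin_dim_subspaces_directed:
  assumes "R \<in> fin_dim_subspaces" "S \<in> fin_dim_subspaces"
  shows "\<exists>F\<in>fin_dim_subspaces. R \<subseteq> F \<and> S \<subseteq> F"
proof -
  obtain A B where "finite A" "span A = R" "finite B" "span B = S"
    using assms by (auto simp: fin_dim_subspaces_def)
  then show ?thesis
    by (intro bexI[of _ "span (A \<union> B)"] fin_dim_subspaces_span) (auto intro: span_mono[THEN subsetD])
qed

lemma basis_of:
  assumes "R \<in> fin_dim_subspaces"
  shows "independent (basis_of R)" "span (basis_of R) = R" "finite (basis_of R)" "basis_of R \<subseteq> R"
proof -
  obtain C where C: "finite C" "span C = R" using assms by (auto simp: fin_dim_subspaces_def)
  obtain B where B: "B \<subseteq> R" "independent B" "R \<subseteq> span B" by (rule maximal_independent_subset)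
  have "span B = R"
    using B span_minimal[OF B(1) fin_dim_subspaces_subspace[OF assms]] by auto
  then have "\<exists>B. independent B \<and> span B = R" using B by blast
  then show *: "independent (basis_of R)" "span (basis_of R) = R"
    unfolding basis_of_def by (metis (mono_tags, lifting) someI_ex)+
  then show "basis_of R \<subseteq> R" using span_superset by metis
  then show "finite (basis_of R)"
    using independent_span_bound[OF C(1) *(1)] C(2) by simp
qed

lemma alg_dual_sum:
  assumes R: "subspace R" and l: "l \<in> alg_dual R" and "finite A" "A \<subseteq> R"
  shows "l (\<Sum>b\<in>A. c b *\<^sub>R b) = (\<Sum>b\<in>A. c b * l b)"
proof -
  have add: "l (x + y) = l x + l y" if "x \<in> R" "y \<in> R" for x y
    using l that by (simp add: alg_dual_def)
  have scale: "l (a *\<^sub>R x) = a * l x" if "x \<in> R" for a x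
    using l that by (simp add: alg_dual_def)
  show ?thesis
    using assms(3,4)
  proof (induction rule: finite_induct)
    case empty
    then show ?case using scale[OF subspace_0[OF R], of 0] by simp
  next
    case (insert b A)
    have "(\<Sum>b\<in>A. c b *\<^sub>R b) \<in> R" "c b *\<^sub>R b \<in> R"
      using insert.prems R by (auto intro!: subspace_sum subspace_scale)
    then show ?case
      using insert by (simp add: add scale)
  qed
qed

lemma alg_dual_eq_sum_basis:
  assumes R: "R \<in> fin_dim_subspaces" and l: "l \<in> alg_dual R" and \<xi>: "\<xi> \<in> R"
  shows "l \<xi> = (\<Sum>b\<in>basis_of R. representation (basis_of R) \<xi> b * l b)"
proof -
  note B = basis_of[OF R]
  have "(\<Sum>b\<in>basis_of R. representation (basis_of R) \<xi> b *\<^sub>R b) = \<xi>"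
    using B \<xi> by (intro sum_representation_eq) auto
  then show ?thesis
    using alg_dual_sum[OF fin_dim_subspaces_subspace[OF R] l B(3,4)] by metis
qed

lemma open_real_contains_rat_interval:
  fixes x :: real
  assumes "open U" "x \<in> U"
  shows "\<exists>q :: rat \<times> rat. x \<in> {of_rat (fst q)<..<of_rat (snd q)} \<and>
    {of_rat (fst q)<..<of_rat (snd q)} \<subseteq> U"
proof -
  obtain e where e: "0 < e" "ball x e \<subseteq> U" using assms by (auto simp: open_contains_ball)
  obtain r s where "x - e < of_rat r" "of_rat r < x" "x < of_rat s" "of_rat s < x + e"
    using of_rat_dense[of "x - e" x] of_rat_dense[of x "x + e"] e(1) by auto
  then have "x \<in> {of_rat r<..<of_rat s}" "{of_rat r<..<of_rat s} \<subseteq> ball x e"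
    by (auto simp: ball_def dist_real_def)
  then show ?thesis using e(2) by (intro exI[of _ "(r, s)"]) simp
qed

lemma openin_powertop_real_countable_boxes:
  assumes B: "finite B" and W: "openin (powertop_real B) W"
  obtains C :: "('b \<Rightarrow> rat \<times> rat) set" where "countable C"
    "W = (\<Union>q\<in>C. \<Pi>\<^sub>E b\<in>B. {of_rat (fst (q b))<..<of_rat (snd (q b))})"
proof -
  define box where "box q = (\<Pi>\<^sub>E b\<in>B. {of_rat (fst (q b))<..<of_rat (snd (q b)) :: real})"
    for q :: "'b \<Rightarrow> rat \<times> rat"
  define C where "C = {q \<in> B \<rightarrow>\<^sub>E UNIV. box q \<subseteq> W}"
  have "countable (B \<rightarrow>\<^sub>E (UNIV :: (rat \<times> rat) set))" using B by (intro countable_PiE) auto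
  then have "countable C" by (rule countable_subset[rotated]) (auto simp: C_def)
  moreover have "W = (\<Union>q\<in>C. box q)"
  proof
    show "W \<subseteq> (\<Union>q\<in>C. box q)"
    proof
      fix x assume x: "x \<in> W"
      then obtain U where U: "\<forall>b\<in>B. openin euclideanreal (U b)" "x \<in> Pi\<^sub>E B U" "Pi\<^sub>E B U \<subseteq> W"
        using W unfolding openin_product_topology_alt by blast
      have "\<forall>b\<in>B. \<exists>q. x b \<in> {of_rat (fst q)<..<of_rat (snd q)} \<and>
          {of_rat (fst q)<..<of_rat (snd q)} \<subseteq> U b"
        using U by (intro ballI open_real_contains_rat_interval) auto
      from bchoice[OF this] obtain q' where q': "\<forall>b\<in>B. x b \<in> {of_rat (fst (q' b))<..<of_rat (snd (q' b))} \<and>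
          {of_rat (fst (q' b))<..<of_rat (snd (q' b))} \<subseteq> U b" ..
      define q where "q = restrict q' B"
      have "box q \<subseteq> Pi\<^sub>E B U" unfolding box_def q_def using q' by (intro PiE_mono) simp
      then have "q \<in> C" using U(3) by (auto simp: C_def q_def)
      moreover have "x \<in> box q" using q' U(2) by (auto simp: box_def q_def PiE_iff)
      ultimately show "x \<in> (\<Union>q\<in>C. box q)" by blast
    qed
  qed (auto simp: C_def)
  ultimately show thesis using that unfolding box_def by blast
qed

lemma space_borel_of: "space (borel_of X) = topspace X"
  unfolding borel_of_def by (rule space_measure_of) (auto dest: openin_subset)

lemma sets_borel_of: "sets (borel_of X) = sigma_sets (topspace X) {U. openin X U}"
  unfolding borel_of_def by (rule sets_measure_of) (auto dest: openin_subset)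

lemma space_dual_borel: "space (borel_of (dual_euclid_top R)) = alg_dual R"
  by (simp add: space_borel_of topspace_dual_euclid_top)

lemma dual_borel_eval_basis_measurable:
  assumes "b \<in> basis_of R"
  shows "(\<lambda>l. l b) \<in> borel_measurable (borel_of (dual_euclid_top R))"
proof (rule borel_measurableI)
  fix S :: "real set" assume "open S"
  then have "openin (powertop_real (basis_of R))
      {x \<in> topspace (powertop_real (basis_of R)). x b \<in> S}"
    by (intro openin_continuous_map_preimage[OF continuous_map_product_projection[OF assms]])
      simp
  then have "openin (dual_euclid_top R) ((\<lambda>l. restrict l (basis_of R)) -`
      {x \<in> topspace (powertop_real (basis_of R)). x b \<in> S} \<inter> alg_dual R)"
    unfolding dual_euclid_top_def openin_pullback_topology by blast
  also have "(\<lambda>l. restrict l (basis_of R)) -`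
      {x \<in> topspace (powertop_real (basis_of R)). x b \<in> S} \<inter> alg_dual R
      = (\<lambda>l. l b) -` S \<inter> alg_dual R"
    using assms by auto
  finally show "(\<lambda>l. l b) -` S \<inter> space (borel_of (dual_euclid_top R))
      \<in> sets (borel_of (dual_euclid_top R))"
    by (auto simp: sets_borel_of space_dual_borel)
qed

lemma dual_borel_eval_measurable:
  assumes R: "R \<in> fin_dim_subspaces" and \<xi>: "\<xi> \<in> R"
  shows "(\<lambda>l. l \<xi>) \<in> borel_measurable (borel_of (dual_euclid_top R))"
proof -
  have "(\<lambda>l. \<Sum>b\<in>basis_of R. representation (basis_of R) \<xi> b * l b)
      \<in> borel_measurable (borel_of (dual_euclid_top R))"
    by (intro borel_measurable_sum borel_measurable_times dual_borel_eval_basis_measurable) auto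
  then show ?thesis
    by (subst measurable_cong) (auto simp: space_dual_borel alg_dual_eq_sum_basis[OF R _ \<xi>])
qed

text \<open>
  As every open subset of \<open>\<real>\<^sup>B\<close> is a countable union of boxes, the Borel \<open>\<sigma>\<close>-algebra of \<open>R\<^sup>a\<close> is the one
  generated by the evaluations.
\<close>

lemma measurable_into_dual_borel:
  assumes R: "R \<in> fin_dim_subspaces" and h: "h \<in> space M \<rightarrow> alg_dual R"
    and ev: "\<And>b. b \<in> basis_of R \<Longrightarrow> (\<lambda>x. h x b) \<in> borel_measurable M"
  shows "h \<in> measurable M (borel_of (dual_euclid_top R))"
  unfolding borel_of_def
proof (rule measurable_measure_of)
  let ?B = "basis_of R"
  note B = basis_of[OF R]
  show "{U. openin (dual_euclid_top R) U} \<subseteq> Pow (topspace (dual_euclid_top R))"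
    by (auto dest: openin_subset)
  show "h \<in> space M \<rightarrow> topspace (dual_euclid_top R)"
    using h by (simp add: topspace_dual_euclid_top)
  fix U assume "U \<in> {U. openin (dual_euclid_top R) U}"
  then obtain W where W: "openin (powertop_real ?B) W"
    and U: "U = (\<lambda>l. restrict l ?B) -` W \<inter> alg_dual R"
    by (auto simp: dual_euclid_top_def openin_pullback_topology)
  obtain C where C: "countable C"
    and W_eq: "W = (\<Union>q\<in>C. \<Pi>\<^sub>E b\<in>?B. {of_rat (fst (q b))<..<of_rat (snd (q b))})"
    by (rule openin_powertop_real_countable_boxes[OF B(3) W])
  have "h -` U \<inter> space M
      = (\<Union>q\<in>C. {x \<in> space M. \<forall>b\<in>?B. h x b \<in> {of_rat (fst (q b))<..<of_rat (snd (q b))}})"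
    unfolding U W_eq using h by (auto simp: PiE_iff) blast
  moreover have "{x \<in> space M. \<forall>b\<in>?B. h x b \<in> {of_rat (fst (q b))<..<of_rat (snd (q b))}} \<in> sets M" for q
    by (rule sets_Collect_finite_all_mem[OF B(3) ev]) auto
  ultimately show "h -` U \<inter> space M \<in> sets M"
    using C by (auto intro!: sets.countable_UN' simp del: greaterThanLessThan_iff)
qed

text \<open>
  A linear combination of the coordinates is the evaluation at a vector of \<open>R\<close>, so the hypothesis
  gives the joint transform of the coordinates.  The boxes in these coordinates are stable under
  intersection and generate the Borel sets.
\<close>

lemma dual_measure_eqI_char:
  assumes R: "R \<in> fin_dim_subspaces"
    and M: "finite_measure M" "sets M = sets (borel_of (dual_euclid_top R))"
    and N: "finite_measure N" "sets N = sets (borel_of (dual_euclid_top R))"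
    and eq: "\<And>\<xi>. \<xi> \<in> R \<Longrightarrow> (\<integral>l. iexp (l \<xi>) \<partial>M) = (\<integral>l. iexp (l \<xi>) \<partial>N)"
  shows "M = N"
proof -
  let ?B = "basis_of R"
  note B = basis_of[OF R]
  interpret M: finite_measure M by fact
  interpret N: finite_measure N by fact
  have sp: "space M = alg_dual R" "space N = alg_dual R"
    using sets_eq_imp_space_eq[OF M(2)] sets_eq_imp_space_eq[OF N(2)] by (simp_all add: space_dual_borel)
  define E where "E = {{l \<in> alg_dual R. \<forall>b\<in>?B. l b \<in> A b} | A. \<forall>b. A b \<in> sets (borel :: real measure)}"
  have box: "{l \<in> alg_dual R. \<forall>b\<in>?B. l b \<in> A b} \<in> E" if "\<And>b. A b \<in> sets borel" for A
    using that unfolding E_def by blast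
  have E_sub: "E \<subseteq> Pow (alg_dual R)" by (auto simp: E_def)
  have ev: "(\<lambda>l. l b) \<in> borel_measurable (borel_of (dual_euclid_top R))" if "b \<in> R" for b
    by (rule dual_borel_eval_measurable[OF R that])
  have gen: "sets (borel_of (dual_euclid_top R)) = sigma_sets (alg_dual R) E"
  proof
    have "E \<subseteq> sets (borel_of (dual_euclid_top R))"
    proof
      fix Y assume "Y \<in> E"
      then obtain A where A: "\<And>b. A b \<in> sets borel" and Y: "Y = {l \<in> alg_dual R. \<forall>b\<in>?B. l b \<in> A b}"
        by (auto simp: E_def)
      have "{l \<in> space (borel_of (dual_euclid_top R)). \<forall>b\<in>?B. l b \<in> A b}
          \<in> sets (borel_of (dual_euclid_top R))"
        by (rule sets_Collect_finite_all_mem[OF B(3) dual_borel_eval_basis_measurable A])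
      then show "Y \<in> sets (borel_of (dual_euclid_top R))" by (simp add: Y space_dual_borel)
    qed
    then show "sigma_sets (alg_dual R) E \<subseteq> sets (borel_of (dual_euclid_top R))"
      using sets.sigma_sets_subset[of E "borel_of (dual_euclid_top R)"] by (simp add: space_dual_borel)
    have "(\<lambda>l. l) \<in> measurable (sigma (alg_dual R) E) (borel_of (dual_euclid_top R))"
    proof (rule measurable_into_dual_borel[OF R])
      show "(\<lambda>l. l) \<in> space (sigma (alg_dual R) E) \<rightarrow> alg_dual R"
        using E_sub by (simp add: space_measure_of)
      fix b assume b: "b \<in> ?B"
      show "(\<lambda>l. l b) \<in> borel_measurable (sigma (alg_dual R) E)"
      proof (rule borel_measurableI)
        fix S :: "real set" assume "open S"
        then have "{l \<in> alg_dual R. \<forall>c\<in>?B. l c \<in> (if c = b then S else UNIV)} \<in> E"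
          by (intro box) simp
        also have "{l \<in> alg_dual R. \<forall>c\<in>?B. l c \<in> (if c = b then S else UNIV)}
            = (\<lambda>l. l b) -` S \<inter> alg_dual R"
          using b by auto
        finally show "(\<lambda>l. l b) -` S \<inter> space (sigma (alg_dual R) E) \<in> sets (sigma (alg_dual R) E)"
          using E_sub by (simp add: space_measure_of sets_measure_of sigma_sets.Basic)
      qed
    qed
    from measurable_sets[OF this]
    have "Y \<inter> alg_dual R \<in> sigma_sets (alg_dual R) E" if "Y \<in> sets (borel_of (dual_euclid_top R))" for Y
      using that E_sub by (simp add: space_measure_of sets_measure_of)
    moreover have "Y \<inter> alg_dual R = Y" if "Y \<in> sets (borel_of (dual_euclid_top R))" for Y
      using sets.sets_into_space[OF that] by (auto simp: space_dual_borel)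
    ultimately show "sets (borel_of (dual_euclid_top R)) \<subseteq> sigma_sets (alg_dual R) E"
      by auto
  qed
  show ?thesis
  proof (rule measure_eqI_generator_eq[where \<Omega> = "alg_dual R" and E = E and A = "\<lambda>_. alg_dual R"])
    show "Int_stable E"
    proof (rule Int_stableI)
      fix Y Y' assume "Y \<in> E" "Y' \<in> E"
      then obtain A A' where A: "\<And>b. A b \<in> sets borel" "Y = {l \<in> alg_dual R. \<forall>b\<in>?B. l b \<in> A b}"
        and A': "\<And>b. A' b \<in> sets borel" "Y' = {l \<in> alg_dual R. \<forall>b\<in>?B. l b \<in> A' b}"
        by (auto simp: E_def)
      have "{l \<in> alg_dual R. \<forall>b\<in>?B. l b \<in> A b \<inter> A' b} \<in> E"
        using A(1) A'(1) by (intro box sets.Int)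
      also have "{l \<in> alg_dual R. \<forall>b\<in>?B. l b \<in> A b \<inter> A' b} = Y \<inter> Y'"
        using A A' by auto
      finally show "Y \<inter> Y' \<in> E" .
    qed
    show "E \<subseteq> Pow (alg_dual R)" by (rule E_sub)
    show "sets M = sigma_sets (alg_dual R) E" "sets N = sigma_sets (alg_dual R) E"
      using M N gen by simp_all
    have "{l \<in> alg_dual R. \<forall>b\<in>?B. l b \<in> UNIV} \<in> E" by (rule box) simp
    then show "range (\<lambda>_::nat. alg_dual R) \<subseteq> E" by auto
    show "emeasure M (alg_dual R) \<noteq> \<infinity>" by simp
    fix Y assume "Y \<in> E"
    then obtain A where A: "\<And>b. A b \<in> sets borel" and Y: "Y = {l \<in> alg_dual R. \<forall>b\<in>?B. l b \<in> A b}"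
      by (auto simp: E_def)
    have "measure M {l \<in> space M. \<forall>b\<in>?B. l b \<in> A b} = measure N {l \<in> space N. \<forall>b\<in>?B. l b \<in> A b}"
    proof (rule joint_events_eqI_char[OF B(3) M(1) N(1) _ _ _ A])
      show "sets M = sets N" using M N by simp
      show "(\<lambda>l. l b) \<in> borel_measurable M" if "b \<in> ?B" for b
        using ev[of b] that B(4) M(2) by (auto cong: measurable_cong_sets)
      fix t
      have in_R: "(\<Sum>b\<in>?B. t b *\<^sub>R b) \<in> R"
        using B(4) by (intro subspace_sum subspace_scale fin_dim_subspaces_subspace[OF R]) auto
      have "l (\<Sum>b\<in>?B. t b *\<^sub>R b) = (\<Sum>b\<in>?B. t b * l b)" if "l \<in> alg_dual R" for l
        by (rule alg_dual_sum[OF fin_dim_subspaces_subspace[OF R] that B(3,4)])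
      then have sum_eq: "(\<integral>l. iexp (\<Sum>b\<in>?B. t b * l b) \<partial>L) = (\<integral>l. iexp (l (\<Sum>b\<in>?B. t b *\<^sub>R b)) \<partial>L)"
        if "space L = alg_dual R" for L
        using that by (intro Bochner_Integration.integral_cong refl) (simp only:)
      show "(\<integral>l. iexp (\<Sum>b\<in>?B. t b * l b) \<partial>M) = (\<integral>l. iexp (\<Sum>b\<in>?B. t b * l b) \<partial>N)"
        unfolding sum_eq[OF sp(1)] sum_eq[OF sp(2)] by (rule eq[OF in_R])
    qed
    then show "emeasure M Y = emeasure N Y"
      by (simp add: M.emeasure_eq_measure N.emeasure_eq_measure Y sp)
  qed auto
qed


section \<open>Restriction maps between duals\<close>

lemma space_cyl_algebra: "space (cyl_algebra :: ('e::real_vector \<Rightarrow> real) measure) = alg_dual UNIV"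
  unfolding cyl_algebra_def by (rule space_measure_of) auto

lemma sets_cyl_algebra: "sets (cyl_algebra :: ('e::real_vector \<Rightarrow> real) measure)
    = sigma_sets (alg_dual UNIV) {{l \<in> alg_dual UNIV. l \<xi> \<in> B} | \<xi> B. B \<in> sets borel}"
  unfolding cyl_algebra_def by (rule sets_measure_of) auto

lemma cyl_algebra_eval_measurable:
  "(\<lambda>l. l \<xi>) \<in> borel_measurable (cyl_algebra :: ('e::real_vector \<Rightarrow> real) measure)"
proof (rule borel_measurableI)
  fix S :: "real set" assume "open S"
  then have "{l \<in> alg_dual UNIV. l \<xi> \<in> S} \<in> sets (cyl_algebra :: ('e \<Rightarrow> real) measure)"
    unfolding sets_cyl_algebra by (intro sigma_sets.Basic CollectI exI[of _ \<xi>] exI[of _ S]) simp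
  moreover have "{l \<in> alg_dual UNIV. l \<xi> \<in> S} = (\<lambda>l. l \<xi>) -` S \<inter> space (cyl_algebra :: ('e \<Rightarrow> real) measure)"
    by (auto simp: space_cyl_algebra)
  ultimately show "(\<lambda>l. l \<xi>) -` S \<inter> space (cyl_algebra :: ('e \<Rightarrow> real) measure) \<in> sets cyl_algebra"
    by simp
qed

lemma restr_apply: "x \<in> R \<Longrightarrow> restr R l x = l x"
  by (simp add: restr_def)

lemma restr_in_dual:
  "\<lbrakk>R \<in> fin_dim_subspaces; R \<subseteq> F; l \<in> alg_dual F\<rbrakk> \<Longrightarrow> restr R l \<in> alg_dual R"
  by (intro restr_alg_dual fin_dim_subspaces_subspace)

lemma restr_measurable:
  assumes R: "R \<in> fin_dim_subspaces" and RF: "R \<subseteq> F" and sp: "space M = alg_dual F"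
    and ev: "\<And>\<xi>. \<xi> \<in> F \<Longrightarrow> (\<lambda>l. l \<xi>) \<in> borel_measurable M"
  shows "restr R \<in> measurable M (borel_of (dual_euclid_top R))"
proof (rule measurable_into_dual_borel[OF R])
  show "restr R \<in> space M \<rightarrow> alg_dual R"
    using restr_in_dual[OF R RF] sp by auto
  show "(\<lambda>l. restr R l b) \<in> borel_measurable M" if "b \<in> basis_of R" for b
    using ev[of b] basis_of(4)[OF R] RF that by (auto simp: restr_apply subset_iff)
qed

text \<open>
  The image of a corresponding measure has the Fourier transform of the corresponding measure on
  the smaller space, so restriction maps preserve the measures.
\<close>

lemma restr_measure_preserving:
  fixes ch :: "'e::real_vector \<Rightarrow> complex"
  assumes R: "R \<in> fin_dim_subspaces" and RF: "R \<subseteq> F"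
    and M: "corresponding_measure ch F A M" and N: "corresponding_measure ch R (borel_of (dual_euclid_top R)) N"
    and sp: "space A = alg_dual F" and ev: "\<And>\<xi>. \<xi> \<in> F \<Longrightarrow> (\<lambda>l. l \<xi>) \<in> borel_measurable A"
  shows "restr R \<in> measurable M N" "distr M N (restr R) = N"
proof -
  have sets: "sets M = sets A" "sets N = sets (borel_of (dual_euclid_top R))"
    and fin: "finite_measure M" "finite_measure N"
    using M N by (auto simp: corresponding_measure_def)
  have "restr R \<in> measurable A (borel_of (dual_euclid_top R))"
    by (rule restr_measurable[OF R RF sp ev])
  then show meas: "restr R \<in> measurable M N"
    by (simp add: measurable_cong_sets[OF sets])
  have evN: "(\<lambda>l. l \<xi>) \<in> borel_measurable N" if "\<xi> \<in> R" for \<xi>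
    using dual_borel_eval_measurable[OF R that] by (simp add: measurable_cong_sets[OF sets(2) refl])
  show "distr M N (restr R) = N"
  proof (rule dual_measure_eqI_char[OF R])
    show "finite_measure (distr M N (restr R))"
      using fin(1) meas by (rule finite_measure.finite_measure_distr)
    show "finite_measure N" by fact
    show "sets (distr M N (restr R)) = sets (borel_of (dual_euclid_top R))"
      "sets N = sets (borel_of (dual_euclid_top R))" using sets by simp_all
    fix \<xi> assume \<xi>: "\<xi> \<in> R"
    have [measurable]: "(\<lambda>l. l \<xi>) \<in> borel_measurable N" by (rule evN[OF \<xi>])
    have "(\<integral>l. iexp (l \<xi>) \<partial>(distr M N (restr R))) = (\<integral>l. iexp (restr R l \<xi>) \<partial>M)"
      by (rule integral_distr[OF meas]) measurable
    also have "\<dots> = ch \<xi>"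
      using M \<xi> RF by (auto simp: corresponding_measure_def restr_apply)
    also have "\<dots> = (\<integral>l. iexp (l \<xi>) \<partial>N)"
      using N \<xi> by (auto simp: corresponding_measure_def)
    finally show "(\<integral>l. iexp (l \<xi>) \<partial>(distr M N (restr R))) = (\<integral>l. iexp (l \<xi>) \<partial>N)" .
  qed
qed

lemma space_cyl_subalgebra: "space (cyl_subalgebra R) = alg_dual UNIV"
  by (simp add: cyl_subalgebra_def)

lemma sets_cyl_subalgebra:
  fixes R :: "'e::real_vector set"
  assumes "R \<in> fin_dim_subspaces"
  shows "sets (cyl_subalgebra R)
    = {restr R -` B \<inter> alg_dual UNIV | B. B \<in> sets (borel_of (dual_euclid_top R))}"
  unfolding cyl_subalgebra_def using restr_in_dual[OF assms]
  by (intro sets_vimage_algebra2) (auto simp: space_dual_borel)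

lemma cyl_subalgebra_eval_measurable:
  fixes F :: "'e::real_vector set"
  assumes F: "F \<in> fin_dim_subspaces" and \<xi>: "\<xi> \<in> F"
  shows "(\<lambda>l. l \<xi>) \<in> borel_measurable (cyl_subalgebra F)"
proof -
  have "restr F \<in> measurable (cyl_subalgebra F) (borel_of (dual_euclid_top F))"
    unfolding cyl_subalgebra_def using restr_in_dual[OF F]
    by (intro measurable_vimage_algebra1) (auto simp: space_dual_borel)
  from measurable_compose[OF this dual_borel_eval_measurable[OF F \<xi>]]
  show ?thesis using \<xi> by (simp add: restr_apply)
qed

lemma cyl_subalgebra_mono:
  fixes R F :: "'e::real_vector set"
  assumes R: "R \<in> fin_dim_subspaces" and F: "F \<in> fin_dim_subspaces" and RF: "R \<subseteq> F"
  shows "sets (cyl_subalgebra R) \<subseteq> sets (cyl_subalgebra F)"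
proof -
  have "restr R \<in> measurable (cyl_subalgebra F) (borel_of (dual_euclid_top R))"
  proof (rule measurable_into_dual_borel[OF R])
    show "restr R \<in> space (cyl_subalgebra F) \<rightarrow> alg_dual R"
      using restr_in_dual[OF R subset_UNIV] by (auto simp: space_cyl_subalgebra)
    show "(\<lambda>l. restr R l b) \<in> borel_measurable (cyl_subalgebra F)" if "b \<in> basis_of R" for b
      using cyl_subalgebra_eval_measurable[OF F, of b] basis_of(4)[OF R] RF that
      by (auto simp: restr_apply subset_iff)
  qed
  from measurable_sets[OF this] show ?thesis
    by (auto simp: sets_cyl_subalgebra[OF R] space_cyl_subalgebra)
qed

lemma cyl_subalgebra_subalgebra:
  fixes R :: "'e::real_vector set"
  assumes R: "R \<in> fin_dim_subspaces"
  shows "subalgebra (cyl_algebra :: ('e \<Rightarrow> real) measure) (cyl_subalgebra R)"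
proof -
  have "restr R \<in> measurable cyl_algebra (borel_of (dual_euclid_top R))"
    by (rule restr_measurable[OF R subset_UNIV space_cyl_algebra cyl_algebra_eval_measurable])
  from measurable_sets[OF this] show ?thesis
    by (auto simp: subalgebra_def space_cyl_subalgebra space_cyl_algebra sets_cyl_subalgebra[OF R])
qed

text \<open>A generator of the cylinder \<open>\<sigma>\<close>-algebra depends on the value at one vector \<open>\<xi>\<close>, so \<open>R = span {\<xi>}\<close> sees it.\<close>

lemma cyl_algebra_generated:
  "sets (cyl_algebra :: ('e::real_vector \<Rightarrow> real) measure)
    = sigma_sets (alg_dual UNIV) (\<Union>R\<in>fin_dim_subspaces. sets (cyl_subalgebra R))"
proof
  have "(\<Union>R\<in>fin_dim_subspaces. sets (cyl_subalgebra R)) \<subseteq> sets (cyl_algebra :: ('e \<Rightarrow> real) measure)"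
    using cyl_subalgebra_subalgebra by (auto simp: subalgebra_def)
  then show "sigma_sets (alg_dual UNIV) (\<Union>R\<in>fin_dim_subspaces. sets (cyl_subalgebra R))
      \<subseteq> sets (cyl_algebra :: ('e \<Rightarrow> real) measure)"
    using sets.sigma_sets_subset[of _ "cyl_algebra :: ('e \<Rightarrow> real) measure"] by (simp add: space_cyl_algebra)
  have "{l \<in> alg_dual UNIV. l \<xi> \<in> B} \<in> (\<Union>R\<in>fin_dim_subspaces. sets (cyl_subalgebra R))"
    if "B \<in> sets borel" for \<xi> :: 'e and B
  proof
    show F: "span {\<xi>} \<in> fin_dim_subspaces" by (rule fin_dim_subspaces_span) simp
    have "\<xi> \<in> span {\<xi>}" by (rule span_base) simp
    from measurable_sets[OF cyl_subalgebra_eval_measurable[OF F this] that]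
    show "{l \<in> alg_dual UNIV. l \<xi> \<in> B} \<in> sets (cyl_subalgebra (span {\<xi>}))"
      by (simp add: space_cyl_subalgebra vimage_def Int_def conj_commute)
  qed
  then show "sets (cyl_algebra :: ('e \<Rightarrow> real) measure)
      \<subseteq> sigma_sets (alg_dual UNIV) (\<Union>R\<in>fin_dim_subspaces. sets (cyl_subalgebra R))"
    unfolding sets_cyl_algebra by (intro sigma_sets_mono') blast
qed


section \<open>Co-Cauchy families as a directed colimit\<close>

lemma coLp_eq_colim_space:
  "coLp p \<nu> = colim_space fin_dim_subspaces (\<lambda>R. Lp p (\<nu> R)) (\<lambda>R F. Lp_pullback p (\<nu> F) (restr R))"
  by (simp only: coLp_def colim_space_def co_rel_def family_rel_def co_Cauchy_def cauchy_families_def)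

lemma co_rel_eq_family_rel:
  "co_rel p \<nu> = family_rel fin_dim_subspaces (\<lambda>R. Lp p (\<nu> R)) (\<lambda>R F. Lp_pullback p (\<nu> F) (restr R))"
  by (simp only: co_rel_def family_rel_def co_Cauchy_def cauchy_families_def)

lemma coLp_inj_eq_colim_inj:
  "coLp_inj p \<nu> = colim_inj fin_dim_subspaces (\<lambda>R. Lp p (\<nu> R)) (\<lambda>R F. Lp_pullback p (\<nu> F) (restr R))"
  by (simp only: fun_eq_iff coLp_inj_def colim_inj_def co_rel_eq_family_rel simp_thms)

lemma frakL_eq_colim_map:
  "frakL p \<mu> = colim_map fin_dim_subspaces (Lp p \<mu>) (\<lambda>R. Lp_pullback p \<mu> (restr R))"
  by (simp only: fun_eq_iff frakL_def colim_map_def family_limit_def[abs_def] simp_thms)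

text \<open>
  The condition on the cocone \<open>L\<^sup>p(E\<^sup>a, \<mu>)\<close> in the general colimit theorem is met by the preimages under \<open>\<phi>\<^sub>R\<^sup>*\<close>
  of the conditional expectations.  Their family is Cauchy with limit \<open>f\<close>, so its class is also
  the value of the inverse map at \<open>f\<close>.
\<close>

theorem theorem4p2:
  fixes ch :: "'e::real_vector \<Rightarrow> complex"
    and \<mu> :: "('e \<Rightarrow> real) measure"
    and \<nu> :: "'e set \<Rightarrow> ('e \<Rightarrow> real) measure"
    and p :: real
  assumes "(UNIV :: 'e set) \<notin> fin_dim_subspaces"
    and "char_function ch" and "ch 0 = 1"
    and "corresponding_measure ch UNIV cyl_algebra \<mu>"
    and "\<forall>R\<in>fin_dim_subspaces.
      corresponding_measure ch R (borel_of (dual_euclid_top R)) (\<nu> R)"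
    and "1 \<le> p"
  shows "let Z = (\<lambda>R. Lp p (\<nu> R));
             P = (\<lambda>R F. Lp_pullback p (\<nu> F) (restr R));
             \<Phi> = (\<lambda>R. Lp_pullback p \<mu> (restr R));
             \<Psi> = coLp_inj p \<nu>
    in realizes_colimit TYPE('y) fin_dim_subspaces Z P (coLp p \<nu>) \<Psi>
     \<and> (\<forall>C\<in>vcarrier (coLp p \<nu>). \<forall>f\<in>C.
          vlimit (Lp p \<mu>) (\<lambda>R. \<Phi> R (f R)) (frakL p \<mu> C) (net fin_dim_subspaces))
     \<and> cocone_iso fin_dim_subspaces Z P (coLp p \<nu>) \<Psi> (Lp p \<mu>) \<Phi> (frakL p \<mu>)
     \<and> (\<forall>A\<in>vcarrier (Lp p \<mu>). \<forall>R\<in>fin_dim_subspaces.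
          Lp_cond_exp p \<mu> (cyl_subalgebra R) A \<in> \<Phi> R ` vcarrier (Z R))
     \<and> cocone_iso fin_dim_subspaces Z P (Lp p \<mu>) \<Phi> (coLp p \<nu>) \<Psi> (frakL_inv p \<mu> \<nu>)
     \<and> (\<forall>C\<in>vcarrier (coLp p \<nu>). frakL_inv p \<mu> \<nu> (frakL p \<mu> C) = C)
     \<and> (\<forall>A\<in>vcarrier (Lp p \<mu>). frakL p \<mu> (frakL_inv p \<mu> \<nu> A) = A)"
proof -
  let ?I = "fin_dim_subspaces :: 'e set set"
  define Z where "Z = (\<lambda>R. Lp p (\<nu> R))"
  define P where "P = (\<lambda>R F. Lp_pullback p (\<nu> F) (restr R))"
  define \<Phi> where "\<Phi> = (\<lambda>R. Lp_pullback p \<mu> (restr R))"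
  let ?\<Psi> = "coLp_inj p \<nu>"
  note p = \<open>1 \<le> p\<close>
  note \<mu> = \<open>corresponding_measure ch UNIV cyl_algebra \<mu>\<close>
  have \<nu>: "corresponding_measure ch R (borel_of (dual_euclid_top R)) (\<nu> R)" if "R \<in> ?I" for R
    using assms(5) that by blast
  interpret \<mu>: finite_measure \<mu> using \<mu> by (simp add: corresponding_measure_def)
  have sets_\<mu>: "sets \<mu> = sets cyl_algebra" using \<mu> by (simp add: corresponding_measure_def)
  have space_\<mu>: "space \<mu> = alg_dual UNIV"
    using sets_eq_imp_space_eq[OF sets_\<mu>] by (simp add: space_cyl_algebra)
  have space_\<nu>: "space (\<nu> R) = alg_dual R" if "R \<in> ?I" for R
  proof -
    have "sets (\<nu> R) = sets (borel_of (dual_euclid_top R))"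
      using \<nu>[OF that] by (simp add: corresponding_measure_def)
    from sets_eq_imp_space_eq[OF this] show ?thesis by (simp add: space_dual_borel)
  qed
  have \<pi>: "restr R \<in> measurable (\<nu> F) (\<nu> R)" "distr (\<nu> F) (\<nu> R) (restr R) = \<nu> R"
    if "R \<in> ?I" "F \<in> ?I" "R \<subseteq> F" for R F
    using restr_measure_preserving[OF that(1,3) \<nu>[OF that(2)] \<nu>[OF that(1)] space_dual_borel
        dual_borel_eval_measurable[OF that(2)]] by simp_all
  have \<phi>: "restr R \<in> measurable \<mu> (\<nu> R)" "distr \<mu> (\<nu> R) (restr R) = \<nu> R"
    if "R \<in> ?I" for R
    using restr_measure_preserving[OF that subset_UNIV \<mu> \<nu>[OF that] space_cyl_algebra
        cyl_algebra_eval_measurable] by simp_all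
  have sub: "subalgebra \<mu> (cyl_subalgebra R)" if "R \<in> ?I" for R
    using cyl_subalgebra_subalgebra[OF that] sets_\<mu>
    by (simp add: subalgebra_def space_\<mu> space_cyl_algebra)

  have codiag: "codiagram ?I Z P"
    unfolding codiagram_def
  proof (intro conjI ballI impI; (elim conjE)?)
    show "banach_space_on (Z R)" for R unfolding Z_def by (rule banach_space_Lp[OF p])
    show "linear_isometry (Z R) (Z F) (P R F)" if "R \<in> ?I" "F \<in> ?I" "R \<le> F" for R F
      unfolding Z_def P_def by (rule linear_isometry_Lp_pullback[OF p \<pi>[OF that]])
    fix R z assume R: "R \<in> ?I" and "z \<in> vcarrier (Z R)"
    then obtain f where f: "f \<in> Lp_fun p (\<nu> R)" "z = Lp_class p (\<nu> R) f"
      unfolding Z_def by (blast elim: Lp_carrierE)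
    have "restr R l = l" if "l \<in> space (\<nu> R)" for l
      using that space_\<nu>[OF R] by (simp add: alg_dual_def restr_def extensional_restrict)
    then show "P R R z = z"
      unfolding P_def f(2) Lp_pullback_class[OF \<pi>[OF R R order_refl] f(1)]
      by (intro Lp_class_eqI AE_I2) simp
    fix F G assume FG: "F \<in> ?I" "G \<in> ?I" "R \<le> F" "F \<le> G"
    have "restr R (restr F l) = restr R l" for l :: "'e \<Rightarrow> real"
      using FG(3) by (auto simp: restr_def fun_eq_iff restrict_def)
    then have "(f \<circ> restr R) \<circ> restr F = f \<circ> restr R" by (simp add: comp_def)
    then show "P F G (P R F z) = P R G z"
      using Lp_fun_comp[OF \<pi>[OF R FG(1,3)] f(1)] order_trans[OF FG(3,4)]
      by (simp add: P_def f(2) Lp_pullback_class[OF \<pi>] R FG f(1))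
  qed
  interpret D: directed_codiagram ?I Z P
  proof
    show "?I \<noteq> {}" using fin_dim_subspaces_span[of "{}"] by blast
  qed (use codiag fin_dim_subspaces_directed in auto)
  have \<Phi>_class: "\<Phi> R (Lp_class p (\<nu> R) f) = Lp_class p \<mu> (f \<circ> restr R)"
    if "R \<in> ?I" "f \<in> Lp_fun p (\<nu> R)" for R f
    unfolding \<Phi>_def by (rule Lp_pullback_class[OF \<phi>[OF that(1)] that(2)])
  have cocone: "cocone ?I Z P (Lp p \<mu>) \<Phi>"
    unfolding cocone_def
  proof (intro conjI ballI impI)
    show "banach_space_on (Lp p \<mu>)" by (rule banach_space_Lp[OF p])
    show "linear_isometry (Z R) (Lp p \<mu>) (\<Phi> R)" if "R \<in> ?I" for R
      unfolding Z_def \<Phi>_def by (rule linear_isometry_Lp_pullback[OF p \<phi>[OF that]])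
    fix R F z assume RF: "R \<in> ?I" "F \<in> ?I" "R \<le> F" and "z \<in> vcarrier (Z R)"
    then obtain f where f: "f \<in> Lp_fun p (\<nu> R)" "z = Lp_class p (\<nu> R) f"
      unfolding Z_def by (blast elim: Lp_carrierE)
    have "restr R (restr F l) = restr R l" for l :: "'e \<Rightarrow> real"
      using RF(3) by (auto simp: restr_def fun_eq_iff restrict_def)
    then have "(f \<circ> restr R) \<circ> restr F = f \<circ> restr R" by (simp add: comp_def)
    then show "\<Phi> R z = \<Phi> F (P R F z)"
      using Lp_fun_comp[OF \<pi>[OF RF] f(1)]
      by (simp add: P_def f(2) Lp_pullback_class[OF \<pi>[OF RF] f(1)] \<Phi>_class RF f(1))
  qed

  \<comment> \<open>The representing family of \<open>A\<close>: the elements of \<open>Z R\<close> that correspond to the conditional expectations.\<close>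
  define g where "g A R = inv_into (vcarrier (Z R)) (\<Phi> R) (Lp_cond_exp p \<mu> (cyl_subalgebra R) A)"
    for A R
  have range: "Lp_cond_exp p \<mu> (cyl_subalgebra R) A \<in> \<Phi> R ` vcarrier (Z R)"
    if A: "A \<in> vcarrier (Lp p \<mu>)" and R: "R \<in> ?I" for A R
  proof -
    interpret E: finite_measure_subalgebra \<mu> "cyl_subalgebra R"
      by unfold_locales (rule sub[OF R])
    obtain f where f: "f \<in> Lp_fun p \<mu>" "A = Lp_class p \<mu> f" using A by (rule Lp_carrierE)
    have "real_cond_exp \<mu> (cyl_subalgebra R) f \<in> borel_measurable
        (vimage_algebra (alg_dual UNIV) (restr R) (borel_of (dual_euclid_top R)))"
      using borel_measurable_cond_exp by (simp add: cyl_subalgebra_def)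
    moreover have "restr R \<in> alg_dual UNIV \<rightarrow> space (borel_of (dual_euclid_top R))"
      using restr_in_dual[OF R subset_UNIV] by (auto simp: space_dual_borel)
    ultimately obtain h where h: "h \<in> borel_measurable (borel_of (dual_euclid_top R))"
      "\<And>l. l \<in> alg_dual UNIV \<Longrightarrow> real_cond_exp \<mu> (cyl_subalgebra R) f l = h (restr R l)"
      using measurable_vimage_algebra_factor by metis
    have sets_\<nu>: "sets (\<nu> R) = sets (borel_of (dual_euclid_top R))"
      using \<nu>[OF R] by (simp add: corresponding_measure_def)
    \<comment> \<open>Integrability of the factor \<open>h\<close> is transferred from \<open>h \<circ> restr R\<close> by measure preservation.\<close>
    have h_meas: "h \<in> borel_measurable (\<nu> R)"
      using h(1) by (simp add: measurable_cong_sets[OF sets_\<nu> refl])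
    have eq: "AE l in \<mu>. (h \<circ> restr R) l = real_cond_exp \<mu> (cyl_subalgebra R) f l"
      using h(2) by (intro AE_I2) (simp add: space_\<mu>)
    have "h \<circ> restr R \<in> Lp_fun p \<mu>"
      using measurable_comp[OF \<phi>(1)[OF R] h_meas] eq
      by (intro Lp_fun_cong_AE[OF E.Lp_cond_exp_fun(1)[OF p f(1)]])
    then have h_Lp: "h \<in> Lp_fun p (\<nu> R)"
      by (simp add: Lp_fun_comp_iff[OF \<phi>(1)[OF R] h_meas \<phi>(2)[OF R]])
    have "Lp_cond_exp p \<mu> (cyl_subalgebra R) A = \<Phi> R (Lp_class p (\<nu> R) h)"
      unfolding f(2) E.Lp_cond_exp_class[OF p f(1)] \<Phi>_class[OF R h_Lp]
      by (rule Lp_class_eqI[OF eq, symmetric])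
    then show ?thesis using Lp_carrierI[OF h_Lp] by (auto simp: Z_def)
  qed
  have g_in: "g A R \<in> vcarrier (Z R)" and \<Phi>_g: "\<Phi> R (g A R) = Lp_cond_exp p \<mu> (cyl_subalgebra R) A"
    if "A \<in> vcarrier (Lp p \<mu>)" "R \<in> ?I" for A R
    unfolding g_def using range[OF that] by (rule inv_into_into, rule f_inv_into_f)
  have g_lim: "vlimit (Lp p \<mu>) (\<lambda>R. \<Phi> R (g A R)) A (net ?I)" if A: "A \<in> vcarrier (Lp p \<mu>)" for A
  proof -
    obtain f where f: "f \<in> Lp_fun p \<mu>" "A = Lp_class p \<mu> f" using A by (rule Lp_carrierE)
    have norm: "vnorm (Lp p \<mu>) (vdiff (Lp p \<mu>) (\<Phi> R (g A R)) A)
        = Lp_norm p \<mu> (\<lambda>l. real_cond_exp \<mu> (cyl_subalgebra R) f l - f l)" if R: "R \<in> ?I" for R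
    proof -
      interpret E: finite_measure_subalgebra \<mu> "cyl_subalgebra R"
        by unfold_locales (rule sub[OF R])
      note Ef = E.Lp_cond_exp_fun(1)[OF p f(1)]
      show ?thesis
        unfolding \<Phi>_g[OF A R] unfolding f(2) E.Lp_cond_exp_class[OF p f(1)]
        by (simp add: Lp_diff_class[OF Ef f(1)] Lp_norm_class Lp_fun_diff[OF p Ef f(1)])
    qed
    have "((\<lambda>R. vnorm (Lp p \<mu>) (vdiff (Lp p \<mu>) (\<Phi> R (g A R)) A)) \<longlongrightarrow> 0) (net ?I)"
      unfolding tendsto_iff
    proof (intro allI impI)
      fix e :: real assume e: "0 < e"
      have "\<exists>R0\<in>?I. \<forall>R\<in>?I. sets (cyl_subalgebra R0) \<subseteq> sets (cyl_subalgebra R) \<longrightarrow>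
          Lp_norm p \<mu> (\<lambda>l. real_cond_exp \<mu> (cyl_subalgebra R) f l - f l) < e"
      proof (rule \<mu>.Lp_cond_exp_convergence[OF p D.nonempty _ sub _ f(1) e])
        fix R S assume "R \<in> ?I" "S \<in> ?I"
        then show "\<exists>F\<in>?I. sets (cyl_subalgebra R) \<subseteq> sets (cyl_subalgebra F) \<and>
            sets (cyl_subalgebra S) \<subseteq> sets (cyl_subalgebra F)"
          using fin_dim_subspaces_directed[of R S] cyl_subalgebra_mono by meson
      next
        show "sets \<mu> = sigma_sets (space \<mu>) (\<Union>R\<in>?I. sets (cyl_subalgebra R))"
          by (simp only: sets_\<mu> space_\<mu> cyl_algebra_generated)
      qed
      then obtain R0 where R0: "R0 \<in> ?I" "\<And>R. R \<in> ?I \<Longrightarrow>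
          sets (cyl_subalgebra R0) \<subseteq> sets (cyl_subalgebra R) \<Longrightarrow>
          Lp_norm p \<mu> (\<lambda>l. real_cond_exp \<mu> (cyl_subalgebra R) f l - f l) < e" by blast
      have "dist (vnorm (Lp p \<mu>) (vdiff (Lp p \<mu>) (\<Phi> R (g A R)) A)) 0 < e"
        if R: "R \<in> ?I" "R0 \<le> R" for R
        using R0(2)[OF R(1) cyl_subalgebra_mono[OF R0(1) R]] by (simp add: norm[OF R(1)] Lp_norm_nonneg)
      then show "\<forall>\<^sub>F R in net ?I. dist (vnorm (Lp p \<mu>) (vdiff (Lp p \<mu>) (\<Phi> R (g A R)) A)) 0 < e"
        unfolding D.eventually_net using R0(1) by blast
    qed
    then show ?thesis using A by (simp add: vlimit_def)
  qed
  have dense: "\<exists>f. (\<forall>R\<in>?I. f R \<in> vcarrier (Z R)) \<and> vlimit (Lp p \<mu>) (\<lambda>R. \<Phi> R (f R)) A (net ?I)"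
    if "A \<in> vcarrier (Lp p \<mu>)" for A
    using g_in[OF that] g_lim[OF that] by blast

  have coLp: "coLp p \<nu> = colim_space ?I Z P" and inj: "?\<Psi> = colim_inj ?I Z P"
    and L: "frakL p \<mu> = colim_map ?I (Lp p \<mu>) \<Phi>" and rel: "co_rel p \<nu> = family_rel ?I Z P"
    by (simp_all only: Z_def P_def \<Phi>_def coLp_eq_colim_space coLp_inj_eq_colim_inj
        frakL_eq_colim_map co_rel_eq_family_rel)
  have iso: "cocone_iso ?I Z P (coLp p \<nu>) ?\<Psi> (Lp p \<mu>) \<Phi> (frakL p \<mu>)"
    and colim: "realizes_colimit TYPE('y) ?I Z P (coLp p \<nu>) ?\<Psi>"
    unfolding coLp inj L by (rule D.colim_space_colimit[OF cocone dense]; assumption)+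
  have L_lim: "vlimit (Lp p \<mu>) (\<lambda>R. \<Phi> R (f R)) (frakL p \<mu> C) (net ?I)"
    if "C \<in> vcarrier (coLp p \<nu>)" "f \<in> C" for C f
    using D.vlimit_colim_map[OF cocone] that unfolding coLp L by blast
  have inv: "frakL_inv p \<mu> \<nu> A \<in> vcarrier (coLp p \<nu>) \<and> frakL p \<mu> (frakL_inv p \<mu> \<nu> A) = A"
    if A: "A \<in> vcarrier (Lp p \<mu>)" for A
  proof -
    have eq: "frakL_inv p \<mu> \<nu> A = family_rel ?I Z P `` {restrict (g A) ?I}"
      unfolding frakL_inv_def rel g_def[abs_def] Z_def \<Phi>_def ..
    have mem: "restrict (g A) ?I \<in> (\<Pi>\<^sub>E R\<in>?I. vcarrier (Z R))" using g_in[OF A] by simp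
    have "\<forall>\<^sub>F R in net ?I. \<Phi> R (g A R) = \<Phi> R (restrict (g A) ?I R)"
      by (rule D.eventually_net_in) simp
    note lim = D.fam_lim_eqI[OF cocone mem vlimit_cong[OF this g_lim[OF A]]]
    show ?thesis
      unfolding eq coLp L D.colim_map_class[OF cocone lim(1)]
      using D.colim_carrierI[OF lim(1)] lim(2) by (rule conjI)
  qed
  have iso': "cocone_iso ?I Z P (Lp p \<mu>) \<Phi> (coLp p \<nu>) ?\<Psi> (frakL_inv p \<mu> \<nu>)"
    by (rule cocone_iso_inverse(1)[OF iso]) (rule inv)
  have left_inv: "frakL_inv p \<mu> \<nu> (frakL p \<mu> C) = C" if "C \<in> vcarrier (coLp p \<nu>)" for C
    by (rule cocone_iso_inverse(2)[OF iso _ that]) (rule inv)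
  show ?thesis
    unfolding Let_def Z_def[symmetric] P_def[symmetric] \<Phi>_def[symmetric]
    using colim L_lim iso range iso' left_inv inv by (intro conjI ballI) simp_all
qed

end
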